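(* Let $\lambda\in\Lambda^+$ and let $V(\lambda)$ be the finite-dimensional irreducible $o(10,\mathbb{C})$-module of highest weight $\lambda$. The $\mathcal{G}^{E_6}$-module $\widehat{V(\lambda)}$ (constructed with parameter $c$) is irreducible if $$c\in\mathbb{C}\setminus\big\{\flat(\lambda)-6+\mathbb{N},\ 2\ell_\omega(\lambda)+2\mathbb{N}\big\},$$ i.e. if $c\notin(\flat(\lambda)-6+\mathbb{N})\cup(2\ell_\omega(\lambda)+2\mathbb{N})$, where $\mathbb{N}$ is the set of nonnegative integers.
   Context: **The Lie algebra $\mathcal{G}^{E_6}$.** Let $\alpha_1,\dots,\alpha_6$ be the simple roots of $E_6$, where the Dynkin diagram has edges $\{1,3\},\{3,4\},\{4,5\},\{5,6\},\{2,4\}$. Let $Q=\bigoplus_{i=1}^6\mathbb{Z}\alpha_i$ with the symmetric $\mathbb{Z}$-bilinear form $(\cdot,\cdot)$ given by $(\alpha_i,\alpha_i)=2$, $(\alpha_i,\alpha_j)=-1$ if $\{i,j\}$ is an edge, $0$ otherwise; $\Phi_{E_6}=\{\alpha\in Q:(\alpha,\alpha)=2\}$. Define $F:Q\times Q\to\{1,-1\}$ by $$F\Big(\sum_i k_i\alpha_i,\sum_j l_j\alpha_j\Big)=(-1)^{\sum_{i=1}^6k_il_i+k_1l_3+k_4l_2+k_3l_4+k_5l_4+k_6l_5}.$$ Let $H=\bigoplus_{i=1}^6\mathbb{C}\alpha_i$ with the form extended bilinearly, and $\mathcal{G}^{E_6}=H\oplus\bigoplus_{\alpha\in\Phi_{E_6}}\mathbb{C}E_\alpha$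 with bracket $[H,H]=0$, $[h,E_\alpha]=-[E_\alpha,h]=(h,\alpha)E_\alpha$, $[E_\alpha,E_{-\alpha}]=-\alpha$, and for $\alpha+\beta\neq0$: $[E_\alpha,E_\beta]=F(\alpha,\beta)E_{\alpha+\beta}$ if $\alpha+\beta\in\Phi_{E_6}$, and $0$ if $\alpha+\beta\notin\Phi_{E_6}$. This is the simple Lie algebra of type $E_6$. Put $\Phi'=\Phi_{E_6}\cap\sum_{i=1}^5\mathbb{Z}\alpha_i$, $\mathcal{G}^{D_5}=\sum_{i=1}^5\mathbb{C}\alpha_i+\sum_{\beta\in\Phi'}\mathbb{C}E_\beta$, and $\mathcal{G}_0=\mathcal{G}^{D_5}+\mathbb{C}\alpha_6=\mathcal{G}^{D_5}\oplus\mathbb{C}\widehat\alpha$, where $\widehat\alpha=2\alpha_1+3\alpha_2+4\alpha_3+6\alpha_4+5\alpha_5+4\alpha_6$ commutes with $\mathcal{G}^{D_5}$. The positive roots not in $\Phi'$ are $\beta_1=\alpha_6$, $\beta_2=\alpha_5+\alpha_6$, $\beta_3=\alpha_4+\alpha_5+\alpha_6$, $\beta_4=\alpha_3+\alpha_4+\alpha_5+\alpha_6$, $\beta_5=\alpha_2+\alpha_4+\alpha_5+\alpha_6$, $\beta_6=\alpha_2+\alpha_3+\alpha_4+\alpha_5+\alpha_6$, $\beta_7=\alpha_1+\alpha_3+\alpha_4+\alpha_5+\alpha_6$, $\beta_8=\sum_{i=1}^6\alpha_i$, $\beta_9=\alpha_2+\alpha_3+2\alpha_4+\alpha_5+\alpha_6$,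 $\beta_{10}=\alpha_1+\alpha_2+\alpha_3+2\alpha_4+\alpha_5+\alpha_6$, $\beta_{11}=\alpha_2+\alpha_3+2\alpha_4+2\alpha_5+\alpha_6$, $\beta_{12}=\alpha_1+\alpha_2+2\alpha_3+2\alpha_4+\alpha_5+\alpha_6$, $\beta_{13}=\alpha_1+\alpha_2+\alpha_3+2\alpha_4+2\alpha_5+\alpha_6$, $\beta_{14}=\alpha_1+\alpha_2+2\alpha_3+2\alpha_4+2\alpha_5+\alpha_6$, $\beta_{15}=\alpha_1+\alpha_2+2\alpha_3+3\alpha_4+2\alpha_5+\alpha_6$, $\beta_{16}=\alpha_1+2\alpha_2+2\alpha_3+3\alpha_4+2\alpha_5+\alpha_6$. Set $\xi_i=E_{\beta_i}$, $\eta_i=E_{-\beta_i}$, $\mathcal{G}_+=\sum_i\mathbb{C}\xi_i$, $\mathcal{G}_-=\sum_i\mathbb{C}\eta_i$; then $\mathcal{G}^{E_6}=\mathcal{G}_-\oplus\mathcal{G}_0\oplus\mathcal{G}_+$ and $[\xi_r,\eta_i]\in\mathcal{G}_0$. **The isomorphism $\nu$.** $o(10,\mathbb{C})$ is the Lie algebra of $10\times10$ matrices spanned by $E_{i,j}-E_{5+j,5+i}$ ($1\le i,j\le5$), $E_{p,5+q}-E_{q,5+p}$ and $E_{5+p,q}-E_{5+q,p}$ ($1\le p<q\le5$). The Lie algebra isomorphism $\nu:o(10,\mathbb{C})\to\mathcal{G}^{D_5}$ is determined by $E_{1,2}-E_{7,6}\mapsto E_{\alpha_1}$, $E_{2,3}-E_{8,7}\mapsto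 E_{\alpha_3}$, $E_{3,4}-E_{9,8}\mapsto E_{\alpha_4}$, $E_{4,5}-E_{10,9}\mapsto E_{\alpha_5}$, $E_{4,10}-E_{5,9}\mapsto E_{\alpha_2}$, $E_{2,1}-E_{6,7}\mapsto -E_{-\alpha_1}$, $E_{3,2}-E_{7,8}\mapsto -E_{-\alpha_3}$, $E_{4,3}-E_{8,9}\mapsto -E_{-\alpha_4}$, $E_{5,4}-E_{9,10}\mapsto -E_{-\alpha_5}$, $E_{10,4}-E_{9,5}\mapsto -E_{-\alpha_2}$. **Differential operators.** $\mathcal{A}=\mathbb{C}[x_1,\dots,x_{16}]$. For $u\in\mathcal{G}_0$ write $[u,\eta_i]=\sum_{j}\varphi_{i,j}(u)\eta_j$ and set $u|_{\mathcal{A}}=\sum_{i,j=1}^{16}\varphi_{i,j}(u)x_j\partial_{x_i}$; $B\in o(10,\mathbb{C})$ acts on $\mathcal{A}$ by $\nu(B)|_{\mathcal{A}}$. Let $D=\sum_{i=1}^{16}x_i\partial_{x_i}$ and $\zeta_1=x_1x_{11}+x_2x_9-x_3x_6+x_4x_5$, $\zeta_2=x_1x_{13}+x_2x_{10}-x_3x_8+x_5x_7$, $\zeta_3=x_1x_{14}+x_2x_{12}-x_4x_8+x_6x_7$, $\zeta_4=x_1x_{15}-x_3x_{12}+x_4x_{10}-x_7x_9$, $\zeta_5=-x_2x_{15}-x_3x_{14}+x_4x_{13}-x_7x_{11}$, $\zeta_6=x_7x_{16}+x_8x_{15}+x_{10}x_{14}-x_{12}x_{13}$, $\zeta_7=-x_4x_{16}-x_6x_{15}-x_9x_{14}+x_{11}x_{12}$,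 $\zeta_8=x_3x_{16}+x_5x_{15}+x_9x_{13}-x_{10}x_{11}$, $\zeta_9=x_2x_{16}-x_5x_{14}+x_6x_{13}-x_8x_{11}$, $\zeta_{10}=x_1x_{16}+x_5x_{12}-x_6x_{10}+x_8x_9$, $$P_i=x_iD-\sum_{k=1}^{10}\zeta_k\sum_{j=1}^{16}\frac{\partial^2\zeta_k}{\partial x_i\partial x_j}\,\partial_{x_j}\qquad(1\le i\le16).$$ The space $U=\sum_{i=1}^{10}\mathbb{C}\zeta_i$ is an $o(10,\mathbb{C})$-submodule of $\mathcal{A}$ isomorphic to the 10-dimensional natural module with standard basis $\zeta_1,\dots,\zeta_{10}$. **The $\mathcal{G}^{E_6}$-module $\widehat M$.** Fix $c\in\mathbb{C}$. Let $M$ be an $o(10,\mathbb{C})$-module, $\widehat M=\mathcal{A}\otimes_{\mathbb{C}}M$, and write $fv=f\otimes v$. Let $\varrho_c:\mathcal{G}_0\to\mathrm{End}(M)$ be the linear map with $\varrho_c(u)v=\nu^{-1}(u)v$ for $u\in\mathcal{G}^{D_5}$ and $\varrho_c(\widehat\alpha)=2c\,\mathrm{id}_M$. Then $\widehat M$ is a $\mathcal{G}^{E_6}$-module via $$\xi_i(fv)=\partial_{x_i}(f)\,v,\qquad u(fv)=(u|_{\mathcal{A}}f)\,v+f\,\varrho_c(u)v\ \ (u\in\mathcal{G}_0),\qquad \eta_i(fv)=P_i(f)\,v+\sum_{r=1}^{16}x_rf\,\varrho_c([\xi_r,\eta_i])v,$$ for $f\in\mathcal{A}$, $v\in M$, $1\le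 i\le16$. **Weights of $o(10,\mathbb{C})$.** The Cartan subalgebra is spanned by $h_i=E_{i,i}-E_{5+i,5+i}$ ($1\le i\le5$), $\varepsilon_i(h_j)=\delta_{i,j}$, $(\varepsilon_i,\varepsilon_j)=\delta_{i,j}$ on $\sum_i\mathbb{Q}\varepsilon_i$. Positive roots: $\varepsilon_i\pm\varepsilon_j$, $i<j$. $\Lambda^+=\{\sum_{i=1}^5\mu_i\varepsilon_i:\mu_i\in\frac12\mathbb{Z},\ \mu_i-\mu_{i+1}\in\mathbb{N}\ (1\le i\le4),\ \mu_4+\mu_5\in\mathbb{N}\}$ is the set of dominant integral weights; $\rho=\sum_{i=1}^4(5-i)\varepsilon_i$; $\lambda_4=\frac12(\varepsilon_1+\varepsilon_2+\varepsilon_3+\varepsilon_4-\varepsilon_5)$. A singular vector is a nonzero weight vector annihilated by all positive root vectors of $o(10,\mathbb{C})$. **The number $\ell_\omega(\lambda)$.** Let $\Pi(\mathcal{A}_1)=\{\frac12\sum_{i=1}^5(-1)^{k_i}\varepsilon_i: k_i\in\{0,1\},\ \sum_ik_i\text{ odd}\}$ (the weights of $\mathcal{A}_1=\sum_i\mathbb{C}x_i$), $\Upsilon(\lambda)=\{\lambda+\mu:\mu\in\Pi(\mathcal{A}_1),\ \lambda+\mu\in\Lambda^+\}$, and $$\ell_\omega(\lambda)=\min\Big\{\tfrac12\big[(\lambda'+2\rho,\lambda')-(\lambda+2\rho,\lambda)-(\lambda_4+2\rho,\lambda_4)\big]:\lambda'\in\Upsilon(\lambda)\Big\}.$$ **The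 number $\flat(\lambda)$.** Let $\Upsilon'(\lambda)=\{\lambda+\mu:\mu\in\{\pm\varepsilon_1,\dots,\pm\varepsilon_5\},\ \lambda+\mu\in\Lambda^+\}$. With $UV(\lambda)=U\otimes V(\lambda)\subset\widehat{V(\lambda)}$ (tensor product $o(10,\mathbb{C})$-module) one has $UV(\lambda)\cong\bigoplus_{\lambda'\in\Upsilon'(\lambda)}V(\lambda')$. For $a\in\{1,\dots,10\}$ put $a'=a+5$ if $a\le5$ and $a'=a-5$ if $a>5$, and define $T'_a:V(\lambda)\to UV(\lambda)$ by $$T'_a(v)=\sum_{b=1}^{10}\zeta_b\,\big((E_{a,b}-E_{b',a'})v\big).$$ For $\lambda'\in\Upsilon'(\lambda)$ let $u=\sum_{i=1}^{10}\zeta_iu_i$ ($u_i\in V(\lambda)$) be a singular vector of weight $\lambda'$ in $UV(\lambda)$ (unique up to scalar); then $\sum_{i=1}^{10}T'_i(u_i)=\flat_{\lambda'}u$ for a scalar $\flat_{\lambda'}$. Set $\flat(\lambda)=\min\{\flat_{\lambda'}:\lambda'\in\Upsilon'(\lambda)\}$. *)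

theory Defs
  imports "HOL-Analysis.Analysis" "HOL-Library.Poly_Mapping"
begin

text \<open>
  The indices 1, ..., n of the finite index types \<open>5\<close>, \<open>6\<close>, \<open>10\<close>, \<open>16\<close> are written by numerals.
  These types are the integers modulo n, so there the last index n is the element 0; in
  particular the order on these types is never used. Indices that have to be compared or shifted
  are natural numbers, converted by \<open>of_nat\<close> where they select a component.
\<close>

definition lie_module ::
  "'g::ab_group_add set \<Rightarrow> (complex \<Rightarrow> 'g \<Rightarrow> 'g) \<Rightarrow> ('g \<Rightarrow> 'g \<Rightarrow> 'g) \<Rightarrow>
   (complex \<Rightarrow> 'm::ab_group_add \<Rightarrow> 'm) \<Rightarrow> ('g \<Rightarrow> 'm \<Rightarrow> 'm) \<Rightarrow> bool" where
  "lie_module L lscale lbracket smul act \<longleftrightarrow>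
     vector_space smul \<and>
     (\<forall>x\<in>L. Vector_Spaces.linear smul smul (act x)) \<and>
     (\<forall>x\<in>L. \<forall>y\<in>L. \<forall>v. act (x + y) v = act x v + act y v) \<and>
     (\<forall>a. \<forall>x\<in>L. \<forall>v. act (lscale a x) v = smul a (act x v)) \<and>
     (\<forall>x\<in>L. \<forall>y\<in>L. \<forall>v. act (lbracket x y) v = act x (act y v) - act y (act x v))"

definition irreducible_module ::
  "'g set \<Rightarrow> (complex \<Rightarrow> 'm::ab_group_add \<Rightarrow> 'm) \<Rightarrow> ('g \<Rightarrow> 'm \<Rightarrow> 'm) \<Rightarrow> bool" where
  "irreducible_module L smul act \<longleftrightarrow>
     (\<exists>w::'m. w \<noteq> 0) \<and>
     (\<forall>W. module.subspace smul W \<and> (\<forall>x\<in>L. \<forall>w\<in>W. act x w \<in> W) \<longrightarrow> W = {0} \<or> W = UNIV)"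

definition finite_dimensional :: "(complex \<Rightarrow> 'm::ab_group_add \<Rightarrow> 'm) \<Rightarrow> bool" where
  "finite_dimensional smul \<longleftrightarrow> (\<exists>B. finite B \<and> module.span smul B = UNIV)"

type_synonym lattice = "int ^ 6"

text \<open>A pair \<open>(h, f)\<close> stands for \<open>h + (\<Sum>\<alpha>. f(\<alpha>) E\<^sub>\<alpha>)\<close>, where \<open>h\<close> is given by its coordinates with
  respect to the simple roots.\<close>

type_synonym e6 = "(complex ^ 6) \<times> (lattice \<Rightarrow>\<^sub>0 complex)"

definition edges :: "(6 \<times> 6) set" where
  "edges = {(1,3), (3,4), (4,5), (5,6), (2,4)}"

definition cartan :: "6 \<Rightarrow> 6 \<Rightarrow> int" where
  "cartan i j = (if i = j then 2 else if (i,j) \<in> edges \<or> (j,i) \<in> edges then -1 else 0)"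

definition qform :: "lattice \<Rightarrow> lattice \<Rightarrow> int" where
  "qform \<alpha> \<beta> = (\<Sum>i\<in>UNIV. \<Sum>j\<in>UNIV. \<alpha> $ i * \<beta> $ j * cartan i j)"

definition hform :: "complex ^ 6 \<Rightarrow> lattice \<Rightarrow> complex" where
  "hform h \<beta> = (\<Sum>i\<in>UNIV. \<Sum>j\<in>UNIV. h $ i * of_int (\<beta> $ j * cartan i j))"

definition Phi :: "lattice set" where
  "Phi = {\<alpha>. qform \<alpha> \<alpha> = 2}"

definition Phi' :: "lattice set" where
  "Phi' = {\<alpha> \<in> Phi. \<alpha> $ 6 = 0}"

definition Fsign :: "lattice \<Rightarrow> lattice \<Rightarrow> complex" where
  "Fsign k l = (if even ((\<Sum>i\<in>UNIV. k $ i * l $ i) + k $ 1 * l $ 3 + k $ 4 * l $ 2 + k $ 3 * l $ 4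
                      + k $ 5 * l $ 4 + k $ 6 * l $ 5) then 1 else -1)"

definition escale :: "complex \<Rightarrow> e6 \<Rightarrow> e6" where
  "escale a x = (a *s fst x, Poly_Mapping.map ((*) a) (snd x))"

definition GE6 :: "e6 set" where
  "GE6 = {x. Poly_Mapping.keys (snd x) \<subseteq> Phi}"

definition Eroot :: "lattice \<Rightarrow> e6" where
  "Eroot \<alpha> = (0, Poly_Mapping.single \<alpha> 1)"

definition of_root :: "lattice \<Rightarrow> e6" where
  "of_root \<alpha> = ((\<chi> i. of_int (\<alpha> $ i)), 0)"

definition root_bracket :: "lattice \<Rightarrow> lattice \<Rightarrow> e6" where
  "root_bracket \<alpha> \<beta> =
     (if \<alpha> + \<beta> = 0 then - of_root \<alpha>
      else if \<alpha> + \<beta> \<in> Phi then escale (Fsign \<alpha> \<beta>) (Eroot (\<alpha> + \<beta>))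
      else 0)"

definition bracket :: "e6 \<Rightarrow> e6 \<Rightarrow> e6" where
  "bracket x y =
     (\<Sum>\<beta>\<in>Poly_Mapping.keys (snd y).
        escale (hform (fst x) \<beta> * Poly_Mapping.lookup (snd y) \<beta>) (Eroot \<beta>))
   - (\<Sum>\<alpha>\<in>Poly_Mapping.keys (snd x).
        escale (hform (fst y) \<alpha> * Poly_Mapping.lookup (snd x) \<alpha>) (Eroot \<alpha>))
   + (\<Sum>\<alpha>\<in>Poly_Mapping.keys (snd x). \<Sum>\<beta>\<in>Poly_Mapping.keys (snd y).
        escale (Poly_Mapping.lookup (snd x) \<alpha> * Poly_Mapping.lookup (snd y) \<beta>)
          (root_bracket \<alpha> \<beta>))"

definition GD5 :: "e6 set" where
  "GD5 = {x. fst x $ 6 = 0 \<and> Poly_Mapping.keys (snd x) \<subseteq> Phi'}"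

definition alhat :: e6 where
  "alhat = (vector [2, 3, 4, 6, 5, 4], 0)"

definition beta :: "nat \<Rightarrow> lattice" where
  "beta i =
    [vector [0,0,0,0,0,1], vector [0,0,0,0,1,1], vector [0,0,0,1,1,1], vector [0,0,1,1,1,1],
     vector [0,1,0,1,1,1], vector [0,1,1,1,1,1], vector [1,0,1,1,1,1], vector [1,1,1,1,1,1],
     vector [0,1,1,2,1,1], vector [1,1,1,2,1,1], vector [0,1,1,2,2,1], vector [1,1,2,2,1,1],
     vector [1,1,1,2,2,1], vector [1,1,2,2,2,1], vector [1,1,2,3,2,1], vector [1,2,2,3,2,1]]
    ! (i - 1)"

definition xi :: "nat \<Rightarrow> e6" where
  "xi i = Eroot (beta i)"

definition eta :: "nat \<Rightarrow> e6" where
  "eta i = Eroot (- beta i)"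

definition G0_part :: "e6 \<Rightarrow> e6" where
  "G0_part x = (fst x, (\<Sum>\<alpha>\<in>Poly_Mapping.keys (snd x) \<inter> Phi'.
                          Poly_Mapping.single \<alpha> (Poly_Mapping.lookup (snd x) \<alpha>)))"

type_synonym mat10 = "complex ^ 10 ^ 10"

definition mscale :: "complex \<Rightarrow> mat10 \<Rightarrow> mat10" where
  "mscale a A = (\<chi> i j. a * A $ i $ j)"

definition mbracket :: "mat10 \<Rightarrow> mat10 \<Rightarrow> mat10" where
  "mbracket A B = A ** B - B ** A"

definition Emat :: "nat \<Rightarrow> nat \<Rightarrow> mat10" where
  "Emat p q = (\<chi> i j. if i = of_nat p \<and> j = of_nat q then 1 else 0)"

definition o10 :: "mat10 set" where
  "o10 = module.span mscale
     ({Emat i j - Emat (5 + j) (5 + i) | i j. i \<in> {1..5} \<and> j \<in> {1..5}}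
      \<union> {Emat p (5 + q) - Emat q (5 + p) | p q. 1 \<le> p \<and> p < q \<and> q \<le> 5}
      \<union> {Emat (5 + p) q - Emat (5 + q) p | p q. 1 \<le> p \<and> p < q \<and> q \<le> 5})"

text \<open>The root vectors for \<open>\<epsilon>\<^sub>i - \<epsilon>\<^sub>j\<close> and \<open>\<epsilon>\<^sub>i + \<epsilon>\<^sub>j\<close>, where \<open>i < j\<close>.\<close>

definition pos_root_vectors :: "mat10 set" where
  "pos_root_vectors =
     {Emat i j - Emat (5 + j) (5 + i) | i j. 1 \<le> i \<and> i < j \<and> j \<le> 5}
     \<union> {Emat i (5 + j) - Emat j (5 + i) | i j. 1 \<le> i \<and> i < j \<and> j \<le> 5}"

text \<open>A weight \<open>\<Sum>\<^sub>i \<mu>\<^sub>i \<epsilon>\<^sub>i\<close> is the vector of its coordinates \<open>\<mu>\<^sub>i\<close>.\<close>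

definition eps :: "5 \<Rightarrow> real ^ 5" where
  "eps i = axis i 1"

definition dominant :: "(real ^ 5) set" where
  "dominant = {\<mu>. (\<forall>i. 2 * \<mu> $ i \<in> \<int>) \<and>
                  (\<forall>i\<in>{1..4::nat}. \<mu> $ of_nat i - \<mu> $ of_nat (i + 1) \<in> \<nat>) \<and>
                  \<mu> $ 4 + \<mu> $ 5 \<in> \<nat>}"

definition rho :: "real ^ 5" where
  "rho = (\<Sum>i\<in>{1..4::nat}. (5 - real i) *\<^sub>R eps (of_nat i))"

definition lambda4 :: "real ^ 5" where
  "lambda4 = (1/2) *\<^sub>R (eps 1 + eps 2 + eps 3 + eps 4 - eps 5)"

definition singular_vector ::
  "(complex \<Rightarrow> 'm::ab_group_add \<Rightarrow> 'm) \<Rightarrow> (mat10 \<Rightarrow> 'm \<Rightarrow> 'm) \<Rightarrow> real ^ 5 \<Rightarrow> 'm \<Rightarrow> bool" where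
  "singular_vector smul act \<mu> w \<longleftrightarrow>
     w \<noteq> 0 \<and>
     (\<forall>i\<in>{1..5::nat}. act (Emat i i - Emat (5 + i) (5 + i)) w
                        = smul (complex_of_real (\<mu> $ of_nat i)) w) \<and>
     (\<forall>B\<in>pos_root_vectors. act B w = 0)"

definition is_irreducible_highest_weight_module ::
  "(complex \<Rightarrow> 'v::ab_group_add \<Rightarrow> 'v) \<Rightarrow> (mat10 \<Rightarrow> 'v \<Rightarrow> 'v) \<Rightarrow> real ^ 5 \<Rightarrow> bool" where
  "is_irreducible_highest_weight_module smul act lam \<longleftrightarrow>
     lie_module o10 mscale mbracket smul act \<and>
     finite_dimensional smul \<and>
     irreducible_module o10 smul act \<and>
     (\<exists>v. singular_vector smul act lam v)"

definition is_nu :: "(mat10 \<Rightarrow> e6) \<Rightarrow> bool" where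
  "is_nu \<nu> \<longleftrightarrow>
     bij_betw \<nu> o10 GD5 \<and>
     (\<forall>A\<in>o10. \<forall>B\<in>o10. \<nu> (A + B) = \<nu> A + \<nu> B) \<and>
     (\<forall>a. \<forall>A\<in>o10. \<nu> (mscale a A) = escale a (\<nu> A)) \<and>
     (\<forall>A\<in>o10. \<forall>B\<in>o10. \<nu> (mbracket A B) = bracket (\<nu> A) (\<nu> B)) \<and>
     \<nu> (Emat 1 2 - Emat 7 6) = Eroot (axis 1 1) \<and>
     \<nu> (Emat 2 3 - Emat 8 7) = Eroot (axis 3 1) \<and>
     \<nu> (Emat 3 4 - Emat 9 8) = Eroot (axis 4 1) \<and>
     \<nu> (Emat 4 5 - Emat 10 9) = Eroot (axis 5 1) \<and>
     \<nu> (Emat 4 10 - Emat 5 9) = Eroot (axis 2 1) \<and>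
     \<nu> (Emat 2 1 - Emat 6 7) = - Eroot (- axis 1 1) \<and>
     \<nu> (Emat 3 2 - Emat 7 8) = - Eroot (- axis 3 1) \<and>
     \<nu> (Emat 4 3 - Emat 8 9) = - Eroot (- axis 4 1) \<and>
     \<nu> (Emat 5 4 - Emat 9 10) = - Eroot (- axis 5 1) \<and>
     \<nu> (Emat 10 4 - Emat 9 5) = - Eroot (- axis 2 1)"

text \<open>Polynomials in \<open>x\<^sub>1, ..., x\<^sub>1\<^sub>6\<close>: coefficients indexed by exponent vectors, with the library's
  convolution product.\<close>

type_synonym monomial = "16 \<Rightarrow>\<^sub>0 nat"
type_synonym poly16 = "monomial \<Rightarrow>\<^sub>0 complex"

definition cpoly :: "complex \<Rightarrow> poly16" where
  "cpoly a = Poly_Mapping.single 0 a"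

definition Xvar :: "nat \<Rightarrow> poly16" where
  "Xvar i = Poly_Mapping.single (Poly_Mapping.single (of_nat i) 1) 1"

text \<open>The truncated subtraction of exponents is harmless, since the coefficient is then 0.\<close>

definition pd :: "nat \<Rightarrow> poly16 \<Rightarrow> poly16" where
  "pd i f = (\<Sum>m\<in>Poly_Mapping.keys f.
     Poly_Mapping.single (m - Poly_Mapping.single (of_nat i) 1)
       (of_nat (Poly_Mapping.lookup m (of_nat i)) * Poly_Mapping.lookup f m))"

definition Dop :: "poly16 \<Rightarrow> poly16" where
  "Dop f = (\<Sum>i\<in>{1..16}. Xvar i * pd i f)"

definition zeta :: "nat \<Rightarrow> poly16" where
  "zeta k =
    [Xvar 1 * Xvar 11 + Xvar 2 * Xvar 9 - Xvar 3 * Xvar 6 + Xvar 4 * Xvar 5,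
     Xvar 1 * Xvar 13 + Xvar 2 * Xvar 10 - Xvar 3 * Xvar 8 + Xvar 5 * Xvar 7,
     Xvar 1 * Xvar 14 + Xvar 2 * Xvar 12 - Xvar 4 * Xvar 8 + Xvar 6 * Xvar 7,
     Xvar 1 * Xvar 15 - Xvar 3 * Xvar 12 + Xvar 4 * Xvar 10 - Xvar 7 * Xvar 9,
     - Xvar 2 * Xvar 15 - Xvar 3 * Xvar 14 + Xvar 4 * Xvar 13 - Xvar 7 * Xvar 11,
     Xvar 7 * Xvar 16 + Xvar 8 * Xvar 15 + Xvar 10 * Xvar 14 - Xvar 12 * Xvar 13,
     - Xvar 4 * Xvar 16 - Xvar 6 * Xvar 15 - Xvar 9 * Xvar 14 + Xvar 11 * Xvar 12,
     Xvar 3 * Xvar 16 + Xvar 5 * Xvar 15 + Xvar 9 * Xvar 13 - Xvar 10 * Xvar 11,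
     Xvar 2 * Xvar 16 - Xvar 5 * Xvar 14 + Xvar 6 * Xvar 13 - Xvar 8 * Xvar 11,
     Xvar 1 * Xvar 16 + Xvar 5 * Xvar 12 - Xvar 6 * Xvar 10 + Xvar 8 * Xvar 9] ! (k - 1)"

definition Pop :: "nat \<Rightarrow> poly16 \<Rightarrow> poly16" where
  "Pop i f = Xvar i * Dop f
     - (\<Sum>k\<in>{1..10}. zeta k * (\<Sum>j\<in>{1..16}. pd i (pd j (zeta k)) * pd j f))"

definition phi :: "e6 \<Rightarrow> nat \<Rightarrow> nat \<Rightarrow> complex" where
  "phi u i j = Poly_Mapping.lookup (snd (bracket u (eta i))) (- beta j)"

definition on_A :: "e6 \<Rightarrow> poly16 \<Rightarrow> poly16" where
  "on_A u f = (\<Sum>i\<in>{1..16}. \<Sum>j\<in>{1..16}. cpoly (phi u i j) * Xvar j * pd i f)"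

text \<open>
  Since the monomials form a basis of the polynomial algebra, its tensor product with \<open>M\<close> consists
  of the polynomials with coefficients in \<open>M\<close>; \<open>tens\<close> gives the pure tensors. A bilinear map \<open>b\<close>
  on the two factors induces \<open>tlift b\<close> on the tensor product, see \<open>tlift_tens\<close> below.
  The scalar multiplication of \<open>M\<close> is passed around as \<open>sc\<close>.
\<close>

type_synonym 'v hat = "monomial \<Rightarrow>\<^sub>0 'v"

definition tens :: "(complex \<Rightarrow> 'v::ab_group_add \<Rightarrow> 'v) \<Rightarrow> poly16 \<Rightarrow> 'v \<Rightarrow> 'v hat" where
  "tens sc f v = Poly_Mapping.map (\<lambda>a. sc a v) f"

definition hscale :: "(complex \<Rightarrow> 'v::ab_group_add \<Rightarrow> 'v) \<Rightarrow> complex \<Rightarrow> 'v hat \<Rightarrow> 'v hat" where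
  "hscale sc a w = Poly_Mapping.map (sc a) w"

definition tlift :: "(poly16 \<Rightarrow> 'v::ab_group_add \<Rightarrow> 'w::ab_group_add) \<Rightarrow> 'v hat \<Rightarrow> 'w" where
  "tlift b w = (\<Sum>m\<in>Poly_Mapping.keys w. b (Poly_Mapping.single m 1) (Poly_Mapping.lookup w m))"

text \<open>For \<open>u\<close> in \<open>\<G>\<^sub>0\<close>, the component of \<open>u\<close> along \<open>alhat\<close> is a quarter of its \<open>\<alpha>\<^sub>6\<close>-coordinate,
  as the elements of \<open>GD5\<close> have \<open>\<alpha>\<^sub>6\<close>-coordinate 0.\<close>

definition rho_c ::
  "(mat10 \<Rightarrow> e6) \<Rightarrow> (complex \<Rightarrow> 'v::ab_group_add \<Rightarrow> 'v) \<Rightarrow> (mat10 \<Rightarrow> 'v \<Rightarrow> 'v) \<Rightarrow>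
   complex \<Rightarrow> e6 \<Rightarrow> 'v \<Rightarrow> 'v" where
  "rho_c \<nu> sc act c u v =
     (let t = fst u $ 6 / 4
      in act (inv_into o10 \<nu> (u - escale t alhat)) v + sc (t * (2 * c)) v)"

definition xi_act :: "(complex \<Rightarrow> 'v::ab_group_add \<Rightarrow> 'v) \<Rightarrow> nat \<Rightarrow> 'v hat \<Rightarrow> 'v hat" where
  "xi_act sc i = tlift (\<lambda>f v. tens sc (pd i f) v)"

definition G0_act ::
  "(mat10 \<Rightarrow> e6) \<Rightarrow> (complex \<Rightarrow> 'v::ab_group_add \<Rightarrow> 'v) \<Rightarrow> (mat10 \<Rightarrow> 'v \<Rightarrow> 'v) \<Rightarrow>
   complex \<Rightarrow> e6 \<Rightarrow> 'v hat \<Rightarrow> 'v hat" where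
  "G0_act \<nu> sc act c u =
     tlift (\<lambda>f v. tens sc (on_A u f) v + tens sc f (rho_c \<nu> sc act c u v))"

definition eta_act ::
  "(mat10 \<Rightarrow> e6) \<Rightarrow> (complex \<Rightarrow> 'v::ab_group_add \<Rightarrow> 'v) \<Rightarrow> (mat10 \<Rightarrow> 'v \<Rightarrow> 'v) \<Rightarrow>
   complex \<Rightarrow> nat \<Rightarrow> 'v hat \<Rightarrow> 'v hat" where
  "eta_act \<nu> sc act c i =
     tlift (\<lambda>f v. tens sc (Pop i f) v
       + (\<Sum>r\<in>{1..16}. tens sc (Xvar r * f) (rho_c \<nu> sc act c (bracket (xi r) (eta i)) v)))"

definition E6_act ::
  "(mat10 \<Rightarrow> e6) \<Rightarrow> (complex \<Rightarrow> 'v::ab_group_add \<Rightarrow> 'v) \<Rightarrow> (mat10 \<Rightarrow> 'v \<Rightarrow> 'v) \<Rightarrow>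
   complex \<Rightarrow> e6 \<Rightarrow> 'v hat \<Rightarrow> 'v hat" where
  "E6_act \<nu> sc act c x w =
     (\<Sum>i\<in>{1..16}. hscale sc (Poly_Mapping.lookup (snd x) (beta i)) (xi_act sc i w))
     + G0_act \<nu> sc act c (G0_part x) w
     + (\<Sum>i\<in>{1..16}. hscale sc (Poly_Mapping.lookup (snd x) (- beta i))
          (eta_act \<nu> sc act c i w))"

definition Pi_A1 :: "(real ^ 5) set" where
  "Pi_A1 = {(1/2) *\<^sub>R (\<Sum>i\<in>UNIV. (-1) ^ k i *\<^sub>R eps i) | k :: 5 \<Rightarrow> nat.
              (\<forall>i. k i \<in> {0, 1}) \<and> odd (\<Sum>i\<in>UNIV. k i)}"

definition Upsilon :: "real ^ 5 \<Rightarrow> (real ^ 5) set" where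
  "Upsilon lam = {lam + \<mu> | \<mu>. \<mu> \<in> Pi_A1 \<and> lam + \<mu> \<in> dominant}"

definition ell :: "real ^ 5 \<Rightarrow> real" where
  "ell lam = Min ((\<lambda>lam'. (1/2) * ((lam' + 2 *\<^sub>R rho) \<bullet> lam' - (lam + 2 *\<^sub>R rho) \<bullet> lam
                              - (lambda4 + 2 *\<^sub>R rho) \<bullet> lambda4)) ` Upsilon lam)"

definition Upsilon' :: "real ^ 5 \<Rightarrow> (real ^ 5) set" where
  "Upsilon' lam = {lam + \<mu> | \<mu>. \<mu> \<in> range eps \<union> range (\<lambda>i. - eps i) \<and> lam + \<mu> \<in> dominant}"

text \<open>\<open>UV\<close> is regarded inside the tensor product of polynomials and \<open>V\<close>, on which \<open>o10\<close> acts by the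
  tensor product action.\<close>

definition o10_act ::
  "(mat10 \<Rightarrow> e6) \<Rightarrow> (complex \<Rightarrow> 'v::ab_group_add \<Rightarrow> 'v) \<Rightarrow> (mat10 \<Rightarrow> 'v \<Rightarrow> 'v) \<Rightarrow>
   mat10 \<Rightarrow> 'v hat \<Rightarrow> 'v hat" where
  "o10_act \<nu> sc act B = tlift (\<lambda>f v. tens sc (on_A (\<nu> B) f) v + tens sc f (act B v))"

definition prime10 :: "nat \<Rightarrow> nat" where
  "prime10 a = (if a \<le> 5 then a + 5 else a - 5)"

definition T' ::
  "(complex \<Rightarrow> 'v::ab_group_add \<Rightarrow> 'v) \<Rightarrow> (mat10 \<Rightarrow> 'v \<Rightarrow> 'v) \<Rightarrow> nat \<Rightarrow> 'v \<Rightarrow> 'v hat" where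
  "T' sc act a v =
     (\<Sum>b\<in>{1..10}. tens sc (zeta b) (act (Emat a b - Emat (prime10 b) (prime10 a)) v))"

definition flat_at ::
  "(mat10 \<Rightarrow> e6) \<Rightarrow> (complex \<Rightarrow> 'v::ab_group_add \<Rightarrow> 'v) \<Rightarrow> (mat10 \<Rightarrow> 'v \<Rightarrow> 'v) \<Rightarrow>
   real ^ 5 \<Rightarrow> complex" where
  "flat_at \<nu> sc act lam' =
     (THE b. \<exists>u :: nat \<Rightarrow> 'v.
        singular_vector (hscale sc) (o10_act \<nu> sc act) lam' (\<Sum>i\<in>{1..10}. tens sc (zeta i) (u i)) \<and>
        (\<Sum>i\<in>{1..10}. T' sc act i (u i)) = hscale sc b (\<Sum>i\<in>{1..10}. tens sc (zeta i) (u i)))"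

text \<open>The scalars \<open>flat_at\<close> are rational numbers; taking real parts only changes their type.\<close>

definition flat ::
  "(mat10 \<Rightarrow> e6) \<Rightarrow> (complex \<Rightarrow> 'v::ab_group_add \<Rightarrow> 'v) \<Rightarrow> (mat10 \<Rightarrow> 'v \<Rightarrow> 'v) \<Rightarrow>
   real ^ 5 \<Rightarrow> real" where
  "flat \<nu> sc act lam = Min ((\<lambda>lam'. Re (flat_at \<nu> sc act lam')) ` Upsilon' lam)"

lemma index_types:
  "(UNIV :: 5 set) = of_nat ` {1..5}" "(UNIV :: 6 set) = of_nat ` {1..6}"
  "(UNIV :: 10 set) = of_nat ` {1..10}" "(UNIV :: 16 set) = of_nat ` {1..16}"
proof -
  have n: "{1..5} = {1,2,3,4,5::nat}" "{1..6} = {1,2,3,4,5,6::nat}"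
    "{1..10} = {1,2,3,4,5,6,7,8,9,10::nat}"
    "{1..16} = {1,2,3,4,5,6,7,8,9,10,11,12,13,14,15,16::nat}"
    by (simp_all add: set_eq_iff, presburger+)
  show "(UNIV :: 5 set) = of_nat ` {1..5}"
    unfolding n by (rule sym, rule card_subset_eq) simp_all
  show "(UNIV :: 6 set) = of_nat ` {1..6}"
    unfolding n by (rule sym, rule card_subset_eq) simp_all
  show "(UNIV :: 10 set) = of_nat ` {1..10}"
    unfolding n by (rule sym, rule card_subset_eq) simp_all
  show "(UNIV :: 16 set) = of_nat ` {1..16}"
    unfolding n by (rule sym, rule card_subset_eq) simp_all
qed

lemma vector_6:
  fixes a b c d e f :: "'a::zero"
  defines "v \<equiv> (vector [a, b, c, d, e, f] :: 'a ^ 6)"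
  shows "v $ 1 = a" "v $ 2 = b" "v $ 3 = c" "v $ 4 = d" "v $ 5 = e" "v $ 6 = f"
  by (simp_all add: v_def vector_def)

lemma vector_space_mscale: "vector_space mscale"
  by unfold_locales (auto simp: mscale_def vec_eq_iff algebra_simps)

lemma lookup_map_zero:
  assumes "g 0 = 0"
  shows "Poly_Mapping.lookup (Poly_Mapping.map g f) m = g (Poly_Mapping.lookup f m)"
  using assms by (simp add: Poly_Mapping.map.rep_eq when_def)

lemma vector_space_hscale:
  assumes "vector_space sc"
  shows "vector_space (hscale sc)"
proof -
  interpret vector_space sc by fact
  show ?thesis
    by unfold_locales
      (auto intro!: poly_mapping_eqI simp: hscale_def lookup_map_zero lookup_add algebra_simps)
qed

lemma tlift_tens:
  assumes "vector_space sc" "vector_space sc'"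
    and add_left: "\<And>f g v. b (f + g) v = b f v + b g v"
    and scale_left: "\<And>a f v. b (cpoly a * f) v = sc' a (b f v)"
    and add_right: "\<And>f v w. b f (v + w) = b f v + b f w"
    and scale_right: "\<And>a f v. b f (sc a v) = sc' a (b f v)"
  shows "tlift b (tens sc f v) = b f v"
proof -
  interpret V: vector_space sc by fact
  interpret W: vector_space sc' by fact
  have lk: "Poly_Mapping.lookup (tens sc f v) m = sc (Poly_Mapping.lookup f m) v" for m
    by (simp add: tens_def lookup_map_zero)
  have z: "b g 0 = 0" for g
    using scale_right[of g 0 0] by simp
  have z': "b 0 w = 0" for w
    using add_left[of 0 0 w] by simp
  have "tlift b (tens sc f v)
      = (\<Sum>m\<in>Poly_Mapping.keys f. b (Poly_Mapping.single m 1) (sc (Poly_Mapping.lookup f m) v))"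
    unfolding tlift_def lk
    by (rule sum.mono_neutral_cong_left) (auto simp: in_keys_iff lk z)
  also have "\<dots> = (\<Sum>m\<in>Poly_Mapping.keys f. b (Poly_Mapping.single m (Poly_Mapping.lookup f m)) v)"
    by (rule sum.cong) (simp_all add: scale_right scale_left[symmetric] cpoly_def mult_single)
  also have "\<dots> = b (\<Sum>m\<in>Poly_Mapping.keys f. Poly_Mapping.single m (Poly_Mapping.lookup f m)) v"
    by (induction rule: infinite_finite_induct[of _ "Poly_Mapping.keys f"])
      (simp_all add: z' add_left)
  also have "(\<Sum>m\<in>Poly_Mapping.keys f. Poly_Mapping.single m (Poly_Mapping.lookup f m)) = f"
    by (rule poly_mapping_eqI) (simp add: lookup_sum lookup_single when_def in_keys_iff)
  finally show ?thesis .
qed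

end

theory Submission
  imports Defs
begin

text \<open>Let \<open>W\<close> be a nonzero submodule. The operators \<open>\<xi>\<^sub>i\<close> lower the degree, so \<open>W\<close> contains a nonzero
  element of \<open>V = V(\<lambda>)\<close> and hence \<open>V\<close>. That \<open>W\<close> contains \<open>f \<otimes> V\<close> for all homogeneous \<open>f\<close> follows by
  induction on the degree. If \<open>g\<close> has degree \<open>n\<close> then, modulo the ideal generated by the quadrics \<open>\<zeta>\<^sub>k\<close>,
  \<open>\<Sum>i. \<eta>\<^sub>i (g \<otimes> u\<^sub>i)\<close> is \<open>g\<close> times the image of \<open>\<Sum>i. x\<^sub>i \<otimes> u\<^sub>i\<close> under \<open>\<Theta> - c/2 + n\<close>, where \<open>\<Theta>\<close> acts on
  \<open>\<A>\<^sub>1 \<otimes> V\<close>. If \<open>h\<close> has degree \<open>n\<close> then \<open>\<Sum>m i. \<eta>\<^sub>i (h \<partial>\<^sub>i \<zeta>\<^sub>m \<otimes> u\<^sub>m)\<close> is \<open>h\<close> times the image of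
  \<open>\<Sum>m. \<zeta>\<^sub>m \<otimes> u\<^sub>m\<close> under \<open>\<Theta> - c - 6 + n\<close>, where \<open>\<Theta>\<close> acts on \<open>U \<otimes> V\<close>. In both cases \<open>\<Theta>\<close> is a quarter
  of a difference of Casimir operators. Hence each eigenvalue of \<open>\<Theta>\<close> occurs at a singular vector, whose
  weight is dominant and therefore lies in \<open>\<Upsilon>(\<lambda>)\<close> or \<open>\<Upsilon>'(\<lambda>)\<close>, and the condition on \<open>c\<close> makes both
  operators invertible.

  Since \<open>\<flat>(\<lambda>)\<close> is defined by means of singular vectors, it is also needed that \<open>U \<otimes> V\<close> has a singular
  vector of each weight in \<open>\<Upsilon>'(\<lambda>)\<close>. It is obtained from \<open>\<zeta>\<^sub>j \<otimes> v\<close> with a highest weight vector \<open>v\<close>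
  by applying the product of the operators \<open>\<Theta> - t\<^sub>b\<close> for the higher eigenvalues \<open>t\<^sub>b\<close>.\<close>

section \<open>Modules over the orthogonal Lie algebra\<close>

text \<open>The common source of the formulas is that the Hessians \<open>Cm a\<close> of the
  quadrics are chiral gamma matrices: \<open>Cm a ** Cm b + Cm (b + 5) ** Cm (a + 5)\<close> is the
  identity if a = b and 0 otherwise. This relation yields the spin matrices on the variables, the
  natural action on the quadrics and, with the Fierz identity \<open>fierz\<close>, the cubic
  identity used for the shift by 6. The structure constants of E6 enter only through finite table
  checks. The delicate point is that the vector obtained by the product of the operators is not
  zero. Its leading coefficient obeys a triangular recursion in which the dual of each index is
  skipped, so it is not simply the product of the eigenvalue gaps. A left eigenvector of the
  recursion matrix shows that it is this product times the sum of the entries of the eigenvector.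
  Dominance makes the gaps at most -2, except possibly at dual indices, and thus keeps the factors 1
  + 1/d of that sum away from 0.\<close>

lemma add_5_5 [simp]: "(a::10) + 5 + 5 = a"
proof -
  have "(5::10) + 5 = 0" by simp
  then show ?thesis by (metis add.assoc add.right_neutral)
qed

lemma add_5_eq_iff: "(a::10) + 5 = b \<longleftrightarrow> a = b + 5"
  by (metis add_5_5)

lemma add_5_neq [simp]: "(a::10) + 5 \<noteq> a" "a \<noteq> a + 5"
proof -
  have "(5::10) \<noteq> 0" by simp
  then show "a + 5 \<noteq> a" by (metis add_cancel_right_right)
  then show "a \<noteq> a + 5" by metis
qed

lemma sum_add_5: "(\<Sum>a\<in>UNIV. f (a + 5 :: 10)) = (\<Sum>a\<in>UNIV. f a)"
  by (rule sum.reindex_bij_witness[of _ "\<lambda>a. a + 5" "\<lambda>a. a + 5"]) auto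

lemma UNIV_10: "(UNIV :: 10 set) = {1, 2, 3, 4, 5, 6, 7, 8, 9, 10}"
  by (rule sym, rule card_subset_eq) simp_all

lemma exhaust_10: "(a::10) = 1 \<or> a = 2 \<or> a = 3 \<or> a = 4 \<or> a = 5 \<or> a = 6 \<or> a = 7 \<or> a = 8 \<or> a = 9 \<or> a = 10"
  using UNIV_10 by blast

text \<open>The position of an index in the order \<open>1, 2, 3, 4, 5, 10, 9, 8, 7, 6\<close>, in which the
  weights \<open>\<epsilon>\<^sub>1, \<dots>, \<epsilon>\<^sub>5, -\<epsilon>\<^sub>5, \<dots>, -\<epsilon>\<^sub>1\<close> of the natural module decrease.\<close>

definition pos :: "10 \<Rightarrow> nat" where
  "pos a = (if a = 1 then 1 else if a = 2 then 2 else if a = 3 then 3 else if a = 4 then 4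
     else if a = 5 then 5 else if a = 10 then 6 else if a = 9 then 7 else if a = 8 then 8
     else if a = 7 then 9 else 10)"

lemma pos_simps [simp]:
  "pos 1 = 1" "pos 2 = 2" "pos 3 = 3" "pos 4 = 4" "pos 5 = 5"
  "pos 6 = 10" "pos 7 = 9" "pos 8 = 8" "pos 9 = 7" "pos 0 = 6"
  by (simp_all add: pos_def)

lemma numeral_10_mod [simp]:
  "(10::10) = 0" "(11::10) = 1" "(12::10) = 2" "(13::10) = 3" "(14::10) = 4" "(15::10) = 5"
  by simp_all

lemma pos_add_5: "pos (a + 5) = 11 - pos a" "pos a \<le> 10"
  using exhaust_10[of a] by auto

lemma pos_inj: "pos a = pos b \<longleftrightarrow> a = b"
  using exhaust_10[of a] exhaust_10[of b] by auto

text \<open>By \<open>ht_root\<close> this functional is positive on all positive roots; maximal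
  weights are taken with respect to it.\<close>

definition ht :: "(10 \<Rightarrow> real) \<Rightarrow> real" where
  "ht m = - (\<Sum>a\<in>UNIV. real (pos a) * m a)"

text \<open>The weight of \<open>F a b\<close>. Weights live on all ten indices, with opposite
  values at a and a + 5, so the difference of two coordinate weights contributes four terms.\<close>

definition root :: "10 \<Rightarrow> 10 \<Rightarrow> 10 \<Rightarrow> real" where
  "root a b c = of_bool (c = a) - of_bool (c = b) + of_bool (c = b + 5) - of_bool (c = a + 5)"

lemma ht_add: "ht (\<lambda>c. m c + n c) = ht m + ht n"
  by (simp add: ht_def sum.distrib algebra_simps)

lemma ht_root: "ht (root a b) = 2 * (real (pos b) - real (pos a))"
proof -
  have *: "(\<Sum>c\<in>UNIV. real (pos c) * of_bool (c = a)) = real (pos a)" for a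
    by (simp add: of_bool_def if_distrib cong: if_cong)
  have p: "real (pos (a + 5)) = 11 - real (pos a)" for a
    using pos_add_5[of a] by (simp add: of_nat_diff)
  show ?thesis
    by (simp add: ht_def root_def algebra_simps sum.distrib sum_subtractf * p del: of_bool_eq_iff)
qed

text \<open>The Casimir eigenvalue at a singular vector of weight m: for
  \<open>pos a < pos b\<close> the product \<open>F a b (F b a w)\<close> collapses to the
  commutator, for \<open>pos b < pos a\<close> it is 0, and the pairs b = a + 5 drop out because
  \<open>F a (a + 5)\<close> vanishes.\<close>

definition cas :: "(10 \<Rightarrow> real) \<Rightarrow> real" where
  "cas m = (\<Sum>a\<in>UNIV. \<Sum>b\<in>UNIV. if a = b then (m a)\<^sup>2
      else if pos a < pos b \<and> b \<noteq> a + 5 then m a - m b else 0)"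

text \<open>\<open>F a b\<close> is the action of \<open>E\<^bsub>a,b\<^esub> - E\<^bsub>b',a'\<^esub>\<close>. The type \<open>10\<close> has arithmetic modulo 10, so
  \<open>a + 5\<close> is the paper's \<open>a'\<close> and the index \<open>10\<close> is \<open>0\<close>.\<close>

locale o10_module = vector_space sc
  for sc :: "complex \<Rightarrow> 'm::ab_group_add \<Rightarrow> 'm" +
  fixes F :: "10 \<Rightarrow> 10 \<Rightarrow> 'm \<Rightarrow> 'm"
  assumes F_add: "F a b (v + w) = F a b v + F a b w"
    and F_sc: "F a b (sc x v) = sc x (F a b v)"
    and skew: "F (b + 5) (a + 5) v = - F a b v"
    and comm: "F a b (F c d v) - F c d (F a b v) =
      (if b = c then F a d v else 0) - (if a = d then F c b v else 0)
      - (if b = d + 5 then F a (c + 5) v else 0) - (if a + 5 = c then F (b + 5) d v else 0)"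
begin

lemma F_0 [simp]: "F a b 0 = 0"
  using F_add[of a b 0 0] by simp

lemma F_minus: "F a b (- v) = - F a b v"
  using F_add[of a b v "- v"] by (simp add: eq_neg_iff_add_eq_0 add.commute)

lemma F_diff: "F a b (v - w) = F a b v - F a b w"
  using F_add[of a b v "- w"] by (simp add: F_minus)

lemma F_sum: "F a b (\<Sum>i\<in>I. f i) = (\<Sum>i\<in>I. F a b (f i))"
  by (induction I rule: infinite_finite_induct) (simp_all add: F_add)

lemma F_swap: "F a b (F c d v) = F c d (F a b v) +
      ((if b = c then F a d v else 0) - (if a = d then F c b v else 0)
      - (if b = d + 5 then F a (c + 5) v else 0) - (if a + 5 = c then F (b + 5) d v else 0))"
  using comm[of a b c d v] by (simp add: algebra_simps)

lemma F_self [simp]: "F a (a + 5) v = 0"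
proof -
  have "F a (a + 5) v = - F a (a + 5) v"
    using skew[of "a + 5" a v] by (metis add_5_5 skew)
  then have "sc 2 (F a (a + 5) v) = 0"
    using scale_left_distrib[of 1 1 "F a (a + 5) v"] by (simp add: eq_neg_iff_add_eq_0)
  then show ?thesis by (simp add: scale_eq_0_iff)
qed

definition wvec :: "(10 \<Rightarrow> real) \<Rightarrow> 'm \<Rightarrow> bool" where
  "wvec m w \<longleftrightarrow> (\<forall>a. F a a w = sc (of_real (m a)) w)"

definition sing :: "(10 \<Rightarrow> real) \<Rightarrow> 'm \<Rightarrow> bool" where
  "sing m w \<longleftrightarrow> w \<noteq> 0 \<and> wvec m w \<and> (\<forall>a b. pos a < pos b \<longrightarrow> F a b w = 0)"

definition stable :: "'m set \<Rightarrow> bool" where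
  "stable K \<longleftrightarrow> subspace K \<and> (\<forall>a b. \<forall>w\<in>K. F a b w \<in> K)"

definition Cas :: "'m \<Rightarrow> 'm" where
  "Cas w = (\<Sum>a\<in>UNIV. \<Sum>b\<in>UNIV. F a b (F b a w))"

lemma F_root:
  assumes "wvec m w"
  shows "wvec (\<lambda>c. m c + root a b c) (F a b w)"
  unfolding wvec_def
proof
  fix c
  have "F c c (F a b w) = F a b (F c c w) +
      ((if c = a then F c b w else 0) - (if c = b then F a c w else 0)
      - (if c = b + 5 then F c (a + 5) w else 0) - (if c + 5 = a then F (c + 5) b w else 0))"
    by (rule F_swap)
  also have "F a b (F c c w) = sc (of_real (m c)) (F a b w)"
    using assms by (simp add: wvec_def F_sc)
  also have "(if c = b + 5 then F c (a + 5) w else 0) = (if c = b + 5 then - F a b w else 0)"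
    using skew[of b a w] by simp
  finally show "F c c (F a b w) = sc (of_real (m c + root a b c)) (F a b w)"
    by (auto simp: root_def algebra_simps scale_left_distrib scale_left_diff_distrib add_5_eq_iff)
qed

lemma wvec_subspace: "subspace {w. wvec m w}"
  by (auto simp: subspace_def wvec_def F_add F_sc scale_right_distrib mult.commute)

text \<open>Applying \<open>F a a\<close> minus its value at the weight n removes the summand of
  weight n and multiplies the one of weight m by m a - n a, which is nonzero for a suitable a. So
  the induction can drop n.\<close>

lemma weight_components:
  assumes K: "subspace K" "\<And>a w. w \<in> K \<Longrightarrow> F a a w \<in> K"
    and S: "finite S" "\<And>m. m \<in> S \<Longrightarrow> wvec m (f m)" "(\<Sum>m\<in>S. f m) \<in> K"
  shows "\<forall>m\<in>S. f m \<in> K"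
  using S
proof (induction S arbitrary: f)
  case empty
  then show ?case by simp
next
  case (insert n S)
  have *: "f m \<in> K" if "m \<in> S" for m
  proof -
    have "m \<noteq> n" using that insert.hyps by auto
    then obtain a where a: "m a \<noteq> n a" by auto
    let ?w = "\<Sum>m\<in>insert n S. f m"
    have "F a a ?w - sc (of_real (n a)) ?w = (\<Sum>m\<in>insert n S. sc (of_real (m a - n a)) (f m))"
      using insert.prems(1)
      by (simp add: F_sum wvec_def scale_sum_right sum_subtractf [symmetric] scale_left_diff_distrib
          del: sum.insert)
    also have "\<dots> = (\<Sum>m\<in>S. sc (of_real (m a - n a)) (f m))"
      using insert.hyps by simp
    finally have "(\<Sum>m\<in>S. sc (of_real (m a - n a)) (f m)) \<in> K"
      using K insert.prems(2) by (metis subspace_diff subspace_scale)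
    then have "\<forall>m\<in>S. sc (of_real (m a - n a)) (f m) \<in> K"
      using insert.prems(1) wvec_subspace by (intro insert.IH) (auto simp: subspace_def)
    then have "sc (of_real (m a - n a)) (f m) \<in> K" using that by blast
    then have "sc (inverse (of_real (m a - n a))) (sc (of_real (m a - n a)) (f m)) \<in> K"
      using K(1) subspace_scale by blast
    then show ?thesis using a by (simp flip: of_real_diff)
  qed
  have "f n = (\<Sum>m\<in>insert n S. f m) - (\<Sum>m\<in>S. f m)"
    using insert.hyps by simp
  also have "\<dots> \<in> K"
    by (rule subspace_diff[OF K(1) insert.prems(2)], rule subspace_sum[OF K(1)], rule *)
  finally show ?case using * by blast
qed

definition wspan :: "((10 \<Rightarrow> real) \<Rightarrow> bool) \<Rightarrow> 'm set" where
  "wspan Q = span {w. \<exists>m. Q m \<and> wvec m w}"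

lemma wspan_decomposition:
  assumes "w \<in> wspan Q"
  shows "\<exists>S f. finite S \<and> (\<forall>m\<in>S. Q m \<and> wvec m (f m)) \<and> w = (\<Sum>m\<in>S. f m)"
  using assms unfolding wspan_def
proof (induction rule: span_induct_alt)
  case base
  show ?case by (intro exI[of _ "{}"]) simp
next
  case (step c x y)
  then obtain S f m where Sf: "finite S" "\<forall>m\<in>S. Q m \<and> wvec m (f m)" "y = (\<Sum>m\<in>S. f m)"
    and m: "Q m" "wvec m x" by auto
  let ?f = "\<lambda>n. (if n \<in> S then f n else 0) + (if n = m then sc c x else 0)"
  have "y = (\<Sum>n\<in>insert m S. if n \<in> S then f n else 0)"
    unfolding Sf(3) using Sf(1) by (intro sum.mono_neutral_cong_left) auto
  moreover have "sc c x = (\<Sum>n\<in>insert m S. if n = m then sc c x else 0)"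
    using Sf(1) by simp
  ultimately have "sc c x + y = (\<Sum>n\<in>insert m S. ?f n)"
    by (simp only: sum.distrib add.commute)
  moreover have "\<forall>n\<in>insert m S. Q n \<and> wvec n (?f n)"
    using Sf(2) m wvec_subspace by (auto simp: subspace_def)
  ultimately show ?case using Sf(1) by (intro exI[of _ "insert m S"] exI[of _ ?f]) blast
qed

text \<open>Linear independence of different weights, obtained from \<open>weight_components\<close>
  for the zero subspace.\<close>

lemma wvec_wspan_eq_0:
  assumes "w \<in> wspan Q" "wvec m w" "\<not> Q m"
  shows "w = 0"
proof -
  obtain S f where Sf: "finite S" "\<forall>m\<in>S. Q m \<and> wvec m (f m)" "w = (\<Sum>m\<in>S. f m)"
    using wspan_decomposition[OF assms(1)] by blast
  have m: "m \<notin> S" using Sf assms(3) by blast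
  let ?f = "f(m := - w)"
  have "(\<Sum>n\<in>insert m S. ?f n) = - w + (\<Sum>n\<in>S. ?f n)"
    using Sf(1) m by simp
  also have "(\<Sum>n\<in>S. ?f n) = w"
    unfolding Sf(3) using m by (intro sum.cong) auto
  finally have "(\<Sum>n\<in>insert m S. ?f n) \<in> {0}" by simp
  then have "\<forall>n\<in>insert m S. ?f n \<in> {0}"
    using Sf m assms(2) by (intro weight_components) (auto simp: wvec_def F_minus)
  then show ?thesis by simp
qed

text \<open>A weight vector in \<open>K\<close> of maximal height is singular, since raising it
  would give a weight vector in \<open>K\<close> of larger height.\<close>

lemma singular_in_stable:
  assumes "stable K" "w \<in> K" "w \<noteq> 0" "finite M" "w \<in> wspan (\<lambda>m. m \<in> M)" "wspan (\<lambda>m. m \<in> M) = UNIV"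
  shows "\<exists>m u. u \<in> K \<and> sing m u"
proof -
  let ?N = "{m \<in> M. \<exists>u\<in>K. u \<noteq> 0 \<and> wvec m u}"
  obtain S f where Sf: "finite S" "\<forall>m\<in>S. m \<in> M \<and> wvec m (f m)" "w = (\<Sum>m\<in>S. f m)"
    using wspan_decomposition[OF assms(5)] by blast
  have "\<forall>m\<in>S. f m \<in> K"
    using Sf assms(1,2) by (intro weight_components) (auto simp: stable_def)
  moreover have "\<exists>m\<in>S. f m \<noteq> 0"
    using Sf assms(3) by (metis sum.neutral)
  ultimately have "?N \<noteq> {}" using Sf by blast
  moreover have "finite ?N" using assms(4) by simp
  ultimately have "Max (ht ` ?N) \<in> ht ` ?N" "\<And>n. n \<in> ?N \<Longrightarrow> ht n \<le> Max (ht ` ?N)"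
    by (simp_all add: Max_in)
  then obtain m where m: "m \<in> ?N" "\<And>n. n \<in> ?N \<Longrightarrow> ht n \<le> ht m"
    by force
  then obtain u where u: "u \<in> K" "u \<noteq> 0" "wvec m u" by blast
  have "F a b u = 0" if "pos a < pos b" for a b
  proof (rule ccontr)
    assume nz: "F a b u \<noteq> 0"
    let ?n = "\<lambda>c. m c + root a b c"
    have w: "wvec ?n (F a b u)" using F_root[OF u(3)] .
    then have "?n \<in> M" using nz wvec_wspan_eq_0[of "F a b u" "\<lambda>m. m \<in> M" ?n] assms(6) by auto
    then have "?n \<in> ?N" using nz w u(1) assms(1) by (auto simp: stable_def)
    then show False using m(2)[of ?n] that by (simp add: ht_add ht_root)
  qed
  then show ?thesis using u unfolding sing_def by blast
qed

text \<open>The argument takes place in the \<open>sl\<^sub>2\<close>-triple \<open>F a b, F b a, F a a - F b b\<close>.\<close>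

lemma singular_dominant:
  assumes "sing m w" "finite M" "wspan (\<lambda>m. m \<in> M) = UNIV" and ab: "pos a < pos b" "b \<noteq> a + 5"
  shows "m a - m b \<in> \<nat>"
proof -
  define u where "u n = (F b a ^^ n) w" for n
  have anb: "a \<noteq> b" using ab by auto
  have r: "root b a a = -1" "root b a b = 1"
    using ab anb by (auto simp: root_def)
  have wv: "wvec (\<lambda>c. m c + real n * root b a c) (u n)" for n
  proof (induction n)
    case 0
    then show ?case using assms(1) by (simp add: u_def sing_def)
  next
    case (Suc n)
    then show ?case using F_root[OF Suc, of b a] by (simp add: u_def algebra_simps)
  qed
  have ba: "a \<noteq> b + 5" using ab by auto
  have bra: "F a b (F b a x) = F b a (F a b x) + (F a a x - F b b x)" for x
    using F_swap[of a b b a x] ab ba by simp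
  \<comment> \<open>The usual sl2 identity for a raising operator on a lowering string. Where the
    string ends, it forces m a - m b = n.\<close>
  have e: "F a b (u (Suc n)) = sc (of_real (real (Suc n) * (m a - m b - real n))) (u n)" for n
  proof (induction n)
    case 0
    then show ?case using assms(1) bra[of w]
      by (simp add: u_def sing_def wvec_def ab scale_left_diff_distrib)
  next
    case (Suc n)
    have h: "F a a (u (Suc n)) = sc (of_real (m a - real (Suc n))) (u (Suc n))"
        "F b b (u (Suc n)) = sc (of_real (m b + real (Suc n))) (u (Suc n))"
      using wv[of "Suc n"] r by (auto simp: wvec_def)
    have "F a b (u (Suc (Suc n))) = F b a (F a b (u (Suc n))) + (F a a (u (Suc n)) - F b b (u (Suc n)))"
      using bra[of "u (Suc n)"] by (simp add: u_def)
    also have "F b a (F a b (u (Suc n))) = sc (of_real (real (Suc n) * (m a - m b - real n))) (u (Suc n))"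
      unfolding Suc by (simp add: F_sc u_def)
    also have "F a a (u (Suc n)) - F b b (u (Suc n))
        = sc (of_real (m a - real (Suc n)) - of_real (m b + real (Suc n))) (u (Suc n))"
      unfolding h by (rule scale_left_diff_distrib[symmetric])
    also have "sc (of_real (real (Suc n) * (m a - m b - real n))) (u (Suc n)) + \<dots>
        = sc (of_real (real (Suc n) * (m a - m b - real n))
            + (of_real (m a - real (Suc n)) - of_real (m b + real (Suc n)))) (u (Suc n))"
      by (rule scale_left_distrib[symmetric])
    also have "of_real (real (Suc n) * (m a - m b - real n))
            + (of_real (m a - real (Suc n)) - of_real (m b + real (Suc n)))
        = (of_real (real (Suc (Suc n)) * (m a - m b - real (Suc n))) :: complex)"
      by (simp only: of_real_add[symmetric] of_real_diff[symmetric] of_real_eq_iff)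
        (simp add: algebra_simps)
    finally show ?case .
  qed
  have "\<exists>n. u n = 0"
  proof (rule ccontr)
    assume "\<not> ?thesis"
    then have "(\<lambda>c. m c + real n * root b a c) \<in> M" for n
      using wv[of n] wvec_wspan_eq_0[of "u n" "\<lambda>m. m \<in> M"] assms(3) by blast
    then have "range (\<lambda>n c. m c + real n * root b a c) \<subseteq> M" by auto
    moreover have "inj (\<lambda>n c. m c + real n * root b a c)"
      using r by (auto simp: inj_def fun_eq_iff dest!: spec[of _ b])
    ultimately show False using assms(2) finite_subset range_inj_infinite by blast
  qed
  then have "u (LEAST n. u n = 0) = 0" by (rule LeastI_ex)
  moreover have "u 0 \<noteq> 0" using assms(1) by (simp add: u_def sing_def)
  ultimately obtain n where n: "(LEAST n. u n = 0) = Suc n" "u (Suc n) = 0"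
    by (metis not0_implies_Suc)
  have "u n \<noteq> 0" using n(1) not_less_Least[of n "\<lambda>n. u n = 0"] by simp
  then have "real (Suc n) * (m a - m b - real n) = 0"
    using e[of n] n(2) by (metis F_0 of_real_eq_0_iff scale_eq_0_iff)
  then have "m a - m b = real n" by simp
  then show ?thesis by simp
qed

lemma Cas_singular:
  assumes "sing m w"
  shows "Cas w = sc (of_real (cas m)) w"
proof -
  have t: "F a b (F b a w) = sc (of_real (if a = b then (m a)\<^sup>2
      else if pos a < pos b \<and> b \<noteq> a + 5 then m a - m b else 0)) w" for a b
  proof -
    consider "a = b" | "b = a + 5" | "a \<noteq> b" "b \<noteq> a + 5" "pos a < pos b" | "pos b < pos a"
      using pos_inj[of a b] by linarith
    then show ?thesis
    proof cases
      case 1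
      then show ?thesis using assms by (simp add: sing_def wvec_def F_sc power2_eq_square)
    next
      case 2
      then have "F b a w = 0" using F_self[of b w] by simp
      then show ?thesis using 2 by simp
    next
      case 3
      then have "a \<noteq> b + 5" by auto
      then show ?thesis using 3 F_swap[of a b b a w] assms
        by (simp add: sing_def wvec_def scale_left_diff_distrib)
    next
      case 4
      then show ?thesis using assms by (auto simp: sing_def)
    qed
  qed
  show ?thesis unfolding Cas_def cas_def t by (simp add: scale_sum_left)
qed

lemma Cas_add: "Cas (v + w) = Cas v + Cas w"
  by (simp add: Cas_def F_add sum.distrib)

lemma Cas_sc: "Cas (sc x w) = sc x (Cas w)"
  by (simp add: Cas_def F_sc scale_sum_right)

text \<open>The commutator with each factor produces four sums. Two of them cancel against those of
  the other factor directly, the two with a dual index after an application of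
  \<open>skew\<close>.\<close>

lemma Cas_F: "Cas (F c d w) = F c d (Cas w)"
proof -
  let ?d = "\<lambda>p x. if p then x else (0::'m)"
  have 1: "F c d (F a b (F b a w)) = F a b (F b a (F c d w))
     + (F a b (?d (d = b) (F c a w)) - F a b (?d (c = a) (F b d w))
        - F a b (?d (d = a + 5) (F c (b + 5) w)) - F a b (?d (c + 5 = b) (F (d + 5) a w)))
     + (?d (d = a) (F c b (F b a w)) - ?d (c = b) (F a d (F b a w))
        - ?d (d = b + 5) (F c (a + 5) (F b a w)) - ?d (c + 5 = a) (F (d + 5) b (F b a w)))" for a b
    unfolding F_swap[of c d a b] F_swap[of c d b a w] F_add F_diff by (simp add: algebra_simps)
  have 2: "F a b (?d p x) = ?d p (F a b x)" for a b p x by simp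
  have i: "\<And>a. (d = a + 5) = (a = d + 5)" "\<And>a. (d = a) = (a = d)" "\<And>a. (c + 5 = a) = (a = c + 5)"
    "\<And>a. (c = a) = (a = c)"
    by (auto simp: add_5_eq_iff)
  have sum_if_const: "(\<Sum>b\<in>UNIV. ?d p (x b)) = ?d p (\<Sum>b\<in>UNIV. x b)" for p and x :: "10 \<Rightarrow> 'm"
    by simp
  have "F c d (Cas w) = Cas (F c d w)
      + ((\<Sum>a\<in>UNIV. F a d (F c a w)) - (\<Sum>b\<in>UNIV. F c b (F b d w))
        - (\<Sum>b\<in>UNIV. F (d + 5) b (F c (b + 5) w)) - (\<Sum>a\<in>UNIV. F a (c + 5) (F (d + 5) a w)))
      + ((\<Sum>b\<in>UNIV. F c b (F b d w)) - (\<Sum>a\<in>UNIV. F a d (F c a w))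
        - (\<Sum>a\<in>UNIV. F c (a + 5) (F (d + 5) a w)) - (\<Sum>b\<in>UNIV. F (d + 5) b (F b (c + 5) w)))"
    unfolding Cas_def F_sum 1 2 sum.distrib sum_subtractf i(1)
    unfolding i(2-4)
    by (simp add: sum_if_const)
  also have "(\<Sum>b\<in>UNIV. F (d + 5) b (F c (b + 5) w)) = - (\<Sum>b\<in>UNIV. F (d + 5) b (F b (c + 5) w))"
    unfolding sum_negf[symmetric]
  proof (rule sum.cong)
    fix b
    have "F c (b + 5) w = - F b (c + 5) w" using skew[of "c + 5" b w] by simp
    then show "F (d + 5) b (F c (b + 5) w) = - F (d + 5) b (F b (c + 5) w)" by (simp add: F_minus)
  qed simp
  also have "(\<Sum>a\<in>UNIV. F c (a + 5) (F (d + 5) a w)) = - (\<Sum>a\<in>UNIV. F a (c + 5) (F (d + 5) a w))"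
    unfolding sum_negf[symmetric]
  proof (rule sum.cong)
    fix a
    show "F c (a + 5) (F (d + 5) a w) = - F a (c + 5) (F (d + 5) a w)"
      using skew[of "c + 5" a "F (d + 5) a w"] by simp
  qed simp
  finally show ?thesis by simp
qed

end

section \<open>Irreducible highest weight modules\<close>

locale hw_module = o10_module sc F
  for sc :: "complex \<Rightarrow> 'm::ab_group_add \<Rightarrow> 'm" and F +
  fixes lm :: "10 \<Rightarrow> real" and v :: 'm
  assumes sing_v: "sing lm v"
    and irreducible: "stable K \<Longrightarrow> K = {0} \<or> K = UNIV"
    and fin_dim: "\<exists>B. finite B \<and> span B = UNIV"
begin

lemma stable_eq_UNIV:
  assumes "stable K" "w \<in> K" "w \<noteq> 0"
  shows "K = UNIV"
  using irreducible[OF assms(1)] assms(2,3) by auto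

lemma stable_span:
  assumes "\<And>a b w. w \<in> S \<Longrightarrow> F a b w \<in> span S"
  shows "stable (span S)"
  unfolding stable_def
proof (intro conjI allI ballI)
  fix a b w
  assume "w \<in> span S"
  then show "F a b w \<in> span S"
    by (induction rule: span_induct_alt)
      (auto simp: F_add F_sc assms span_zero intro!: span_add span_scale)
qed (rule subspace_span)

text \<open>The span of all weight vectors is stable and contains \<open>v\<close>, so it is
  everything by irreducibility. A finite spanning set then involves only finitely many
  weights.\<close>

lemma finite_weights: "\<exists>M. finite M \<and> wspan (\<lambda>m. m \<in> M) = UNIV"
proof -
  obtain B where B: "finite B" "span B = UNIV" using fin_dim by blast
  have "stable (wspan (\<lambda>m. True))"
    unfolding wspan_def using F_root by (intro stable_span span_base) blast
  moreover have "v \<in> wspan (\<lambda>m. True)"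
    unfolding wspan_def using sing_v by (intro span_base) (auto simp: sing_def)
  ultimately have "wspan (\<lambda>m. True) = UNIV"
    using stable_eq_UNIV sing_v unfolding sing_def by blast
  then have "\<exists>S f. finite S \<and> (\<forall>m\<in>S. wvec m (f m)) \<and> b = (\<Sum>m\<in>S. f m)" for b
    using wspan_decomposition[of b "\<lambda>m. True"] by auto
  then obtain S f where Sf: "\<And>b. finite (S b)" "\<And>b m. m \<in> S b \<Longrightarrow> wvec m (f b m)"
    "\<And>b. b = (\<Sum>m\<in>S b. f b m)" by metis
  let ?M = "\<Union>b\<in>B. S b"
  have "B \<subseteq> wspan (\<lambda>m. m \<in> ?M)"
  proof
    fix b assume b: "b \<in> B"
    have "(\<Sum>m\<in>S b. f b m) \<in> wspan (\<lambda>m. m \<in> ?M)"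
      unfolding wspan_def using b Sf(2) by (intro span_sum span_base) blast
    then show "b \<in> wspan (\<lambda>m. m \<in> ?M)" using Sf(3)[of b] by simp
  qed
  then have "span B \<subseteq> wspan (\<lambda>m. m \<in> ?M)"
    unfolding wspan_def by (intro span_minimal subspace_span)
  then show ?thesis using B Sf(1) by (intro exI[of _ ?M]) auto
qed

inductive_set gen :: "(10 \<Rightarrow> real) \<Rightarrow> 'm \<Rightarrow> 'm set" for m w where
  base: "w \<in> gen m w"
| step: "x \<in> gen m w \<Longrightarrow> pos a < pos b \<Longrightarrow> F b a x \<in> gen m w"

lemma gen_weight:
  assumes "sing m w" "x \<in> gen m w"
  shows "x = w \<or> (\<exists>n. wvec n x \<and> ht n < ht m)"
  using assms(2)
proof induction
  case (step x a b)
  have "wvec m w" using assms(1) by (simp add: sing_def)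
  then obtain n where "wvec n x" "ht n \<le> ht m" using step by fastforce
  then have "wvec (\<lambda>c. n c + root b a c) (F b a x)" "ht (\<lambda>c. n c + root b a c) < ht m"
    using F_root step(2) by (auto simp: ht_add ht_root)
  then show ?case by blast
qed simp

text \<open>A raising operator is commuted past the lowering operators until it meets \<open>w\<close>.\<close>

lemma span_gen:
  assumes "sing m w"
  shows "span (gen m w) = UNIV"
proof -
  have "F a b x \<in> span (gen m w)" if "x \<in> gen m w" for x a b
    using that
  proof (induction arbitrary: a b)
    case base
    consider "pos a < pos b" | "a = b" | "pos b < pos a" using pos_inj[of a b] by linarith
    then show ?case
    proof cases
      case 1
      then show ?thesis using assms by (simp add: sing_def span_zero)
    next
      case 2
      then show ?thesis using assms by (auto simp: sing_def wvec_def intro: span_scale span_base gen.base)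
    next
      case 3
      then show ?thesis by (intro span_base gen.step gen.base)
    qed
  next
    case (step x c d)
    have "y \<in> span (gen m w) \<Longrightarrow> F d c y \<in> span (gen m w)" for y
      by (induction rule: span_induct_alt)
        (auto simp: F_add F_sc span_zero intro!: span_add span_scale intro: span_base gen.step step(2))
    then show ?case unfolding F_swap[of a b d c]
      using step(3) by (intro span_add span_diff) (auto simp: span_zero)
  qed
  then have "stable (span (gen m w))" by (rule stable_span)
  then show ?thesis
    using stable_eq_UNIV[of _ w] assms by (auto simp: sing_def intro: span_base gen.base)
qed

text \<open>A complement of the line through \<open>v\<close>, by \<open>decompose\<close> and
  \<open>v_notin_low\<close>. Coefficients of \<open>v\<close> are computed modulo
  \<open>low\<close>, where all lowering operators vanish by \<open>F_low\<close>.\<close>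

abbreviation low :: "'m set" where
  "low \<equiv> wspan (\<lambda>n. ht n < ht lm)"

lemma decompose: "\<exists>c. x - sc c v \<in> low"
proof -
  have "x \<in> span (gen lm v)" using span_gen[OF sing_v] by simp
  then show ?thesis
  proof (induction rule: span_induct_alt)
    case base
    then show ?case by (intro exI[of _ 0]) (simp add: wspan_def span_zero)
  next
    case (step c y z)
    obtain d where d: "z - sc d v \<in> low" using step by blast
    show ?case
    proof (cases "y = v")
      case True
      then have "sc c y + z - sc (c + d) v = z - sc d v" by (simp add: scale_left_distrib)
      then show ?thesis using d by metis
    next
      case False
      then have "y \<in> low" unfolding wspan_def
        using gen_weight[OF sing_v step(1)] by (intro span_base) auto
      then have "sc c y + (z - sc d v) \<in> low"
        using d unfolding wspan_def by (intro span_add span_scale)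
      then show ?thesis by (intro exI[of _ d]) (simp add: algebra_simps)
    qed
  qed
qed

lemma v_notin_low: "v \<notin> low"
  using wvec_wspan_eq_0[of v "\<lambda>n. ht n < ht lm" lm] sing_v by (auto simp: sing_def)

lemma F_low:
  assumes "pos a < pos b"
  shows "F b a x \<in> low"
proof -
  have *: "ht n \<le> ht lm \<Longrightarrow> wvec n y \<Longrightarrow> F b a y \<in> low" for n y
    unfolding wspan_def
    using F_root[of n y b a] assms by (intro span_base) (auto simp: ht_add ht_root intro!: exI)
  obtain c where c: "x - sc c v \<in> low" using decompose by blast
  have "y \<in> low \<Longrightarrow> F b a y \<in> low" for y
    unfolding wspan_def[of "\<lambda>n. ht n < ht lm"]
  proof (induction rule: span_induct_alt)
    case (step c x y)
    then obtain n where "ht n < ht lm" "wvec n x" by blast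
    then have "F b a x \<in> low" by (intro *[of n]) simp_all
    then show ?case using step(2) unfolding wspan_def
      by (auto simp: F_add F_sc intro!: span_add span_scale)
  qed (simp add: span_zero)
  then have "F b a (x - sc c v) \<in> low" using c by blast
  moreover have "sc c (F b a v) \<in> low"
    using *[of lm v] sing_v by (auto simp: sing_def wspan_def intro!: span_scale)
  ultimately have "F b a (x - sc c v) + sc c (F b a v) \<in> low"
    unfolding wspan_def by (rule span_add)
  then show ?thesis by (simp add: F_diff F_sc)
qed

text \<open>Lowering operators applied to a singular vector already span the module, and each of
  them decreases the height.\<close>

lemma weight_le:
  assumes "sing m w" "wvec n x" "x \<noteq> 0"
  shows "n = m \<or> ht n < ht m"
proof (rule ccontr)
  assume no: "\<not> ?thesis"
  have "gen m w \<subseteq> wspan (\<lambda>n. n = m \<or> ht n < ht m)"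
  proof
    fix y assume "y \<in> gen m w"
    then show "y \<in> wspan (\<lambda>n. n = m \<or> ht n < ht m)"
      unfolding wspan_def using gen_weight[OF assms(1), of y] assms(1)
      by (intro span_base) (auto simp: sing_def)
  qed
  then have "wspan (\<lambda>n. n = m \<or> ht n < ht m) = UNIV"
    using span_gen[OF assms(1)] span_minimal[of "gen m w" "wspan (\<lambda>n. n = m \<or> ht n < ht m)"]
      subspace_span by (auto simp: wspan_def)
  then have "x = 0" using assms(2) no by (intro wvec_wspan_eq_0) auto
  then show False using assms(3) by simp
qed

lemma singular_weight_unique: "sing m w \<Longrightarrow> m = lm"
  using weight_le[of m w lm v] weight_le[of lm v m w] sing_v by (auto simp: sing_def)

text \<open>The vectors on which \<open>Cas\<close> takes its value at \<open>v\<close> form a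
  stable subspace, because \<open>Cas\<close> commutes with the action.\<close>

lemma Cas_scalar: "Cas w = sc (of_real (cas lm)) w"
proof -
  let ?K = "{w. Cas w = sc (of_real (cas lm)) w}"
  have "stable ?K"
    by (auto simp: stable_def subspace_def Cas_add Cas_sc Cas_F F_sc scale_right_distrib mult.commute)
      (simp add: Cas_def)
  then have "?K = UNIV"
    using stable_eq_UNIV[of ?K v] Cas_singular[OF sing_v] sing_v by (auto simp: sing_def)
  then show ?thesis by blast
qed

end

section \<open>Tensor products\<close>

text \<open>The tensor product of an irreducible highest weight module with a module that has the basis
  \<open>'n\<close>, given by \<open>F\<^sub>a\<^sub>b x\<^sub>i = (\<Sum>j. X a b i j x\<^sub>j)\<close>. The vector \<open>w\<close> stands for
  \<open>(\<Sum>i. x\<^sub>i \<otimes> w $ i)\<close>.\<close>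

locale tensor_module = hw_module sc F lm v
  for sc :: "complex \<Rightarrow> 'v::ab_group_add \<Rightarrow> 'v" and F lm v +
  fixes X :: "10 \<Rightarrow> 10 \<Rightarrow> 'n::finite \<Rightarrow> 'n \<Rightarrow> complex" and wx :: "'n \<Rightarrow> 10 \<Rightarrow> real" and kX :: real
  assumes X_skew: "X (b + 5) (a + 5) i j = - X a b i j"
    and X_comm: "(\<Sum>k\<in>UNIV. X c d i k * X a b k j) - (\<Sum>k\<in>UNIV. X a b i k * X c d k j) =
      (if b = c then X a d i j else 0) - (if a = d then X c b i j else 0)
      - (if b = d + 5 then X a (c + 5) i j else 0) - (if a + 5 = c then X (b + 5) d i j else 0)"
    and X_diag: "X a a i j = (if i = j then of_real (wx i a) else 0)"
    and X_cas: "(\<Sum>a\<in>UNIV. \<Sum>b\<in>UNIV. \<Sum>k\<in>UNIV. X b a i k * X a b k j)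
      = (if i = j then of_real kX else 0)"
begin

definition tsc :: "complex \<Rightarrow> 'v ^ 'n \<Rightarrow> 'v ^ 'n" where
  "tsc x w = (\<chi> i. sc x (w $ i))"

definition TF :: "10 \<Rightarrow> 10 \<Rightarrow> 'v ^ 'n \<Rightarrow> 'v ^ 'n" where
  "TF a b w = (\<chi> j. (\<Sum>i\<in>UNIV. sc (X a b i j) (w $ i)) + F a b (w $ j))"

text \<open>The mixed part of the Casimir operator. The factor 1/2 accounts for each generator
  occurring twice, as \<open>F a b\<close> and as \<open>- F (b + 5) (a + 5)\<close>.\<close>

definition Theta :: "'v ^ 'n \<Rightarrow> 'v ^ 'n" where
  "Theta w = (\<chi> r. sc (1/2) (\<Sum>a\<in>UNIV. \<Sum>b\<in>UNIV. \<Sum>i\<in>UNIV. sc (X a b i r) (F b a (w $ i))))"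

lemma tsc_nth [simp]: "tsc x w $ i = sc x (w $ i)"
  by (simp add: tsc_def)

lemma TF_TF_nth: "TF a b (TF c d w) $ j =
    (\<Sum>k\<in>UNIV. sc (\<Sum>i\<in>UNIV. X c d k i * X a b i j) (w $ k))
    + (\<Sum>i\<in>UNIV. sc (X a b i j) (F c d (w $ i))) + (\<Sum>i\<in>UNIV. sc (X c d i j) (F a b (w $ i)))
    + F a b (F c d (w $ j))"
proof -
  have "(\<Sum>i\<in>UNIV. sc (X a b i j) (\<Sum>k\<in>UNIV. sc (X c d k i) (w $ k)))
      = (\<Sum>k\<in>UNIV. sc (\<Sum>i\<in>UNIV. X c d k i * X a b i j) (w $ k))"
    unfolding scale_sum_right scale_sum_left scale_scale
    by (subst sum.swap) (simp add: mult.commute)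
  then show ?thesis
    by (simp add: TF_def scale_right_distrib sum.distrib F_add F_sum F_sc)
qed

sublocale T: o10_module tsc TF
proof
  fix a b c d :: 10 and x y :: complex and w u :: "'v ^ 'n"
  show "TF (b + 5) (a + 5) w = - TF a b w"
    by (simp add: TF_def vec_eq_iff X_skew skew sum_negf)
  have s: "(\<Sum>k\<in>UNIV. sc (if p then x k else 0) (w $ k)) = (if p then \<Sum>k\<in>UNIV. sc (x k) (w $ k) else 0)"
    for p and x :: "'n \<Rightarrow> complex" by simp
  have "(TF a b (TF c d w) - TF c d (TF a b w)) $ j =
      ((if b = c then TF a d w else 0) - (if a = d then TF c b w else 0)
      - (if b = d + 5 then TF a (c + 5) w else 0) - (if a + 5 = c then TF (b + 5) d w else 0)) $ j" for j
  proof -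
    have "(TF a b (TF c d w) - TF c d (TF a b w)) $ j =
      (\<Sum>k\<in>UNIV. sc ((\<Sum>i\<in>UNIV. X c d k i * X a b i j) - (\<Sum>i\<in>UNIV. X a b k i * X c d i j)) (w $ k))
      + (F a b (F c d (w $ j)) - F c d (F a b (w $ j)))"
      by (simp add: TF_TF_nth scale_left_diff_distrib sum_subtractf)
    also have "\<dots> = ((if b = c then TF a d w else 0) - (if a = d then TF c b w else 0)
      - (if b = d + 5 then TF a (c + 5) w else 0) - (if a + 5 = c then TF (b + 5) d w else 0)) $ j"
      unfolding X_comm comm scale_left_diff_distrib sum_subtractf s by (simp add: TF_def)
    finally show ?thesis .
  qed
  then show "TF a b (TF c d w) - TF c d (TF a b w) =
      (if b = c then TF a d w else 0) - (if a = d then TF c b w else 0)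
      - (if b = d + 5 then TF a (c + 5) w else 0) - (if a + 5 = c then TF (b + 5) d w else 0)"
    by (simp add: vec_eq_iff)
qed (simp_all add: vec_eq_iff TF_def scale_right_distrib scale_left_distrib scale_sum_right F_add F_sc
    sum.distrib mult.commute)

text \<open>Polarization: \<open>\<Delta>(F\<^sub>a\<^sub>b F\<^sub>b\<^sub>a)\<close> contains the mixed term \<open>F\<^sub>a\<^sub>b \<otimes> F\<^sub>b\<^sub>a\<close> twice after summation.\<close>

lemma Theta_Cas: "tsc 4 (Theta w) = T.Cas w - tsc (of_real (kX + cas lm)) w"
proof -
  have "T.Cas w $ j = (tsc 4 (Theta w) + tsc (of_real (kX + cas lm)) w) $ j" for j
  proof -
    let ?A = "\<Sum>a\<in>UNIV. \<Sum>b\<in>UNIV. \<Sum>i\<in>UNIV. sc (X a b i j) (F b a (w $ i))"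
    have 1: "(\<Sum>a\<in>UNIV. \<Sum>b\<in>UNIV. \<Sum>k\<in>UNIV. sc (\<Sum>i\<in>UNIV. X b a k i * X a b i j) (w $ k))
        = sc (of_real kX) (w $ j)"
    proof -
      have "(\<Sum>a\<in>UNIV. \<Sum>b\<in>UNIV. \<Sum>k\<in>UNIV. sc (\<Sum>i\<in>UNIV. X b a k i * X a b i j) (w $ k))
        = (\<Sum>k\<in>UNIV. sc (\<Sum>a\<in>UNIV. \<Sum>b\<in>UNIV. \<Sum>i\<in>UNIV. X b a k i * X a b i j) (w $ k))"
        unfolding scale_sum_left by (subst (2) sum.swap) (subst (1) sum.swap, rule refl)
      then show ?thesis unfolding X_cas by (simp add: if_distrib[of "\<lambda>x. sc x _"] cong: if_cong)
    qed
    have 2: "(\<Sum>a\<in>UNIV. \<Sum>b\<in>UNIV. \<Sum>i\<in>UNIV. sc (X b a i j) (F a b (w $ i))) = ?A"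
      by (rule sum.swap)
    have "T.Cas w $ j = sc (of_real kX) (w $ j) + ?A + ?A + Cas (w $ j)"
      unfolding T.Cas_def sum_component TF_TF_nth sum.distrib 1 2 Cas_def ..
    moreover have "sc 2 ?A = ?A + ?A" using scale_left_distrib[of 1 1 ?A] by simp
    ultimately show ?thesis
      by (simp add: Theta_def Cas_scalar scale_left_distrib algebra_simps)
  qed
  then show ?thesis by (simp add: vec_eq_iff)
qed

lemma Theta_eq: "Theta w = tsc (1/4) (T.Cas w - tsc (of_real (kX + cas lm)) w)"
  unfolding Theta_Cas[symmetric] by simp

lemma Theta_TF: "Theta (TF a b w) = TF a b (Theta w)"
  unfolding Theta_eq by (simp only: T.Cas_F T.F_sc T.F_diff)

lemma Theta_add: "Theta (u + w) = Theta u + Theta w"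
  unfolding Theta_eq by (simp add: T.Cas_add T.scale_right_distrib algebra_simps)

lemma Theta_tsc: "Theta (tsc x w) = tsc x (Theta w)"
  unfolding Theta_eq by (simp add: T.Cas_sc T.scale_right_diff_distrib mult.commute)

lemma Theta_diff: "Theta (u - w) = Theta u - Theta w"
  using Theta_add[of "u - w" w] by (simp add: algebra_simps)

definition tht :: "'n \<Rightarrow> real" where
  "tht i = ht (wx i)"

definition wt :: "'n \<Rightarrow> 10 \<Rightarrow> real" where
  "wt i a = lm a + wx i a"

lemma Theta_singular:
  assumes "T.sing m u"
  shows "Theta u = tsc (of_real ((cas m - kX - cas lm) / 4)) u"
  unfolding Theta_eq T.Cas_singular[OF assms]
  by (simp only: T.scale_left_diff_distrib[symmetric] T.scale_scale) (simp add: field_simps)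

text \<open>The entry (i, j) of the commutator of \<open>X a b\<close> with \<open>X c c\<close> is
  computed twice: from the diagonal form of \<open>X c c\<close>, and from
  \<open>X_comm\<close>.\<close>

lemma X_weight:
  assumes "X a b i j \<noteq> 0"
  shows "wx j c = wx i c + root a b c"
proof -
  have "(\<Sum>k\<in>UNIV. X a b i k * X c c k j) - (\<Sum>k\<in>UNIV. X c c i k * X a b k j) =
      of_real (wx j c - wx i c) * X a b i j"
    by (simp add: X_diag if_distrib[of "\<lambda>x. _ * x"] if_distrib[of "\<lambda>x. x * _"] algebra_simps cong: if_cong)
  moreover have t: "(if c = a then X c b i j else 0) = of_real (of_bool (c = a)) * X a b i j"
      "(if c = b then X a c i j else 0) = of_real (of_bool (c = b)) * X a b i j"
      "(if c = b + 5 then X c (a + 5) i j else 0) = - of_real (of_bool (c = b + 5)) * X a b i j"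
      "(if c + 5 = a then X (c + 5) b i j else 0) = of_real (of_bool (c = a + 5)) * X a b i j"
    using X_skew[of b a i j] by (simp_all add: add_5_eq_iff)
  ultimately have "of_real (wx j c - wx i c) * X a b i j = of_real (root a b c) * X a b i j"
    unfolding X_comm[of a b i c c j] t(1-4)
    by (simp only: root_def of_real_add of_real_diff) (simp only: algebra_simps mult_minus_left mult_minus_right add_uminus_conv_diff)
  then show ?thesis using assms by (simp flip: of_real_diff)
qed

lemma wvec_axis:
  assumes "wvec m x"
  shows "T.wvec (\<lambda>a. m a + wx i a) (axis i x)"
  using assms by (auto simp: T.wvec_def wvec_def TF_def axis_def vec_eq_iff X_diag scale_left_distrib
      if_distrib[of "\<lambda>x. sc x _"] if_distrib[of "\<lambda>x. sc _ x"] cong: if_cong)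

lemma T_finite_weights: "\<exists>M. finite M \<and> T.wspan (\<lambda>m. m \<in> M) = UNIV"
proof -
  obtain M where M: "finite M" "wspan (\<lambda>m. m \<in> M) = UNIV" using finite_weights by blast
  let ?M = "(\<lambda>(m, i) a. m a + wx i a) ` (M \<times> UNIV)"
  have "w \<in> T.wspan (\<lambda>m. m \<in> ?M)" for w
  proof -
    have "axis i x \<in> T.wspan (\<lambda>m. m \<in> ?M)" for i x
    proof -
      have "x \<in> wspan (\<lambda>m. m \<in> M)" using M by simp
      then show ?thesis unfolding wspan_def
      proof (induction rule: span_induct_alt)
        case base
        have "axis i (0::'v) = 0" by (simp add: axis_def vec_eq_iff)
        then show ?case unfolding T.wspan_def by (metis T.span_zero)
      next
        case (step c x y)
        have "axis i (sc c x + y) = tsc c (axis i x) + axis i y"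
          by (simp add: axis_def vec_eq_iff)
        moreover have "axis i x \<in> T.wspan (\<lambda>m. m \<in> ?M)"
        proof -
          obtain m where m: "m \<in> M" "wvec m x" using step(1) by blast
          then have "(\<lambda>a. m a + wx i a) \<in> ?M" by force
          then show ?thesis
            using wvec_axis[OF m(2)] unfolding T.wspan_def by (intro T.span_base) blast
        qed
        then have "tsc c (axis i x) + axis i y \<in> T.wspan (\<lambda>m. m \<in> ?M)"
          using step(2) unfolding T.wspan_def by (intro T.span_add T.span_scale)
        ultimately show ?case by simp
      qed
    qed
    then have "(\<Sum>i\<in>UNIV. axis i (w $ i)) \<in> T.wspan (\<lambda>m. m \<in> ?M)"
      unfolding T.wspan_def by (intro T.span_sum)
    also have "(\<Sum>i\<in>UNIV. axis i (w $ i)) = w"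
      by (simp add: vec_eq_iff axis_def)
    finally show ?thesis .
  qed
  then show ?thesis using M(1) by (intro exI[of _ ?M]) auto
qed

text \<open>The component of a singular vector at a minimal weight of the first factor is singular.\<close>

lemma singular_weight:
  assumes "T.sing m w"
  shows "\<exists>i. m = wt i"
proof -
  let ?I = "{i. w $ i \<noteq> 0}"
  have "?I \<noteq> {}" using assms by (auto simp: T.sing_def vec_eq_iff)
  then obtain i where i: "w $ i \<noteq> 0" "\<And>j. w $ j \<noteq> 0 \<Longrightarrow> tht i \<le> tht j"
    using ex_min_if_finite[of "tht ` ?I"] by force
  have "F a b (w $ i) = 0" if "pos a < pos b" for a b
  proof -
    have "X a b k i = 0 \<or> w $ k = 0" for k
    proof (rule ccontr)
      assume no: "\<not> ?thesis"
      then have "wx i = (\<lambda>c. wx k c + root a b c)" using X_weight by blast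
      then have "tht i > tht k" using that by (simp add: tht_def ht_add ht_root)
      then show False using i(2)[of k] no by simp
    qed
    then have "(\<Sum>k\<in>UNIV. sc (X a b k i) (w $ k)) = 0" by (intro sum.neutral) auto
    moreover have "TF a b w $ i = 0" using assms that by (simp add: T.sing_def)
    ultimately show ?thesis by (simp add: TF_def)
  qed
  moreover have "wvec (\<lambda>a. m a - wx i a) (w $ i)"
    unfolding wvec_def
  proof
    fix a
    have "TF a a w $ i = sc (of_real (m a)) (w $ i)"
      using assms by (simp add: T.sing_def T.wvec_def)
    then show "F a a (w $ i) = sc (of_real (m a - wx i a)) (w $ i)"
      by (simp add: TF_def X_diag if_distrib[of "\<lambda>x. sc x _"] scale_left_diff_distrib algebra_simps cong: if_cong)
  qed
  ultimately have "sing (\<lambda>a. m a - wx i a) (w $ i)" using i(1) by (simp add: sing_def)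
  then have "m a - wx i a = lm a" for a by (metis singular_weight_unique)
  then have "m a = wt i a" for a by (metis wt_def diff_add_cancel)
  then show ?thesis by blast
qed

lemma Theta_eigenvector:
  assumes "Theta w = tsc s w" "w \<noteq> 0"
  shows "\<exists>i u. T.sing (wt i) u \<and> s = of_real ((cas (wt i) - kX - cas lm) / 4)
    \<and> (\<forall>a b. pos a < pos b \<longrightarrow> b \<noteq> a + 5 \<longrightarrow> wt i a - wt i b \<in> \<nat>)"
proof -
  obtain M where M: "finite M" "T.wspan (\<lambda>m. m \<in> M) = UNIV" using T_finite_weights by blast
  let ?K = "{w. Theta w = tsc s w}"
  have "T.stable ?K"
    by (auto simp: T.stable_def T.subspace_def Theta_add Theta_tsc Theta_TF T.F_sc
        T.scale_right_distrib mult.commute) (metis T.scale_zero_left T.scale_zero_right Theta_tsc)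
  then obtain m u where u: "u \<in> ?K" "T.sing m u"
    using T.singular_in_stable[of ?K w M] assms M by auto
  obtain i where i: "m = wt i" using singular_weight[OF u(2)] by blast
  have "tsc s u = Theta u" using u(1) by simp
  also have "\<dots> = tsc (of_real ((cas m - kX - cas lm) / 4)) u" by (rule Theta_singular[OF u(2)])
  finally have "s = of_real ((cas m - kX - cas lm) / 4)"
    using u(2) by (metis T.scale_cancel_right T.sing_def)
  then show ?thesis using u i T.singular_dominant[OF u(2) M] by blast
qed

lemma T_fin_dim: "\<exists>B. finite B \<and> T.span B = UNIV"
proof -
  obtain B where B: "finite B" "span B = UNIV" using fin_dim by blast
  let ?B = "(\<lambda>(i, b). axis i b) ` (UNIV \<times> B)"
  have "w \<in> T.span ?B" for w
  proof -
    have "axis i x \<in> T.span ?B" for i x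
    proof -
      have "x \<in> span B" using B by simp
      then show ?thesis
      proof (induction rule: span_induct_alt)
        case base
        have "axis i (0::'v) = 0" by (simp add: axis_def vec_eq_iff)
        then show ?case by (metis T.span_zero)
      next
        case (step c x y)
        have "axis i (sc c x + y) = tsc c (axis i x) + axis i y"
          by (simp add: axis_def vec_eq_iff)
        moreover have "axis i x \<in> T.span ?B" using step(1) by (intro T.span_base) auto
        then have "tsc c (axis i x) + axis i y \<in> T.span ?B"
          using step(2) by (intro T.span_add T.span_scale)
        ultimately show ?case by simp
      qed
    qed
    then have "(\<Sum>i\<in>UNIV. axis i (w $ i)) \<in> T.span ?B"
      by (intro T.span_sum)
    also have "(\<Sum>i\<in>UNIV. axis i (w $ i)) = w"
      by (simp add: vec_eq_iff axis_def)
    finally show ?thesis .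
  qed
  then show ?thesis using B by (intro exI[of _ ?B]) auto
qed

text \<open>Injectivity suffices in finite dimension. In this way the exclusion of eigenvalues
  becomes the solvability of an equation.\<close>

lemma Theta_surj:
  assumes "\<And>w. Theta w = tsc s w \<Longrightarrow> w = 0"
  shows "\<exists>u. Theta u - tsc s u = w"
proof -
  let ?f = "\<lambda>u. Theta u - tsc s u"
  obtain B where B: "finite B" "T.span B = UNIV" using T_fin_dim by blast
  obtain B' where B': "B' \<subseteq> B" "T.independent B'" "B \<subseteq> T.span B'"
    using T.maximal_independent_subset[of B] by blast
  have "T.span B' = UNIV" using B B' T.span_minimal[of B "T.span B'"] by auto
  then interpret D: finite_dimensional_vector_space tsc B'
    using B B' by unfold_locales (auto intro: finite_subset)
  have lin: "Vector_Spaces.linear tsc tsc ?f"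
    by unfold_locales (simp_all add: Theta_add Theta_tsc T.scale_right_distrib T.scale_right_diff_distrib
      algebra_simps)
  have "inj ?f"
  proof (rule injI)
    fix x y assume "?f x = ?f y"
    then have "Theta (x - y) = tsc s (x - y)"
      by (simp add: Theta_diff T.scale_right_diff_distrib algebra_simps)
    from assms[OF this] show "x = y" by simp
  qed
  then have "surj ?f" using D.linear_inj_imp_surj[OF lin] by blast
  then obtain u where "w = ?f u" by (rule surjE)
  then show ?thesis by (intro exI[of _ u]) simp
qed

end

section \<open>The natural module\<close>

text \<open>Transposed against the matrix \<open>Fm a b\<close>: the index i is the basis vector
  acted upon, j the one in the image.\<close>

definition XU :: "10 \<Rightarrow> 10 \<Rightarrow> 10 \<Rightarrow> 10 \<Rightarrow> complex" where
  "XU a b i j = of_bool (j = a \<and> i = b) - of_bool (j = b + 5 \<and> i = a + 5)"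

definition wU :: "10 \<Rightarrow> 10 \<Rightarrow> real" where
  "wU i a = of_bool (a = i) - of_bool (a = i + 5)"

lemma sum_of_bool_conj:
  "(\<Sum>k\<in>(UNIV::10 set). of_bool (k = c \<and> P) * of_bool (Q \<and> k = b)) = (of_bool (c = b \<and> P \<and> Q) :: complex)"
proof -
  have "(\<Sum>k\<in>(UNIV::10 set). of_bool (k = c \<and> P) * of_bool (Q \<and> k = b))
      = (\<Sum>k\<in>(UNIV::10 set). if k = c then of_bool (c = b \<and> P \<and> Q) else (0::complex))"
    by (rule sum.cong) auto
  then show ?thesis by simp
qed

lemma XU_comm: "(\<Sum>k\<in>UNIV. XU c d i k * XU a b k j) - (\<Sum>k\<in>UNIV. XU a b i k * XU c d k j) =
      (if b = c then XU a d i j else 0) - (if a = d then XU c b i j else 0)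
      - (if b = d + 5 then XU a (c + 5) i j else 0) - (if a + 5 = c then XU (b + 5) d i j else 0)"
proof -
  have P: "(\<Sum>k\<in>UNIV. XU c d i k * XU a b k j) = of_bool (c = b \<and> i = d \<and> j = a)
      - of_bool (c = a + 5 \<and> i = d \<and> j = b + 5) - of_bool (d + 5 = b \<and> i = c + 5 \<and> j = a)
      + of_bool (d + 5 = a + 5 \<and> i = c + 5 \<and> j = b + 5)" for a b c d
    unfolding XU_def left_diff_distrib right_diff_distrib sum_subtractf sum_of_bool_conj by simp
  have 1: "(\<Sum>k\<in>UNIV. XU c d i k * XU a b k j) = of_bool (b = c) * of_bool (i = d) * of_bool (j = a)
      - of_bool (a + 5 = c) * of_bool (i = d) * of_bool (j = b + 5)
      - of_bool (b = d + 5) * of_bool (i = c + 5) * of_bool (j = a)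
      + of_bool (a = d) * of_bool (i = c + 5) * of_bool (j = b + 5)"
    unfolding P of_bool_conj by (simp add: eq_commute[of c] eq_commute[of "d + 5"] eq_commute[of d])
  have 2: "(\<Sum>k\<in>UNIV. XU a b i k * XU c d k j) = of_bool (a = d) * of_bool (i = b) * of_bool (j = c)
      - of_bool (a + 5 = c) * of_bool (i = b) * of_bool (j = d + 5)
      - of_bool (b = d + 5) * of_bool (i = a + 5) * of_bool (j = c)
      + of_bool (b = c) * of_bool (i = a + 5) * of_bool (j = d + 5)"
    unfolding P of_bool_conj by (simp add: add_5_eq_iff)
  have 3: "(if p then x else 0) = of_bool p * x" for p and x :: complex by simp
  show ?thesis
    unfolding 1 2 unfolding 3 XU_def of_bool_conj add_5_5 by (simp only: algebra_simps)
qed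

text \<open>The number 18 = 2 + 16 is the value of \<open>cas\<close> at the highest weight of the
  natural module.\<close>

lemma XU_cas: "(\<Sum>a\<in>UNIV. \<Sum>b\<in>UNIV. \<Sum>k\<in>UNIV. XU b a i k * XU a b k j) = (if i = j then of_real 18 else 0)"
proof -
  have "(\<Sum>k\<in>UNIV. XU b a i k * XU a b k j) = of_bool (i = a \<and> j = a)
      - of_bool (b = a + 5 \<and> i = a \<and> j = b + 5) - of_bool (a + 5 = b \<and> i = b + 5 \<and> j = a)
      + of_bool (i = b + 5 \<and> j = b + 5)" for a b
    unfolding XU_def left_diff_distrib right_diff_distrib sum_subtractf sum_of_bool_conj by simp
  also have "\<dots> a b = (if a = i then of_bool (i = j) else 0) - (if b = a + 5 then of_bool (i = a \<and> i = j) else 0)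
      - (if b = a + 5 then of_bool (i = a \<and> i = j) else 0) + (if b = i + 5 then of_bool (i = j) else 0)" for a b
    by (auto simp: add_5_eq_iff)
  finally have "(\<Sum>a\<in>UNIV. \<Sum>b\<in>UNIV. \<Sum>k\<in>UNIV. XU b a i k * XU a b k j)
    = (\<Sum>a\<in>UNIV. \<Sum>b\<in>(UNIV::10 set). if a = i then of_bool (i = j) else 0)
      - (\<Sum>a\<in>UNIV. \<Sum>b\<in>UNIV. if b = a + 5 then of_bool (i = a \<and> i = j) else 0)
      - (\<Sum>a\<in>UNIV. \<Sum>b\<in>UNIV. if b = a + 5 then of_bool (i = a \<and> i = j) else 0)
      + (\<Sum>a\<in>(UNIV::10 set). \<Sum>b\<in>UNIV. if b = i + 5 then of_bool (i = j) else 0)"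
    by (simp only: sum.distrib sum_subtractf)
  also have "(\<Sum>a\<in>UNIV. \<Sum>b\<in>(UNIV::10 set). if a = i then of_bool (i = j) else 0) = 10 * (of_bool (i = j) :: complex)"
    by (subst sum.swap) simp
  also have "(\<Sum>a\<in>UNIV. \<Sum>b\<in>UNIV. if b = a + 5 then of_bool (i = a \<and> i = j) else 0)
      = (\<Sum>a\<in>UNIV. if a = i then of_bool (i = j) else (0::complex))"
    by (intro sum.cong) auto
  also have "\<dots> = of_bool (i = j)" by simp
  finally show ?thesis by simp
qed

section \<open>Nonvanishing of the sum of the entries of a triangular eigenvector\<close>

lemma one_plus_inverse_nonzero:
  fixes D :: real
  assumes "D \<le> - 2"
  shows "1 + 1 / D \<noteq> 0"
  using assms by (simp add: field_simps)

text \<open>With x = 1/D and y = 1/D', the relation D + D' = K gives (K + 1) x y = x + y + x y,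
  which cancels the surplus of (1 + x)(1 + y) over 1. This is the step of the recursion past the
  middle, with D and D' at dual indices.\<close>

lemma triangular_sum_step:
  fixes K D D' a s P :: real
  assumes "D + D' = K" "D \<noteq> 0" "D' \<noteq> 0" "(K + 1) * s = a * (1 + 1 / D') * (K * P + 1)"
  shows "(K + 1) * (s + (s - a / D') / D) = a * (K * (P * (1 + 1 / D) * (1 + 1 / D')) + 1)"
proof -
  define x y where "x = 1 / D" and "y = 1 / D'"
  have xy: "D * x = 1" "D' * y = 1" "a / D' = a * y" "\<And>z. z / D = z * x"
    using assms(2,3) by (simp_all add: x_def y_def)
  have "(K + 1) * (x * y) = (D * x) * y + (D' * y) * x + x * y"
    unfolding assms(1)[symmetric] by (simp add: algebra_simps)
  then have e: "(K + 1) * (x * y) = x + y + x * y" by (simp add: xy)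
  have "(K + 1) * (s + (s - a * y) * x) = ((K + 1) * s) * (1 + x) - a * ((K + 1) * (x * y))"
    by (simp add: algebra_simps)
  also have "\<dots> = a * (K * (P * (1 + x) * (1 + y)) + 1)"
    unfolding assms(4)[folded y_def] e by (simp add: algebra_simps)
  finally show ?thesis unfolding xy(3) xy(4)[of "s - a * y"] x_def[symmetric] y_def[symmetric] .
qed

text \<open>The left eigenvector that is used in \<open>W_nonzero_if_gap\<close>, with indices counted from the lowest
  weight: \<open>m\<close> is the position of \<open>j\<close>, the index \<open>11 - q\<close> is dual to \<open>q\<close>, and \<open>d q\<close> is the difference of
  the eigenvalues at \<open>m\<close> and \<open>q\<close>.\<close>

function lev :: "nat \<Rightarrow> (nat \<Rightarrow> real) \<Rightarrow> nat \<Rightarrow> real" where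
  "lev m d q = (if q < m then 0 else if q = m then 1
     else ((\<Sum>i = 1..q - 1. lev m d i) - (if 5 < q then lev m d (11 - q) else 0)) / d q)"
  by pat_completeness auto
termination by (relation "Wellfounded.measure (\<lambda>(m, d, q). q)") auto

declare lev.simps [simp del]

text \<open>Up to the middle, the partial sums \<open>S q\<close> are products of factors \<open>1 + 1 / d q\<close>. Beyond it, they
  satisfy \<open>(K + 1) S\<^sub>q = S\<^bsub>10 - q\<^esub> (K P + 1)\<close> with \<open>K = d (11 - m)\<close> and a product \<open>P\<close> of such factors,
  and at the index dual to \<open>m\<close> the partial sum collapses to \<open>P\<close>.\<close>

lemma sum_lev_nonzero:
  assumes m: "1 \<le> m" "m \<le> 10"
    and dual: "\<And>q. 1 \<le> q \<Longrightarrow> q \<le> 10 \<Longrightarrow> d q + d (11 - q) = d (11 - m)"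
    and D: "\<And>q. m < q \<Longrightarrow> q \<le> 10 \<Longrightarrow> q + m \<noteq> 11 \<Longrightarrow> d q \<le> - 2"
  shows "(\<Sum>i = 1..10. lev m d i) \<noteq> 0"
proof -
  define S where "S q = (\<Sum>i = 1..q. lev m d i)" for q
  have S_0: "S q = 0" if "q < m" for q using that by (simp add: S_def lev.simps)
  have S_Suc: "S (Suc q) = S q + lev m d (Suc q)" for q by (simp add: S_def)
  have lev: "lev m d (Suc q) = (S q - (if 5 \<le> q then lev m d (10 - q) else 0)) / d (Suc q)" if "m \<le> q" for q
    using that by (subst lev.simps) (auto simp: S_def)
  have lev_0: "lev m d q = 0" if "q < m" for q using that by (simp add: lev.simps)
  have lev_m: "lev m d m = 1" by (simp add: lev.simps)
  have S_m: "S m = 1" using S_Suc[of "m - 1"] S_0[of "m - 1"] m lev_m by simp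
  have simple: "S (Suc q) = S q * (1 + 1 / d (Suc q))" if "m \<le> q" "q < 5 \<or> 10 - q < m" for q
    unfolding S_Suc lev[OF that(1)] using that(2) by (auto simp: lev_0 algebra_simps)
  have nonzero_Suc: "S (Suc q) \<noteq> 0" if "S q \<noteq> 0" "m \<le> q" "q < 10" "Suc q + m \<noteq> 11" "q < 5 \<or> 10 - q < m" for q
    unfolding simple[OF that(2,5)] using that one_plus_inverse_nonzero[OF D[of "Suc q"]] by simp
  have upper: "S 10 \<noteq> 0" if "S q \<noteq> 0" "m \<le> q" "11 \<le> q + m" "q \<le> 10" for q
    using that(4,1-3)
  proof (induction q rule: inc_induct)
    case (step q)
    have "S (Suc q) \<noteq> 0" using step.prems step.hyps by (intro nonzero_Suc) auto
    then show ?case using step.IH step.prems by simp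
  qed
  have lower: "S q \<noteq> 0" if "m \<le> q" "q \<le> 5" for q
    using that
  proof (induction q rule: dec_induct)
    case (step q)
    then show ?case by (intro nonzero_Suc) auto
  qed (simp add: S_m)
  consider "6 \<le> m" | "m = 5" | "m \<le> 4" by linarith
  then have "S 10 \<noteq> 0"
  proof cases
    case 1
    then show ?thesis using m by (intro upper[of m]) (auto simp: S_m)
  next
    case 2
    \<comment> \<open>For m = 5 the dual index is the next one, and its entry is 0, since its
      numerator is the entry at 5 minus itself.\<close>
    then have "S 6 = 1" using S_Suc[of 5] lev[of 5] S_m lev_m by simp
    then show ?thesis using 2 by (intro upper[of 6]) auto
  next
    case 3
    let ?K = "d (11 - m)"
    \<comment> \<open>The bound \<open>D\<close> leaves out the dual of m, but 5 and 6 are dual to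
      each other and both covered by it.\<close>
    have "?K = d 5 + d 6" using dual[of 5] by simp
    then have K: "?K \<noteq> 0" using D[of 5] D[of 6] 3 by simp
    have "\<exists>P. P \<noteq> 0 \<and> (?K + 1) * S q = S (10 - q) * (?K * P + 1)" if "5 \<le> q" "q \<le> 10 - m" for q
      using that
    proof (induction q rule: dec_induct)
      case base
      show ?case by (intro exI[of _ 1]) simp
    next
      case (step q)
      then obtain P where P: "P \<noteq> 0" "(?K + 1) * S q = S (10 - q) * (?K * P + 1)" by auto
      let ?a = "S (9 - q)" and ?D = "d (Suc q)" and ?D' = "d (10 - q)"
      have q: "Suc (9 - q) = 10 - q" "m \<le> 9 - q" "9 - q < 5" using step by auto
      have D2: "?D \<le> - 2" "?D' \<le> - 2" using step by (auto intro!: D)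
      have "?D + ?D' = ?K" using dual[of "Suc q"] step by simp
      moreover have a: "S (10 - q) = ?a * (1 + 1 / ?D')" using simple[of "9 - q"] q by simp
      moreover have "S (Suc q) = S q + (S q - ?a / ?D') / ?D"
        using S_Suc[of q] lev[of q] lev[of "9 - q"] q step by simp
      ultimately have "(?K + 1) * S (Suc q) = ?a * (?K * (P * (1 + 1 / ?D) * (1 + 1 / ?D')) + 1)"
        using triangular_sum_step[of ?D ?D' ?K "S q" ?a P] P(2) D2 by simp
      then show ?case
        using P(1) one_plus_inverse_nonzero[OF D2(1)] one_plus_inverse_nonzero[OF D2(2)]
        by (intro exI[of _ "P * (1 + 1 / ?D) * (1 + 1 / ?D')"]) simp
    qed
    moreover have "5 \<le> 10 - m" using 3 by simp
    \<comment> \<open>Taken at q = 10 - m, where the dual partial sum is S m = 1.\<close>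
    ultimately obtain P where P: "P \<noteq> 0" "(?K + 1) * S (10 - m) = ?K * P + 1"
      using 3 by (force simp: S_m)
    have "Suc (10 - m) = 11 - m" "m \<le> 10 - m" "5 \<le> 10 - m" "10 - (10 - m) = m" using 3 by auto
    then have "S (11 - m) = S (10 - m) + (S (10 - m) - 1) / ?K"
      using S_Suc[of "10 - m"] lev[of "10 - m"] lev_m by simp
    also have "\<dots> = ((?K + 1) * S (10 - m) - 1) / ?K" using K by (simp add: field_simps)
    also have "\<dots> = P" unfolding P using K by simp
    finally show ?thesis using 3 P(1) m by (intro upper[of "11 - m"]) auto
  qed
  then show ?thesis by (simp add: S_def)
qed

lemma sum_10: "(\<Sum>a\<in>(UNIV::10 set). f a) = f 1 + f 2 + f 3 + f 4 + f 5 + f 6 + f 7 + f 8 + f 9 + f 0"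
proof -
  have "(\<Sum>a\<in>(UNIV::10 set). f a)
      = f 1 + (f 2 + (f 3 + (f 4 + (f 5 + (f 6 + (f 7 + (f 8 + (f 9 + f 0))))))))"
    unfolding UNIV_10 by simp
  then show ?thesis by (simp only: add.assoc)
qed

lemma cas_eq:
  assumes "\<And>a. m (a + 5) = - m a"
  shows "cas m = 2 * ((m 1)\<^sup>2 + (m 2)\<^sup>2 + (m 3)\<^sup>2 + (m 4)\<^sup>2 + (m 5)\<^sup>2)
    + 16 * m 1 + 12 * m 2 + 8 * m 3 + 4 * m 4"
proof -
  have "m 6 = - m 1" "m 7 = - m 2" "m 8 = - m 3" "m 9 = - m 4" "m 0 = - m 5"
    using assms[of 1] assms[of 2] assms[of 3] assms[of 4] assms[of 5] by simp_all
  then show ?thesis unfolding cas_def sum_10 by simp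
qed

text \<open>The indices whose eigenvalues are divided out to reach j. For j = 10 the index 5 is left
  out: it is dual to 10, raising never leads from 10 to 5, and t 5 and t 10 may coincide. For j = 6
  the list is not cut at all.\<close>

definition pl :: "10 \<Rightarrow> 10 list" where
  "pl j = (if j = 10 then [1, 2, 3, 4] else takeWhile (\<lambda>i. i \<noteq> j) [1, 2, 3, 4, 5, 10, 9, 8, 7])"

text \<open>These are the pairs for which \<open>F r j\<close> is a positive root vector; dual pairs
  are excluded because \<open>F r j\<close> is then 0.\<close>

definition before :: "10 \<Rightarrow> 10 \<Rightarrow> bool" where
  "before r j \<longleftrightarrow> pos r < pos j \<and> r \<noteq> j + 5"

section \<open>Singular vectors in the tensor product with the natural module\<close>

locale natural_tensor = hw_module sc F lm v
  for sc :: "complex \<Rightarrow> 'v::ab_group_add \<Rightarrow> 'v" and F lm v +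
  assumes lm_odd: "lm (a + 5) = - lm a"
begin

sublocale N: tensor_module sc F lm v XU wU 18
proof
  show "XU (b + 5) (a + 5) i j = - XU a b i j" for a b i j by (auto simp: XU_def)
  show "XU a a i j = (if i = j then of_real (wU i a) else 0)" for a i j
    by (auto simp: XU_def wU_def)
qed (rule XU_comm XU_cas)+

text \<open>The two terms of \<open>XU\<close> contribute equally by \<open>skew\<close>, which
  absorbs the factor 1/2. In this form \<open>Theta\<close> is the operator by which
  \<open>flat_at\<close> is defined, see \<open>T'_emb\<close>.\<close>

lemma Theta_nth: "N.Theta w $ r = (\<Sum>i\<in>UNIV. F i r (w $ i))"
proof -
  have "(\<Sum>a\<in>UNIV. \<Sum>b\<in>UNIV. \<Sum>i\<in>UNIV. sc (XU a b i r) (F b a (w $ i)))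
      = (\<Sum>i\<in>UNIV. \<Sum>a\<in>UNIV. \<Sum>b\<in>UNIV. sc (XU a b i r) (F b a (w $ i)))"
    by (simp only: sum.swap[of "\<lambda>b i. sc (XU _ b i r) (F b _ (w $ i))"])
      (rule sum.swap)
  also have "\<dots> = (\<Sum>i\<in>UNIV. sc 2 (F i r (w $ i)))"
  proof (rule sum.cong)
    fix i
    have "(\<Sum>a\<in>UNIV. \<Sum>b\<in>UNIV. sc (XU a b i r) (F b a (w $ i)))
      = (\<Sum>a\<in>UNIV. \<Sum>b\<in>UNIV. (if b = i then (if a = r then F i r (w $ i) else 0) else 0)
          - (if b = r + 5 then (if a = i + 5 then F (r + 5) (i + 5) (w $ i) else 0) else 0))"
      by (intro sum.cong) (auto simp: XU_def scale_left_diff_distrib add_5_eq_iff)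
    also have "\<dots> = F i r (w $ i) - F (r + 5) (i + 5) (w $ i)"
      by (simp add: sum_subtractf)
    also have "\<dots> = sc 2 (F i r (w $ i))"
      using scale_left_distrib[of 1 1 "F i r (w $ i)"] by (simp add: skew)
    finally show "(\<Sum>a\<in>UNIV. \<Sum>b\<in>UNIV. sc (XU a b i r) (F b a (w $ i))) = sc 2 (F i r (w $ i))" .
  qed simp
  finally have e: "(\<Sum>a\<in>UNIV. \<Sum>b\<in>UNIV. \<Sum>i\<in>UNIV. sc (XU a b i r) (F b a (w $ i)))
      = (\<Sum>i\<in>UNIV. sc 2 (F i r (w $ i)))" .
  show ?thesis unfolding N.Theta_def vec_lambda_beta e unfolding scale_sum_right by simp
qed

definition t :: "10 \<Rightarrow> real" where
  "t j = (cas (N.wt j) - 18 - cas lm) / 4"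

lemma t_eq: "t j = lm j - (\<Sum>r\<in>UNIV. of_bool (before r j))"
proof -
  have l: "lm 6 = - lm 1" "lm 7 = - lm 2" "lm 8 = - lm 3" "lm 9 = - lm 4" "lm 10 = - lm 5"
    using lm_odd[of 1] lm_odd[of 2] lm_odd[of 3] lm_odd[of 4] lm_odd[of 5] by simp_all
  have "N.wt j (a + 5) = - N.wt j a" for a
    by (auto simp: N.wt_def wU_def lm_odd add_5_eq_iff)
  from cas_eq[of "N.wt j", OF this] cas_eq[of lm, OF lm_odd] have "t j = ((N.wt j 1)\<^sup>2 - (lm 1)\<^sup>2 + (N.wt j 2)\<^sup>2 - (lm 2)\<^sup>2
      + (N.wt j 3)\<^sup>2 - (lm 3)\<^sup>2 + (N.wt j 4)\<^sup>2 - (lm 4)\<^sup>2 + (N.wt j 5)\<^sup>2 - (lm 5)\<^sup>2) / 2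
      + 4 * wU j 1 + 3 * wU j 2 + 2 * wU j 3 + wU j 4 - 9 / 2"
    by (simp add: t_def N.wt_def algebra_simps add_divide_distrib diff_divide_distrib)
  then show ?thesis
    using exhaust_10[of j] l
    by (elim disjE) (simp_all add: N.wt_def wU_def before_def sum_10 power2_eq_square algebra_simps)
qed

fun Q :: "10 list \<Rightarrow> 'v ^ 10 \<Rightarrow> 'v ^ 10" where
  "Q [] w = w"
| "Q (b # ts) w = Q ts (N.Theta w - N.tsc (of_real (t b)) w)"

lemma Q_add: "Q ts (u + w) = Q ts u + Q ts w"
proof (induction ts arbitrary: u w)
  case (Cons b ts)
  have "N.Theta (u + w) - N.tsc (of_real (t b)) (u + w)
      = (N.Theta u - N.tsc (of_real (t b)) u) + (N.Theta w - N.tsc (of_real (t b)) w)"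
    by (simp add: N.Theta_add N.T.scale_right_distrib)
  then show ?case by (simp only: Q.simps Cons)
qed simp

lemma Q_tsc: "Q ts (N.tsc x w) = N.tsc x (Q ts w)"
proof (induction ts arbitrary: w)
  case (Cons b ts)
  have "N.Theta (N.tsc x w) - N.tsc (of_real (t b)) (N.tsc x w)
      = N.tsc x (N.Theta w - N.tsc (of_real (t b)) w)"
    by (simp add: N.Theta_tsc N.T.scale_right_diff_distrib mult.commute)
  then show ?case by (simp only: Q.simps Cons)
qed simp

lemma Q_TF: "Q ts (N.TF a b w) = N.TF a b (Q ts w)"
proof (induction ts arbitrary: w)
  case (Cons d ts)
  have "N.Theta (N.TF a b w) - N.tsc (of_real (t d)) (N.TF a b w)
      = N.TF a b (N.Theta w - N.tsc (of_real (t d)) w)"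
    by (simp add: N.Theta_TF N.T.F_diff N.T.F_sc)
  then show ?case by (simp only: Q.simps Cons)
qed simp

lemma Q_0 [simp]: "Q ts 0 = 0"
  using Q_add[of ts 0 0] by simp

lemma Q_minus: "Q ts (- w) = - Q ts w"
  using Q_add[of ts w "- w"] by (simp add: eq_neg_iff_add_eq_0 add.commute)

lemma Q_diff: "Q ts (u - w) = Q ts u - Q ts w"
  using Q_add[of ts u "- w"] by (simp add: Q_minus)

lemma Q_sum: "Q ts (\<Sum>i\<in>I. f i) = (\<Sum>i\<in>I. Q ts (f i))"
  by (induction I rule: infinite_finite_induct) (simp_all add: Q_add)

lemma Q_append: "Q (xs @ ys) w = Q ys (Q xs w)"
  by (induction xs arbitrary: w) simp_all

lemma Q_eigenvector:
  assumes "N.Theta w = N.tsc (of_real (t b)) w" "b \<in> set ts"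
  shows "Q ts w = 0"
  using assms
proof (induction ts arbitrary: w)
  case (Cons d ts)
  show ?case
  proof (cases "d = b")
    case False
    let ?w = "N.Theta w - N.tsc (of_real (t d)) w"
    have "N.Theta ?w = N.tsc (of_real (t b)) ?w"
      unfolding Cons.prems(1)
      by (simp add: N.Theta_tsc N.Theta_diff Cons.prems(1) N.T.scale_right_diff_distrib mult.commute)
    then show ?thesis using Cons False by simp
  qed (simp add: Cons.prems)
qed simp

lemma set_pl: "b \<in> set (pl j) \<longleftrightarrow> pos b < pos j \<and> \<not> (j = 10 \<and> b = 5)"
  using exhaust_10[of j] exhaust_10[of b] by (elim disjE) (simp_all add: pl_def)

lemma pl_split: "b \<in> set (pl j) \<Longrightarrow> \<exists>r. pl j = pl b @ r \<and> b \<in> set r"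
  using exhaust_10[of j] exhaust_10[of b] by (elim disjE) (simp_all add: pl_def)

definition W :: "10 \<Rightarrow> 'v ^ 10" where
  "W j = Q (pl j) (axis j v)"

lemma TF_axis:
  "N.TF a b (axis j x) = (if j = b then axis a x else 0) - (if j = a + 5 then axis (b + 5) x else 0)
    + axis j (F a b x)"
  by (auto simp: vec_eq_iff N.TF_def axis_def XU_def scale_left_diff_distrib sum_subtractf
      if_distrib[of "sc _"] if_distrib[of "F a b"] cong: if_cong)

text \<open>A raising operator sends \<open>axis j v\<close> to a combination of vectors
  \<open>axis i v\<close> with i in \<open>pl j\<close>, and \<open>Q\<close> commutes with the
  action.\<close>

lemma W_raise:
  assumes ab: "pos a < pos b" and IH: "\<And>i. i \<in> set (pl j) \<Longrightarrow> Q (pl j) (axis i v) = 0"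
  shows "N.TF a b (W j) = 0"
proof -
  have F: "F a b v = 0" using sing_v ab by (simp add: sing_def)
  have z: "axis j 0 = (0 :: 'v ^ 10)" by (simp add: axis_def vec_eq_iff)
  have "N.TF a b (axis j v) =
      (if j = b then axis a v else 0) - (if j = a + 5 then axis (b + 5) v else 0)"
    unfolding TF_axis F z by simp
  also have "Q (pl j) \<dots> = 0"
  proof (cases "b = a + 5")
    case True
    then show ?thesis by (auto simp: add_5_eq_iff)
  next
    case False
    have "a \<in> set (pl j)" if "j = b"
      using that False ab by (auto simp: set_pl)
    moreover have "b + 5 \<in> set (pl j)" if "j = a + 5"
      using that False ab pos_add_5[of a] pos_add_5[of b] by (auto simp: set_pl add_5_eq_iff)
    ultimately show ?thesis using False IH by (auto simp: Q_diff)
  qed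
  finally show ?thesis unfolding W_def Q_TF[symmetric] .
qed

lemma W_wvec: "N.T.wvec (N.wt j) (W j)"
proof -
  have "N.T.wvec (N.wt j) (axis j v)"
    using N.wvec_axis[of lm v j] sing_v unfolding N.wt_def[abs_def] by (simp add: sing_def)
  then show ?thesis unfolding W_def N.T.wvec_def by (simp flip: Q_TF Q_tsc)
qed

text \<open>Induction along \<open>pos\<close>: once \<open>W i\<close> is 0 or singular,
  \<open>Theta\<close> acts on it by t i, and the part of \<open>pl j\<close> beyond
  \<open>pl i\<close> contains the factor that kills it.\<close>

lemma Q_pl: "i \<in> set (pl j) \<Longrightarrow> Q (pl j) (axis i v) = 0"
  and W_singular: "W j = 0 \<or> N.T.sing (N.wt j) (W j)"
proof -
  have 1: "W j = 0 \<or> N.T.sing (N.wt j) (W j)" if "\<And>i. i \<in> set (pl j) \<Longrightarrow> Q (pl j) (axis i v) = 0" for j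
    using W_raise[OF _ that] W_wvec[of j] by (auto simp: N.T.sing_def)
  have 2: "i \<in> set (pl j) \<Longrightarrow> Q (pl j) (axis i v) = 0" for i j
  proof (induction "pos j" arbitrary: i j rule: less_induct)
    case less
    have "pos i < pos j" using less.prems by (simp add: set_pl)
    then have "W i = 0 \<or> N.T.sing (N.wt i) (W i)" by (intro 1 less.hyps)
    then have e: "N.Theta (W i) = N.tsc (of_real (t i)) (W i)"
      using N.Theta_singular unfolding t_def by (auto simp: N.Theta_tsc[of 0, simplified])
    obtain r where r: "pl j = pl i @ r" "i \<in> set r" using pl_split[OF less.prems] by blast
    then show ?case using Q_eigenvector[OF e r(2)] by (simp add: Q_append W_def)
  qed
  show "i \<in> set (pl j) \<Longrightarrow> Q (pl j) (axis i v) = 0" by (rule 2)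
  show "W j = 0 \<or> N.T.sing (N.wt j) (W j)" by (rule 1, rule 2)
qed

text \<open>\<open>C ts j\<close> is the coefficient of \<open>\<zeta>\<^sub>j \<otimes> v\<close> in \<open>Q ts (\<zeta>\<^sub>j \<otimes> v)\<close>; all other
  coefficients can be ignored, because \<open>Q ts\<close> commutes with the action.\<close>

fun C :: "10 list \<Rightarrow> 10 \<Rightarrow> real" where
  "C [] j = 1"
| "C (b # ts) j = (lm j - t b) * C ts j + (\<Sum>r\<in>UNIV. of_bool (before r j) * (C ts r - C ts j))"

text \<open>For r before j, \<open>N.TF j r (axis r v)\<close> is \<open>axis j v\<close> plus the
  term \<open>axis r (F j r v)\<close> of \<open>Theta\<close>. So that term is expressed through a
  lowering operator of the tensor product, with which \<open>Q\<close> commutes.\<close>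

lemma Theta_axis:
  "N.Theta (axis j v) = N.tsc (of_real (lm j)) (axis j v)
    + (\<Sum>r\<in>UNIV. if before r j then N.TF j r (axis r v) - axis j v else 0)"
proof -
  have t: "(if before r j then N.TF j r (axis r v) - axis j v else 0) = (if r = j then 0 else axis r (F j r v))" for r
  proof -
    have [simp]: "axis r (0::'v) = 0" for r :: 10 by (simp add: axis_def vec_eq_iff)
    consider "r = j" | "r = j + 5" | "r \<noteq> j" "r \<noteq> j + 5" "pos j < pos r"
      | "r \<noteq> j" "r \<noteq> j + 5" "pos r < pos j"
      using pos_inj[of r j] by linarith
    then show ?thesis
      using sing_v by cases (auto simp: before_def TF_axis sing_def)
  qed
  have j: "N.tsc (of_real (lm j)) (axis j v) = axis j (F j j v)"
    using sing_v by (simp add: sing_def wvec_def vec_eq_iff axis_def)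
  show ?thesis unfolding t j
    by (auto simp: vec_eq_iff Theta_nth axis_def if_distrib[of "F _ _"] sum.remove[of UNIV j] cong: if_cong)
qed

text \<open>In the component j of \<open>N.TF j r w\<close> the part \<open>F j r (w $ j)\<close>
  lies in \<open>low\<close>, so that only \<open>w $ r\<close> survives. This yields the recursion
  of \<open>C\<close>.\<close>

lemma Q_coefficient: "Q ts (axis j v) $ j - sc (of_real (C ts j)) v \<in> low"
proof (induction ts arbitrary: j)
  case Nil
  show ?case by (simp add: wspan_def span_zero)
next
  case (Cons b ts)
  let ?q = "\<lambda>j. Q ts (axis j v)" and ?c = "\<lambda>j. of_real (C ts j) :: complex"
  have e: "N.TF j r w $ j = w $ r + F j r (w $ j)" if "before r j" for r w
  proof -
    have "sc (XU j r i j) (w $ i) = (if i = r then w $ r else 0)" for i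
      using that by (auto simp: XU_def before_def add_5_eq_iff)
    then show ?thesis by (simp add: N.TF_def)
  qed
  let ?S = "sc (of_real (lm j - t b)) (?q j $ j)
     + (\<Sum>r\<in>UNIV. if before r j then ?q r $ r + F j r (?q r $ j) - ?q j $ j else 0)"
  let ?R = "sc (of_real (lm j - t b)) (?q j $ j - sc (?c j) v)
     + (\<Sum>r\<in>UNIV. if before r j then (?q r $ r - sc (?c r) v) + F j r (?q r $ j)
           - (?q j $ j - sc (?c j) v) else 0)"
  have Q: "Q (b # ts) (axis j v) $ j = ?S"
    by (simp add: Theta_axis Q_add Q_diff Q_tsc Q_sum if_distrib[of "Q ts"] if_distrib[of "\<lambda>x. x $ j"] Q_TF
        e scale_left_diff_distrib cong: if_cong)
  have S: "?S - sc (of_real (C (b # ts) j)) v = ?R"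
  proof -
    have 0: "sc (of_real (C (b # ts) j)) v = sc (of_real (lm j - t b)) (sc (?c j) v)
        + sc (of_real (\<Sum>r\<in>UNIV. of_bool (before r j) * (C ts r - C ts j))) v"
      by (simp only: C.simps of_real_add of_real_mult scale_left_distrib scale_scale)
    have 1: "sc (of_real (\<Sum>r\<in>UNIV. of_bool (before r j) * (C ts r - C ts j))) v
        = (\<Sum>r\<in>UNIV. if before r j then sc (?c r) v - sc (?c j) v else 0)"
      unfolding of_real_sum scale_sum_left by (intro sum.cong) (auto simp: scale_left_diff_distrib)
    have 2: "(\<Sum>r\<in>UNIV. if before r j then (?q r $ r - sc (?c r) v) + F j r (?q r $ j)
           - (?q j $ j - sc (?c j) v) else 0)
        = (\<Sum>r\<in>UNIV. if before r j then ?q r $ r + F j r (?q r $ j) - ?q j $ j else 0)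
        - (\<Sum>r\<in>UNIV. if before r j then sc (?c r) v - sc (?c j) v else 0)"
      unfolding sum_subtractf[symmetric] by (intro sum.cong) auto
    show ?thesis unfolding 0 1 unfolding 2 scale_right_diff_distrib by (rule add_diff_add)
  qed
  have "?R \<in> low"
  proof -
    have 1: "?q r $ r - sc (?c r) v \<in> span {w. \<exists>m. ht m < ht lm \<and> wvec m w}" for r
      using Cons[of r] by (simp add: wspan_def)
    have 2: "before r j \<Longrightarrow> F j r x \<in> span {w. \<exists>m. ht m < ht lm \<and> wvec m w}" for r x
      using F_low[of r j x] by (simp add: wspan_def before_def)
    have 3: "(if before r j then (?q r $ r - sc (?c r) v) + F j r (?q r $ j) - (?q j $ j - sc (?c j) v) else 0)
        \<in> span {w. \<exists>m. ht m < ht lm \<and> wvec m w}" for r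
      using 1[of r] 1[of j] 2[of r "?q r $ j"] by (cases "before r j") (simp_all add: span_zero span_add span_diff)
    show ?thesis unfolding wspan_def by (intro span_add span_scale span_sum 1 3)
  qed
  then show ?case unfolding Q S .
qed

lemma C_eq_0:
  assumes "Q ts (axis j v) $ j = 0"
  shows "C ts j = 0"
proof (rule ccontr)
  assume nz: "C ts j \<noteq> 0"
  have "- sc (of_real (C ts j)) v \<in> low"
    using Q_coefficient[of ts j] assms by simp
  then have "sc (of_real (C ts j)) v \<in> low"
    unfolding wspan_def using span_neg by fastforce
  then have "sc (inverse (of_real (C ts j))) (sc (of_real (C ts j)) v) \<in> low"
    unfolding wspan_def by (rule span_scale)
  then show False using nz v_notin_low by simp
qed

text \<open>A left eigenvector of the triangular matrix of the recursion for \<open>C\<close> turns the coefficient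
  into a product.\<close>

lemma C_left_eigenvector:
  assumes "\<And>r. L r * (t r - t j) + (\<Sum>b\<in>UNIV. of_bool (before r b) * L b) = 0"
  shows "(\<Sum>b\<in>UNIV. L b * C ts b) = (\<Prod>s\<leftarrow>ts. t j - t s) * (\<Sum>b\<in>UNIV. L b)"
proof (induction ts)
  case (Cons s ts)
  have "C (s # ts) b = (t b - t s) * C ts b + (\<Sum>r\<in>UNIV. of_bool (before r b) * C ts r)" for b
    by (simp add: t_eq[of b] right_diff_distrib sum_subtractf sum_distrib_left sum_distrib_right algebra_simps del: sum_of_bool_mult_eq sum_mult_of_bool_eq sum_of_bool_eq)
  then have "(\<Sum>b\<in>UNIV. L b * C (s # ts) b)
      = (\<Sum>b\<in>UNIV. L b * (t b - t s) * C ts b) + (\<Sum>b\<in>UNIV. \<Sum>r\<in>UNIV. of_bool (before r b) * L b * C ts r)"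
    by (simp add: distrib_left sum.distrib sum_distrib_left mult_ac
        del: sum_of_bool_mult_eq sum_mult_of_bool_eq sum_of_bool_eq)
  also have "(\<Sum>b\<in>UNIV. \<Sum>r\<in>UNIV. of_bool (before r b) * L b * C ts r)
      = (\<Sum>r\<in>UNIV. (\<Sum>b\<in>UNIV. of_bool (before r b) * L b) * C ts r)"
    by (subst sum.swap) (simp add: sum_distrib_right del: sum_of_bool_mult_eq sum_mult_of_bool_eq sum_of_bool_eq)
  also have "\<dots> = (\<Sum>r\<in>UNIV. (L r * (t j - t r)) * C ts r)"
  proof (rule sum.cong)
    fix r
    have "(\<Sum>b\<in>UNIV. of_bool (before r b) * L b) = L r * (t j - t r)"
      using assms[of r] by (simp add: algebra_simps)
    then show "(\<Sum>b\<in>UNIV. of_bool (before r b) * L b) * C ts r = L r * (t j - t r) * C ts r" by simp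
  qed simp
  also have "(\<Sum>b\<in>UNIV. L b * (t b - t s) * C ts b) + \<dots> = (t j - t s) * (\<Sum>b\<in>UNIV. L b * C ts b)"
    unfolding sum.distrib[symmetric] sum_distrib_left by (intro sum.cong) (auto simp: algebra_simps)
  finally show ?case unfolding Cons by simp
qed simp

text \<open>If \<open>W j\<close> were 0, the coefficient at j would vanish, as do those at the
  indices of \<open>pl j\<close> by \<open>Q_pl\<close>. Since \<open>L\<close> is supported on
  these indices, the product in \<open>C_left_eigenvector\<close> would be 0.\<close>

lemma W_nonzero:
  assumes L: "\<And>r. L r * (t r - t j) + (\<Sum>b\<in>UNIV. of_bool (before r b) * L b) = 0"
    and "L j = 1" "\<And>r. r \<notin> set (pl j) \<Longrightarrow> r \<noteq> j \<Longrightarrow> L r = 0" "(\<Sum>b\<in>UNIV. L b) \<noteq> 0"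
    and D: "\<And>r. r \<in> set (pl j) \<Longrightarrow> t j \<noteq> t r"
  shows "W j \<noteq> 0"
proof
  assume "W j = 0"
  then have "C (pl j) j = 0" by (intro C_eq_0) (simp add: W_def)
  moreover have "C (pl j) r = 0" if "r \<in> set (pl j)" for r
    using Q_pl[OF that] by (intro C_eq_0) simp
  ultimately have "(\<Sum>b\<in>UNIV. L b * C (pl j) b) = 0"
    using assms(3) by (intro sum.neutral) fastforce
  then have "(\<Prod>s\<leftarrow>pl j. t j - t s) = 0"
    using C_left_eigenvector[OF L, of "pl j"] assms(4) by simp
  then show False using D by (auto simp: prod_list_zero_iff)
qed

lemma t_dual: "t b + t (b + 5) = - 8"
  using exhaust_10[of b] lm_odd[of b]
  by (elim disjE) (simp_all add: t_eq sum_10 before_def)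

text \<open>The vector \<open>lev\<close>, transported to the ten indices by \<open>rpos\<close>, is
  the required left eigenvector. The relation of dual gaps comes from \<open>t_dual\<close>.\<close>

lemma W_nonzero_if_gap:
  assumes gap: "\<And>r. r \<in> set (pl j) \<Longrightarrow> r \<noteq> j + 5 \<Longrightarrow> t j - t r \<le> - 2"
  shows "W j \<noteq> 0"
proof -
  define rpos where "rpos b = 11 - pos b" for b
  \<comment> \<open>The inverse of \<open>rpos\<close> on 1, ..., 10; the entry at position 0 is a
    dummy.\<close>
  define index :: "nat \<Rightarrow> 10" where "index q = [10, 6, 7, 8, 9, 10, 5, 4, 3, 2, 1] ! q" for q :: nat
  define d where "d q = t j - t (index q)" for q
  let ?m = "rpos j"
  define L where "L = lev ?m d"
  have rp: "1 \<le> rpos b" "rpos b \<le> 10" "rpos (b + 5) = 11 - rpos b" "d (rpos b) = t j - t b" for b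
    using exhaust_10[of b] by (elim disjE; simp add: rpos_def d_def index_def nth_Cons')+
  have rpos_index: "rpos (index q) = q" if "1 \<le> q" "q \<le> 10" for q
  proof -
    have "q = 1 \<or> q = 2 \<or> q = 3 \<or> q = 4 \<or> q = 5 \<or> q = 6 \<or> q = 7 \<or> q = 8 \<or> q = 9 \<or> q = 10"
      using that by presburger
    then show ?thesis by (elim disjE) (simp_all add: rpos_def index_def nth_Cons')
  qed
  have dual: "d q + d (11 - q) = d (11 - ?m)" if "1 \<le> q" "q \<le> 10" for q
    using rp(4)[of "index q"] rp(4)[of "index q + 5"] rp(4)[of "j + 5"] t_dual[of "index q"] t_dual[of j] that
    unfolding rp(3) by (simp add: rpos_index)
  have set: "r \<in> set (pl j) \<longleftrightarrow> ?m < rpos r \<and> \<not> (j = 10 \<and> r = 5)" for r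
    using pos_add_5(2)[of r] pos_add_5(2)[of j] by (auto simp: set_pl rpos_def)
  have D: "d q \<le> - 2" if "?m < q" "q \<le> 10" "q + ?m \<noteq> 11" for q
  proof -
    have "index q \<noteq> j + 5" using that rp(3)[of j] rpos_index[of q] rp(1,2)[of j] by auto
    moreover have "\<not> (j = 10 \<and> index q = 5)"
      using calculation by auto
    ultimately show ?thesis
      using that gap[of "index q"] set[of "index q"] rpos_index[of q] by (simp add: d_def)
  qed
  have neq: "t j \<noteq> t r" if "r \<in> set (pl j)" for r
  proof (cases "r = j + 5")
    case True
    \<comment> \<open>The gap at j + 5 is not assumed. It equals d 5 + d 6, and both of these are
      bounded when j + 5 lies in \<open>pl j\<close>.\<close>
    have "?m \<le> 4" using that exhaust_10[of j] unfolding True by (elim disjE) (simp_all add: set_pl rpos_def)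
    then have "d (11 - ?m) < 0" using D[of 5] D[of 6] dual[of 5] by simp
    then show ?thesis using rp(4)[of "j + 5"] rp(3)[of j] True by simp
  qed (use gap[OF that] in auto)
  have L_0: "L q = 0" if "q < ?m" for q using that by (simp add: L_def lev.simps)
  have "L (rpos r) * (t r - t j) + (\<Sum>b\<in>UNIV. of_bool (before r b) * L (rpos b)) = 0" for r
  proof -
    let ?q = "rpos r"
    let ?s = "(\<Sum>i = 1..?q - 1. L i) - (if 5 < ?q then L (11 - ?q) else 0)"
    have e: "(\<Sum>b\<in>UNIV. of_bool (before r b) * L (rpos b)) = ?s"
      using exhaust_10[of r]
      by (elim disjE) (simp_all add: sum_10 before_def rpos_def eval_nat_numeral)
    show ?thesis
    proof (cases "?m < ?q")
      case True
      have L: "L ?q = ?s / (t j - t r)"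
        using True unfolding L_def rp(4)[symmetric] by (subst lev.simps) simp
      show ?thesis
      proof (cases "t j = t r")
        case True
        \<comment> \<open>The denominator can vanish only for j = 10 and r = 5, and there the
          numerator vanishes too.\<close>
        then have "j = 10" "r = 5" using \<open>?m < ?q\<close> neq[of r] set[of r] by auto
        then have "?s = 0" using L_0 by (simp add: rpos_def eval_nat_numeral)
        then show ?thesis unfolding e using True by simp
      next
        case False
        then have "x / (t j - t r) * (t r - t j) + x = 0" for x by (simp add: field_simps)
        then show ?thesis unfolding e L .
      qed
    next
      case False
      then have "?s = 0" using L_0 by (auto intro!: sum.neutral)
      moreover have "L ?q = 0 \<or> t r = t j"
      proof (cases "?q = ?m")
        case True
        then show ?thesis using rp(4)[of r] rp(4)[of j] by simp
      qed (use False L_0 in auto)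
      ultimately show ?thesis unfolding e by auto
    qed
  qed
  moreover have "(\<Sum>b\<in>UNIV. L (rpos b)) \<noteq> 0"
  proof -
    have "(\<Sum>b\<in>UNIV. L (rpos b)) = (\<Sum>i = 1..10. L i)"
      by (simp add: sum_10 rpos_def eval_nat_numeral)
    then show ?thesis using sum_lev_nonzero[OF rp(1,2) dual D] by (simp add: L_def)
  qed
  moreover have "L (rpos r) = 0" if "r \<notin> set (pl j)" "r \<noteq> j" for r
  proof (cases "j = 10 \<and> r = 5")
    case True
    then have m: "?m = 5" "rpos r = 6" by (simp_all add: rpos_def)
    have "(\<Sum>i = 1..5. L i) = L 5" using L_0 m by (simp add: eval_nat_numeral)
    then show ?thesis unfolding m(2) by (subst L_def, subst lev.simps) (simp add: m L_def)
  next
    case False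
    then show ?thesis using that set[of r] pos_inj[of r j] pos_add_5(2)[of r] pos_add_5(2)[of j]
      by (intro L_0) (auto simp: rpos_def)
  qed
  moreover have "L (rpos j) = 1" by (simp add: L_def lev.simps)
  ultimately show ?thesis using neq by (intro W_nonzero[of "\<lambda>b. L (rpos b)" j]) auto
qed

text \<open>Dominance gives \<open>lm j - lm r\<close> at most -1, and the number subtracted in
  \<open>t_eq\<close> grows by at least 1 from r to j. Together this is the gap of -2.\<close>

lemma W_singular_if_dominant:
  assumes dom: "\<And>a b. pos a < pos b \<Longrightarrow> b \<noteq> a + 5 \<Longrightarrow> N.wt j a - N.wt j b \<in> \<nat>"
  shows "N.T.sing (N.wt j) (W j)"
proof -
  have n: "(\<Sum>r\<in>UNIV. of_bool (before r j)) = real (if pos j \<le> 5 then pos j - 1 else pos j - 2)" for j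
    using exhaust_10[of j] by (elim disjE) (simp_all add: sum_10 before_def)
  have "t j - t r \<le> - 2" if r: "r \<in> set (pl j)" "r \<noteq> j + 5" for r
  proof -
    have p: "pos r < pos j" "r \<noteq> j" "j \<noteq> r + 5" using r by (auto simp: set_pl)
    then have "N.wt j r - N.wt j j \<in> \<nat>" by (intro dom)
    then have "lm j - lm r \<le> - 1"
      using p r(2) by (auto simp: N.wt_def wU_def Nats_altdef2)
    \<comment> \<open>Only between the dual indices 5 and 10 would the number in \<open>t_eq\<close>
      stay the same.\<close>
    moreover have "\<not> (pos r = 5 \<and> pos j = 6)"
      using p(3) pos_inj[of r 5] pos_inj[of j 10] by auto
    then have "real (if pos j \<le> 5 then pos j - 1 else pos j - 2)
        \<ge> real (if pos r \<le> 5 then pos r - 1 else pos r - 2) + 1"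
      using p(1) by (auto simp: pos_def split: if_splits)
    ultimately show ?thesis unfolding t_eq n by linarith
  qed
  then have "W j \<noteq> 0" by (rule W_nonzero_if_gap)
  then show ?thesis using W_singular[of j] by simp
qed

end

section \<open>The spinor module\<close>

text \<open>Row \<open>n\<close> of the table encodes the Hessian matrix of \<open>\<zeta>\<^sub>n\<close>: its \<open>i\<close>-th entry is \<open>j\<close> or \<open>-j\<close> if
  the Hessian has the entry \<open>1\<close> or \<open>-1\<close> at \<open>(i, j)\<close>, and 0 if the \<open>i\<close>-th row of the Hessian vanishes.
  In \<open>ct n k\<close>, the index \<open>k\<close> may also carry a sign.\<close>

definition ctab :: "int list list" where
  "ctab =
  [[11, 9, -6, 5, 4, -3, 0, 0, 2, 0, 1, 0, 0, 0, 0, 0],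
   [13, 10, -8, 0, 7, 0, 5, -3, 0, 2, 0, 0, 1, 0, 0, 0],
   [14, 12, 0, -8, 0, 7, 6, -4, 0, 0, 0, 2, 0, 1, 0, 0],
   [15, 0, -12, 10, 0, 0, -9, 0, -7, 4, 0, -3, 0, 0, 1, 0],
   [0, -15, -14, 13, 0, 0, -11, 0, 0, 0, -7, 0, 4, -3, -2, 0],
   [0, 0, 0, 0, 0, 0, 16, 15, 0, 14, 0, -13, -12, 10, 8, 7],
   [0, 0, 0, -16, 0, -15, 0, 0, -14, 0, 12, 11, 0, -9, -6, -4],
   [0, 0, 16, 0, 15, 0, 0, 0, 13, -11, -10, 0, 9, 0, 5, 3],
   [0, 16, 0, 0, -14, 13, 0, -11, 0, 0, -8, 0, 6, -5, 0, 2],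
   [16, 0, 0, 0, 12, -10, 0, 9, 8, -6, 0, 5, 0, 0, 0, 1]]"

definition ct :: "nat \<Rightarrow> int \<Rightarrow> int" where
  "ct n i = (if i = 0 then 0 else if i > 0 then ctab ! (n - 1) ! nat (i - 1)
     else - (ctab ! (n - 1) ! nat (- i - 1)))"

lemma ct_minus: "ct n (- i) = - ct n i"
  by (simp add: ct_def)

lemma ct_0: "ct n 0 = 0"
  by (simp add: ct_def)

text \<open>The relation \<open>Clifford\<close> on basis vectors. The Hessians are signed partial
  permutation matrices, so their products are compositions of \<open>ct\<close>.\<close>

lemma ct_clifford_check:
  "list_all (\<lambda>a. list_all (\<lambda>b. list_all (\<lambda>i.
     let p = ct b (ct (prime10 a) i); q = ct a (ct (prime10 b) i) in
     if a = prime10 b then p = i \<and> q = 0 \<or> p = 0 \<and> q = i else p = - q) [1..16]) [1..<11]) [1..<11]"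
  by code_simp

lemma ct_symmetric_check:
  "list_all (\<lambda>a. list_all (\<lambda>i. \<bar>ct a i\<bar> \<le> 16 \<and> (ct a (ct a i) = i \<or> ct a i = 0)) [1..16]) [1..<11]"
  by code_simp

lemma ct_trace_check:
  "list_all (\<lambda>a. list_all (\<lambda>b. sum_list (map (\<lambda>i. let p = ct a i; q = ct b i in
     if p = 0 then 0 else if p = q then 1 else if p = - q then - 1 else 0) [1..16]) =
     (if a = b then 8 else (0::int))) [1..<11]) [1..<11]"
  by code_simp

lemma bij_of_nat_10: "bij_betw of_nat {1..10} (UNIV :: 10 set)"
  and bij_of_nat_16: "bij_betw of_nat {1..16} (UNIV :: 16 set)"
  using index_types by (auto simp: bij_betw_def intro!: eq_card_imp_inj_on)

definition idx10 :: "10 \<Rightarrow> nat" where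
  "idx10 = inv_into {1..10} of_nat"

definition idx16 :: "16 \<Rightarrow> nat" where
  "idx16 = inv_into {1..16} of_nat"

lemma idx10: "idx10 a \<in> {1..10}" "of_nat (idx10 a) = a"
  using bij_betw_inv_into_right[OF bij_of_nat_10, of a] bij_betwE[OF bij_betw_inv_into[OF bij_of_nat_10]]
  by (auto simp: idx10_def)

lemma idx16: "idx16 i \<in> {1..16}" "of_nat (idx16 i) = i"
  using bij_betw_inv_into_right[OF bij_of_nat_16, of i] bij_betwE[OF bij_betw_inv_into[OF bij_of_nat_16]]
  by (auto simp: idx16_def)

lemma idx10_of_nat: "n \<in> {1..10} \<Longrightarrow> idx10 (of_nat n) = n"
  unfolding idx10_def using bij_of_nat_10 by (simp add: bij_betw_def)

lemma idx16_of_nat: "n \<in> {1..16} \<Longrightarrow> idx16 (of_nat n) = n"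
  unfolding idx16_def using bij_of_nat_16 by (simp add: bij_betw_def)

lemma idx10_inj: "idx10 a = idx10 b \<longleftrightarrow> a = b"
  by (metis idx10(2))

lemma idx16_inj: "idx16 i = idx16 j \<longleftrightarrow> i = j"
  by (metis idx16(2))

lemma prime10_range: "n \<in> {1..10} \<Longrightarrow> prime10 n \<in> {1..10}"
  by (auto simp: prime10_def)

lemma of_nat_prime10:
  assumes "n \<in> {1..10}"
  shows "of_nat (prime10 n) = (of_nat n + 5 :: 10)"
proof (cases "n \<le> 5")
  case False
  then have "of_nat n = (of_nat (n - 5) + 5 :: 10)" by (simp add: of_nat_diff)
  then show ?thesis using False by (simp add: prime10_def)
qed (simp add: prime10_def)

lemma idx10_add_5: "idx10 (a + 5) = prime10 (idx10 a)"
  by (metis idx10 idx10_of_nat of_nat_prime10 prime10_range)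

lemma sum_idx10: "(\<Sum>n\<in>{1..10}. g n) = (\<Sum>a\<in>UNIV. g (idx10 a))"
  by (rule sum.reindex_bij_witness[of _ idx10 of_nat]) (auto simp: idx10 idx10_of_nat simp del: atLeastAtMost_iff One_nat_def)

lemma sum_idx16: "(\<Sum>n\<in>{1..16}. g n) = (\<Sum>a\<in>UNIV. g (idx16 a))"
  by (rule sum.reindex_bij_witness[of _ idx16 of_nat]) (auto simp: idx16 idx16_of_nat simp del: atLeastAtMost_iff One_nat_def)

definition sv :: "int \<Rightarrow> 16 \<Rightarrow> complex" where
  "sv k j = (if k = int (idx16 j) then 1 else if k = - int (idx16 j) then -1 else 0)"

text \<open>The Hessian matrix of the quadric \<open>zt a\<close>, by \<open>dx_zt\<close> and
  \<open>dx_grad\<close>.\<close>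

definition Cm :: "10 \<Rightarrow> complex ^ 16 ^ 16" where
  "Cm a = (\<chi> i j. sv (ct (idx10 a) (int (idx16 i))) j)"

lemma sv_0: "sv 0 j = 0" and sv_minus: "sv (- k) j = - sv k j" and sv_idx: "sv (int (idx16 i)) j = of_bool (i = j)"
  using idx16(1)[of j] idx16(1)[of i] by (auto simp: sv_def idx16_inj)

lemma index_cases:
  assumes "\<bar>k\<bar> \<le> 16"
  obtains "k = 0" | m where "k = int (idx16 m)" | m where "k = - int (idx16 m)"
proof -
  consider "k = 0" | "nat \<bar>k\<bar> \<in> {1..16}" using assms by force
  then show ?thesis
  proof cases
    case 2
    then have "\<bar>k\<bar> = int (idx16 (of_nat (nat \<bar>k\<bar>)))" using idx16_of_nat[OF 2] by simp
    then show ?thesis using that(2,3) by (metis abs_if minus_minus)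
  qed (use that in blast)
qed

lemma sv_Cm:
  assumes "\<bar>k\<bar> \<le> 16"
  shows "(\<Sum>m\<in>UNIV. sv k m * Cm b $ m $ j) = sv (ct (idx10 b) k) j"
  using assms
  by (cases k rule: index_cases) (simp_all add: sv_0 ct_0 sv_minus ct_minus sv_idx Cm_def sum_negf
    if_distrib[of "\<lambda>x. x * _"] of_bool_def cong: if_cong)

lemma idx10_mem: "idx10 a \<in> set [1..<11]" and idx16_mem: "int (idx16 i) \<in> set [1..16]"
  using idx10(1)[of a] idx16(1)[of i] by auto

lemma ct_bound: "\<bar>ct (idx10 a) (int (idx16 i))\<bar> \<le> 16"
  and ct_ct: "ct (idx10 a) (ct (idx10 a) (int (idx16 i))) = int (idx16 i) \<or> ct (idx10 a) (int (idx16 i)) = 0"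
  using ct_symmetric_check idx10_mem[of a] idx16_mem[of i] unfolding list_all_iff by blast+

lemma Cm_mult: "(Cm a ** Cm b) $ i $ j = sv (ct (idx10 b) (ct (idx10 a) (int (idx16 i)))) j"
  unfolding matrix_matrix_mult_def using sv_Cm[OF ct_bound] by (simp add: Cm_def)

lemma Cm_symmetric: "Cm a $ i $ j = Cm a $ j $ i"
proof -
  have *: "Cm a $ j $ i = x" if "Cm a $ i $ j = x" "x \<noteq> 0" for i j x
  proof -
    have "ct (idx10 a) (int (idx16 i)) = int (idx16 j) \<and> x = 1
        \<or> ct (idx10 a) (int (idx16 i)) = - int (idx16 j) \<and> x = -1"
      using that by (auto simp: Cm_def sv_def split: if_splits)
    then consider "ct (idx10 a) (int (idx16 i)) = int (idx16 j)" "x = 1"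
      | "ct (idx10 a) (int (idx16 i)) = - int (idx16 j)" "x = -1" by blast
    then show ?thesis
    proof cases
      case 1
      then have "ct (idx10 a) (int (idx16 j)) = int (idx16 i)" using ct_ct[of a i] idx16(1)[of j] by auto
      then show ?thesis using 1 by (simp add: Cm_def sv_def)
    next
      case 2
      then have "ct (idx10 a) (int (idx16 j)) = - int (idx16 i)"
        using ct_ct[of a i] idx16(1)[of j] by (auto simp: ct_minus)
      then show ?thesis using 2 idx16(1)[of i] by (auto simp: Cm_def sv_def)
    qed
  qed
  show ?thesis using *[of i j] *[of j i] by metis
qed

section \<open>Clifford relations and the half-spin representation\<close>

definition dm :: "bool \<Rightarrow> complex ^ 16 ^ 16" where
  "dm p = (if p then mat 1 else 0)"

text \<open>If the gamma matrix of a has the off-diagonal blocks \<open>Cm a\<close> and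
  \<open>Cm (a + 5)\<close>, this is a diagonal block of the anticommutator of the gamma matrices of
  a and b + 5.\<close>

lemma Clifford: "Cm a ** Cm b + Cm (b + 5) ** Cm (a + 5) = dm (a = b)"
proof -
  have "(Cm a ** Cm b + Cm (b + 5) ** Cm (a + 5)) $ i $ j = dm (a = b) $ i $ j" for i j
  proof -
    let ?k = "int (idx16 i)"
    let ?p = "ct (idx10 b) (ct (idx10 a) ?k)" and ?q = "ct (idx10 (a + 5)) (ct (idx10 (b + 5)) ?k)"
    have pp: "prime10 (idx10 (a + 5)) = idx10 a" for a by (metis idx10_add_5 add_5_5)
    have "if idx10 (a + 5) = prime10 (idx10 b) then ?p = ?k \<and> ?q = 0 \<or> ?p = 0 \<and> ?q = ?k else ?p = - ?q"
      using ct_clifford_check idx10_mem[of "a + 5"] idx10_mem[of b] idx16_mem[of i]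
      unfolding list_all_iff Let_def by (metis idx10_add_5 pp)
    moreover have "idx10 (a + 5) = prime10 (idx10 b) \<longleftrightarrow> a = b"
      by (metis idx10_add_5 idx10_inj add_5_eq_iff add_5_5)
    ultimately show ?thesis
      by (auto simp: Cm_mult sv_0 sv_minus sv_idx dm_def mat_def of_bool_def split: if_splits)
  qed
  then show ?thesis by (simp add: vec_eq_iff)
qed

lemma Cm_trace: "(\<Sum>i\<in>UNIV. \<Sum>j\<in>UNIV. Cm a $ i $ j * Cm b $ i $ j) = 8 * of_bool (a = b)"
proof -
  let ?f = "\<lambda>a b i. let p = ct a i; q = ct b i in
     if p = 0 then 0 else if p = q then 1 else if p = - q then - 1 else (0::int)"
  have "(\<Sum>j\<in>UNIV. Cm a $ i $ j * Cm b $ i $ j) = of_int (?f (idx10 a) (idx10 b) (int (idx16 i)))" for i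
  proof -
    let ?p = "ct (idx10 a) (int (idx16 i))" and ?q = "ct (idx10 b) (int (idx16 i))"
    have "(\<Sum>j\<in>UNIV. sv ?p j * sv ?q j) = (if ?p = 0 then 0 else if ?p = ?q then 1 else if ?p = - ?q then - 1 else 0)"
      using ct_bound[of a i]
    proof (cases ?p rule: index_cases)
      case (2 m)
      then have "(\<Sum>j\<in>UNIV. sv ?p j * sv ?q j) = sv ?q m" by (simp add: sv_idx)
      then show ?thesis using 2 idx16(1)[of m] by (auto simp: sv_def)
    next
      case (3 m)
      then have "(\<Sum>j\<in>UNIV. sv ?p j * sv ?q j) = - sv ?q m" by (simp add: sv_idx sv_minus sum_negf)
      then show ?thesis using 3 idx16(1)[of m] by (auto simp: sv_def)
    qed (simp add: sv_0)
    then show ?thesis by (simp add: Cm_def Let_def)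
  qed
  then have "(\<Sum>i\<in>UNIV. \<Sum>j\<in>UNIV. Cm a $ i $ j * Cm b $ i $ j)
      = (\<Sum>i\<in>UNIV. of_int (?f (idx10 a) (idx10 b) (int (idx16 i))))" by simp
  also have "\<dots> = (\<Sum>n\<in>{1..16}. of_int (?f (idx10 a) (idx10 b) (int n)))"
    by (rule sum_idx16[symmetric])
  also have "\<dots> = (\<Sum>k\<in>{1..16::int}. of_int (?f (idx10 a) (idx10 b) k))"
    by (rule sum.reindex_bij_witness[of _ nat int]) auto
  also have "\<dots> = of_int (sum_list (map (?f (idx10 a) (idx10 b)) [1..16]))"
    by (simp add: sum_list_distinct_conv_sum_set flip: of_int_sum del: set_upto) (simp only: set_upto)
  also have "sum_list (map (?f (idx10 a) (idx10 b)) [1..16]) = (if idx10 a = idx10 b then 8 else 0)"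
    using ct_trace_check idx10_mem[of a] idx10_mem[of b] unfolding list_all_iff by blast
  finally show ?thesis by (simp add: idx10_inj)
qed

text \<open>The half-spin representation as a product of two gamma blocks; subtracting 1/2 for a = b
  makes it skew, see \<open>XS_skew\<close>.\<close>

definition XS :: "10 \<Rightarrow> 10 \<Rightarrow> 16 \<Rightarrow> 16 \<Rightarrow> complex" where
  "XS a b i j = (Cm b ** Cm a) $ i $ j - (if a = b \<and> i = j then 1 / 2 else 0)"

definition wS :: "16 \<Rightarrow> 10 \<Rightarrow> real" where
  "wS i a = (if ct (idx10 a) (int (idx16 i)) = 0 then - (1 / 2) else 1 / 2)"

text \<open>By \<open>ct_ct\<close>, \<open>Cm a ** Cm a\<close> is the projection onto the basis
  vectors that \<open>Cm a\<close> does not kill.\<close>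

lemma XS_diag: "XS a a i j = (if i = j then of_real (wS i a) else 0)"
  using ct_ct[of a i] idx16(1)[of i] by (auto simp: XS_def Cm_mult wS_def sv_idx sv_0 ct_0)

definition XM :: "10 \<Rightarrow> 10 \<Rightarrow> complex ^ 16 ^ 16" where
  "XM a b = Cm b ** Cm a - (1/2) *\<^sub>R dm (a = b)"

lemma XM_nth: "XM a b $ i $ j = XS a b i j"
  by (simp add: XM_def XS_def dm_def mat_def scaleR_conv_of_real[where 'a = complex])

lemma dm_mult [simp]: "dm p ** M = (if p then M else 0)" "M ** dm p = (if p then M else 0)"
  by (simp_all add: dm_def)

lemma matrix_diff_ldistrib: "A ** (B - C) = A ** B - A ** (C :: complex ^ 'n ^ 'm)"
  by (simp add: vec_eq_iff matrix_matrix_mult_def sum_subtractf algebra_simps)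

lemma matrix_diff_rdistrib: "(B - C) ** A = B ** A - C ** (A :: complex ^ 'n ^ 'm)"
  by (simp add: vec_eq_iff matrix_matrix_mult_def sum_subtractf algebra_simps)

lemma XM_skew: "XM (b + 5) (a + 5) = - XM a b"
proof -
  have "Cm (a + 5) ** Cm (b + 5) = (1/2) *\<^sub>R dm (a = b) + (1/2) *\<^sub>R dm (a = b) - Cm b ** Cm a"
    using Clifford[of b a] unfolding eq_commute[of b a]
    by (simp add: algebra_simps flip: scaleR_left_distrib)
  moreover have "(b + 5 = a + 5) = (a = b)" by auto
  ultimately show ?thesis unfolding XM_def by (simp only:) simp
qed

lemma matrix_add_rdistrib: "(B + C) ** A = B ** A + C ** (A :: complex ^ 'n ^ 'm)"
  by (simp add: vec_eq_iff matrix_matrix_mult_def sum.distrib algebra_simps)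

lemma Clifford_swap: "Cm a ** Cm b = dm (a = b) - Cm (b + 5) ** Cm (a + 5)"
  using Clifford[of a b] by (simp add: algebra_simps)

text \<open>Four exchanges by \<open>Clifford_swap\<close> move one pair of factors past the other;
  each leaves behind one of the four terms.\<close>

lemma Cm4: "Cm d ** Cm c ** (Cm b ** Cm a) - Cm b ** Cm a ** (Cm d ** Cm c) =
    (if b = c then Cm d ** Cm a else 0) - (if b = d + 5 then Cm (c + 5) ** Cm a else 0)
    + (if a + 5 = c then Cm b ** Cm (d + 5) else 0) - (if a = d then Cm b ** Cm c else 0)"
proof -
  have e1: "(c + 5 = a) = (a + 5 = c)" by (metis add_5_5)
  let ?Y = "Cm (c + 5) ** Cm a"
  have "Cm d ** Cm c ** (Cm b ** Cm a) = Cm d ** (Cm c ** Cm b) ** Cm a"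
    by (simp add: matrix_mul_assoc)
  also have "\<dots> = (if b = c then Cm d ** Cm a else 0) - (Cm d ** Cm (b + 5)) ** ?Y"
    unfolding Clifford_swap[of c b] by (simp add: matrix_diff_ldistrib matrix_diff_rdistrib matrix_mul_assoc)
  finally have 1: "Cm d ** Cm c ** (Cm b ** Cm a) = (if b = c then Cm d ** Cm a else 0) - (Cm d ** Cm (b + 5)) ** ?Y" .
  have 2: "(Cm d ** Cm (b + 5)) ** ?Y = (if b = d + 5 then ?Y else 0) - Cm b ** (Cm (d + 5) ** ?Y)"
    unfolding Clifford_swap[of d "b + 5"] by (auto simp: matrix_diff_rdistrib matrix_mul_assoc)
  have 3: "Cm b ** (Cm (d + 5) ** ?Y) =
      (if a + 5 = c then Cm b ** Cm (d + 5) else 0) - Cm b ** ((Cm (d + 5) ** Cm (a + 5)) ** Cm c)"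
    unfolding Clifford_swap[of "c + 5" a] e1 by (auto simp: matrix_diff_ldistrib matrix_mul_assoc)
  have 4: "Cm b ** ((Cm (d + 5) ** Cm (a + 5)) ** Cm c)
      = (if a = d then Cm b ** Cm c else 0) - Cm b ** Cm a ** (Cm d ** Cm c)"
    unfolding Clifford_swap[of "d + 5" "a + 5"]
    by (auto simp: matrix_diff_ldistrib matrix_diff_rdistrib matrix_mul_assoc)
  show ?thesis unfolding 1 2 3 4 by simp
qed

lemma XM_mult: "XM c d ** XM a b - XM a b ** XM c d
    = Cm d ** Cm c ** (Cm b ** Cm a) - Cm b ** Cm a ** (Cm d ** Cm c)"
proof -
  have s: "(r *\<^sub>R A) ** B = r *\<^sub>R (A ** B)" "A ** (r *\<^sub>R B) = r *\<^sub>R (A ** B)"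
    for r and A B :: "complex ^ 16 ^ 16"
    by (simp_all add: vec_eq_iff matrix_matrix_mult_def scaleR_sum_right)
  show ?thesis unfolding XM_def matrix_diff_ldistrib matrix_diff_rdistrib s dm_mult
    by (auto simp: dm_def algebra_simps)
qed

lemma XM_comm: "XM c d ** XM a b - XM a b ** XM c d =
      (if b = c then XM a d else 0) - (if a = d then XM c b else 0)
      - (if b = d + 5 then XM a (c + 5) else 0) - (if a + 5 = c then XM (b + 5) d else 0)"
proof -
  have e: "(b + 5 = d) = (b = d + 5)" "(d = b + 5) = (b = d + 5)" by (metis add_5_5)+
  have "XM (b + 5) d = (1/2) *\<^sub>R dm (b = d + 5) - Cm b ** Cm (d + 5)"
    unfolding XM_def Clifford_swap[of d "b + 5"] e
    by (auto simp: vec_eq_iff dm_def mat_def scaleR_conv_of_real[where 'a = complex])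
  then show ?thesis unfolding XM_mult Cm4
    by (auto simp: XM_def dm_def)
qed

lemma XS_skew: "XS (b + 5) (a + 5) i j = - XS a b i j"
  using XM_skew[of b a] by (simp flip: XM_nth)

lemma XS_comm: "(\<Sum>k\<in>UNIV. XS c d i k * XS a b k j) - (\<Sum>k\<in>UNIV. XS a b i k * XS c d k j) =
      (if b = c then XS a d i j else 0) - (if a = d then XS c b i j else 0)
      - (if b = d + 5 then XS a (c + 5) i j else 0) - (if a + 5 = c then XS (b + 5) d i j else 0)"
  using arg_cong[OF XM_comm[of c d a b], of "\<lambda>M. M $ i $ j"]
  by (simp add: matrix_matrix_mult_def XM_nth if_distrib[of "\<lambda>M. M $ _"] cong: if_cong)

lemma sum_Cm_square: "(\<Sum>b\<in>UNIV. Cm b ** Cm b) = 5 *\<^sub>R mat 1"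
proof -
  have "(\<Sum>b\<in>UNIV. Cm b ** Cm b + Cm (b + 5) ** Cm (b + 5)) = (\<Sum>b\<in>(UNIV::10 set). mat 1)"
    unfolding Clifford by (simp add: dm_def)
  then have "(\<Sum>b\<in>UNIV. Cm b ** Cm b) + (\<Sum>b\<in>UNIV. Cm b ** Cm b) = (\<Sum>b\<in>(UNIV::10 set). mat 1)"
    unfolding sum.distrib sum_add_5[of "\<lambda>b. Cm b ** Cm b"] .
  then have "(\<Sum>b\<in>UNIV. Cm b ** Cm b) $ i $ j = (5 *\<^sub>R mat 1) $ i $ j" for i j
    by (auto dest!: arg_cong[of _ _ "\<lambda>M. M $ i $ j"] simp: mat_def scaleR_conv_of_real[where 'a = complex])
  then show ?thesis by (simp add: vec_eq_iff)
qed

text \<open>By \<open>sum_Cm_square\<close> the fourfold products sum to 25, and the diagonal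
  corrections to 10/4 - 5. The result 45/2 is \<open>cas\<close> at the highest spin weight.\<close>

lemma XM_cas: "(\<Sum>a\<in>UNIV. \<Sum>b\<in>UNIV. XM b a ** XM a b) = (45/2) *\<^sub>R mat 1"
proof -
  have s: "(r *\<^sub>R A) ** B = r *\<^sub>R (A ** B)" "A ** (r *\<^sub>R B) = r *\<^sub>R (A ** B)"
    for r and A B :: "complex ^ 16 ^ 16"
    by (simp_all add: vec_eq_iff matrix_matrix_mult_def scaleR_sum_right)
  have lsum: "(\<Sum>b\<in>UNIV. A ** (f b ** B)) = A ** ((\<Sum>b\<in>UNIV. f b) ** B)"
    for A B :: "complex ^ 16 ^ 16" and f :: "10 \<Rightarrow> complex ^ 16 ^ 16"
    unfolding sum_10 matrix_add_ldistrib matrix_add_rdistrib ..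
  have "XM b a ** XM a b = Cm a ** ((Cm b ** Cm b) ** Cm a)
      + (if b = a then (1/4) *\<^sub>R mat 1 - Cm a ** Cm a else 0)" for a b
    unfolding XM_def matrix_diff_ldistrib matrix_diff_rdistrib s dm_mult
    by (auto simp: dm_def algebra_simps matrix_mul_assoc)
  then have "(\<Sum>a\<in>UNIV. \<Sum>b\<in>UNIV. XM b a ** XM a b)
      = (\<Sum>a\<in>UNIV. Cm a ** ((\<Sum>b\<in>UNIV. Cm b ** Cm b) ** Cm a)
         + ((1/4) *\<^sub>R mat 1 - Cm a ** Cm a))"
    by (simp add: sum.distrib lsum)
  also have "\<dots> = (45/2) *\<^sub>R mat 1"
    unfolding sum_Cm_square sum.distrib sum_subtractf s matrix_mul_lid
    by (simp add: scaleR_sum_right[symmetric] sum_Cm_square sum_constant_scaleR)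
      (simp flip: scaleR_left_distrib scaleR_left_diff_distrib)
  finally show ?thesis .
qed

lemma XS_cas: "(\<Sum>a\<in>UNIV. \<Sum>b\<in>UNIV. \<Sum>k\<in>UNIV. XS b a i k * XS a b k j) = (if i = j then of_real (45/2) else 0)"
  using arg_cong[OF XM_cas, of "\<lambda>M. M $ i $ j"]
  by (cases "i = j") (simp_all add: matrix_matrix_mult_def XM_nth mat_def scaleR_conv_of_real[where 'a = complex])

locale spinor_tensor = hw_module sc F lm v
  for sc :: "complex \<Rightarrow> 'v::ab_group_add \<Rightarrow> 'v" and F lm v +
  assumes lm_odd: "lm (a + 5) = - lm a"
begin

sublocale S: tensor_module sc F lm v XS wS "45/2"
  by unfold_locales (rule XS_skew XS_comm XS_diag XS_cas)+

end

text \<open>In other words, the quadrics \<open>\<zeta>\<^sub>m\<close> span a copy of the natural module.\<close>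

lemma XM_Cm: "transpose (XM a b) ** Cm m + Cm m ** XM a b
    = (if b = m then Cm a else 0) - (if a + 5 = m then Cm (b + 5) else 0)"
proof -
  have t: "transpose (XM a b) = Cm a ** Cm b - (1/2) *\<^sub>R dm (a = b)"
    by (auto simp: vec_eq_iff transpose_def XM_def matrix_matrix_mult_def dm_def mat_def Cm_symmetric mult.commute)
  have s: "(r *\<^sub>R A) ** B = r *\<^sub>R (A ** B)" "A ** (r *\<^sub>R B) = r *\<^sub>R (A ** B)"
    for r and A B :: "complex ^ 16 ^ 16"
    by (simp_all add: vec_eq_iff matrix_matrix_mult_def scaleR_sum_right)
  have "Cm a ** Cm b ** Cm m = Cm a ** (Cm b ** Cm m)" by (simp add: matrix_mul_assoc)
  also have "\<dots> = (if b = m then Cm a else 0) - (Cm a ** Cm (m + 5)) ** Cm (b + 5)"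
    unfolding Clifford_swap[of b m] by (auto simp: matrix_diff_ldistrib matrix_mul_assoc)
  also have "(Cm a ** Cm (m + 5)) ** Cm (b + 5) = (if a + 5 = m then Cm (b + 5) else 0) - Cm m ** (Cm (a + 5) ** Cm (b + 5))"
    unfolding Clifford_swap[of a "m + 5"] by (auto simp: matrix_diff_rdistrib matrix_mul_assoc add_5_eq_iff)
  also have "Cm (a + 5) ** Cm (b + 5) = dm (a = b) - Cm b ** Cm a"
    unfolding Clifford_swap[of "a + 5" "b + 5"] by (auto simp: dm_def)
  also have "Cm m ** (dm (a = b) - Cm b ** Cm a) = (if a = b then Cm m else 0) - Cm m ** (Cm b ** Cm a)"
    by (auto simp: matrix_diff_ldistrib)
  finally have e: "Cm a ** Cm b ** Cm m = (if b = m then Cm a else 0) - ((if a + 5 = m then Cm (b + 5) else 0)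
      - ((if a = b then Cm m else 0) - Cm m ** (Cm b ** Cm a)))" .
  show ?thesis unfolding t unfolding XM_def matrix_diff_ldistrib matrix_diff_rdistrib e s dm_mult
    by (simp add: vec_eq_iff)
qed

section \<open>Polynomials\<close>

lemma poly_mapping_sum: "(\<Sum>m\<in>Poly_Mapping.keys f. Poly_Mapping.single m (Poly_Mapping.lookup f m)) = f"
  by (rule poly_mapping_eqI) (simp add: lookup_sum lookup_single when_def in_keys_iff)

lemma poly_mapping_induct [case_names single add]:
  assumes "\<And>m a. P (Poly_Mapping.single m a)" "\<And>f g. P f \<Longrightarrow> P g \<Longrightarrow> P (f + g)"
  shows "P (f :: 'a \<Rightarrow>\<^sub>0 'b::comm_monoid_add)"
proof -
  have "P 0" using assms(1)[of undefined 0] by simp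
  then have "P (\<Sum>m\<in>S. Poly_Mapping.single m (Poly_Mapping.lookup f m))" for S
    by (induction S rule: infinite_finite_induct) (simp_all add: assms)
  from this[of "Poly_Mapping.keys f"] show ?thesis unfolding poly_mapping_sum .
qed

lemma pd_superset:
  assumes "finite S" "Poly_Mapping.keys f \<subseteq> S"
  shows "pd i f = (\<Sum>m\<in>S. Poly_Mapping.single (m - Poly_Mapping.single (of_nat i) 1)
       (of_nat (Poly_Mapping.lookup m (of_nat i)) * Poly_Mapping.lookup f m))"
  unfolding pd_def using assms by (intro sum.mono_neutral_left) (auto simp: in_keys_iff)

lemma pd_add: "pd i (f + g) = pd i f + pd i g"
proof -
  let ?S = "Poly_Mapping.keys f \<union> Poly_Mapping.keys g"
  have "Poly_Mapping.keys (f + g) \<subseteq> ?S" by (rule Poly_Mapping.keys_add)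
  then show ?thesis
    by (simp add: pd_superset[of ?S] lookup_add distrib_left single_add sum.distrib)
qed

lemma pd_single: "pd i (Poly_Mapping.single m a) = Poly_Mapping.single (m - Poly_Mapping.single (of_nat i) 1)
    (of_nat (Poly_Mapping.lookup m (of_nat i)) * a)"
  by (subst pd_superset[of "{m}"]) auto

lemma pd_single_mult:
  "pd i (Poly_Mapping.single m a * Poly_Mapping.single n b) =
    pd i (Poly_Mapping.single m a) * Poly_Mapping.single n b + Poly_Mapping.single m a * pd i (Poly_Mapping.single n b)"
proof -
  let ?e = "Poly_Mapping.single (of_nat i) 1 :: monomial" and ?i = "of_nat i :: 16"
  have s: "m + n - ?e = (m - ?e) + n" if "Poly_Mapping.lookup m ?i > 0" for m n :: monomial
    using that by (intro poly_mapping_eqI) (auto simp: lookup_add lookup_minus lookup_single when_def)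
  have 1: "Poly_Mapping.single (m + n - ?e) (of_nat (Poly_Mapping.lookup m ?i) * (a * b))
      = Poly_Mapping.single (m - ?e + n) (of_nat (Poly_Mapping.lookup m ?i) * a * b)"
    using s[of m n] by (cases "Poly_Mapping.lookup m ?i") (simp_all add: mult.assoc)
  have 2: "Poly_Mapping.single (m + n - ?e) (of_nat (Poly_Mapping.lookup n ?i) * (a * b))
      = Poly_Mapping.single (m + (n - ?e)) (a * (of_nat (Poly_Mapping.lookup n ?i) * b))"
    using s[of n m] by (cases "Poly_Mapping.lookup n ?i") (simp_all add: add.commute mult_ac)
  show ?thesis
    unfolding mult_single pd_single lookup_add of_nat_add distrib_right single_add 1 2 ..
qed

lemma pd_mult: "pd i (f * g) = pd i f * g + f * pd i g"
proof (induction f rule: poly_mapping_induct)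
  case (single m a)
  show ?case
  proof (induction g rule: poly_mapping_induct)
    case (add f g)
    then show ?case by (simp add: distrib_left pd_add)
  qed (rule pd_single_mult)
next
  case (add f g)
  then show ?case by (simp add: distrib_right pd_add)
qed

lemma pd_cpoly: "pd i (cpoly a) = 0"
  by (simp add: cpoly_def pd_single)

lemma pd_0: "pd i 0 = 0"
  by (simp add: pd_def)

lemma pd_sum: "pd i (\<Sum>k\<in>I. f k) = (\<Sum>k\<in>I. pd i (f k))"
  by (induction I rule: infinite_finite_induct) (simp_all add: pd_0 pd_add)

lemma pd_cpoly_mult: "pd i (cpoly a * f) = cpoly a * pd i f"
  by (simp add: pd_mult pd_cpoly)

lemma cpoly_simps: "cpoly 0 = 0" "cpoly 1 = 1" "cpoly (a + b) = cpoly a + cpoly b" "cpoly (- a) = - cpoly a"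
    "cpoly (a - b) = cpoly a - cpoly b" "cpoly (a * b) = cpoly a * cpoly b"
    "cpoly (of_nat n) = of_nat n" "cpoly (numeral k) = numeral k"
  by (simp_all add: cpoly_def single_add single_diff single_uminus mult_single)

lemma cpoly_sum: "cpoly (\<Sum>k\<in>I. f k) = (\<Sum>k\<in>I. cpoly (f k))"
  by (induction I rule: infinite_finite_induct) (simp_all add: cpoly_simps)

section \<open>The gradients of the quadrics and their identities\<close>

definition xv :: "16 \<Rightarrow> poly16" where
  "xv i = Xvar (idx16 i)"

definition dx :: "16 \<Rightarrow> poly16 \<Rightarrow> poly16" where
  "dx i = pd (idx16 i)"

lemmas dx_simps = pd_add[of "idx16 i" for i, folded dx_def] pd_mult[of "idx16 i" for i, folded dx_def]
  pd_cpoly[of "idx16 i" for i, folded dx_def] pd_sum[of "idx16 i" for i, folded dx_def]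
  pd_cpoly_mult[of "idx16 i" for i, folded dx_def] pd_0[of "idx16 i" for i, folded dx_def]

lemma dx_xv: "dx i (xv j) = of_bool (i = j)"
proof -
  have "Poly_Mapping.single j 1 - Poly_Mapping.single i 1 = (0 :: monomial)" if "i = j"
    using that by simp
  then show ?thesis by (auto simp: dx_def xv_def Xvar_def pd_single idx16 lookup_single when_def)
qed

definition zt :: "10 \<Rightarrow> poly16" where
  "zt a = zeta (idx10 a)"

definition grad :: "10 \<Rightarrow> 16 \<Rightarrow> poly16" where
  "grad a i = (\<Sum>l\<in>UNIV. cpoly (Cm a $ i $ l) * xv l)"

definition svar :: "int \<Rightarrow> poly16" where
  "svar k = (if k > 0 then Xvar (nat k) else if k < 0 then - Xvar (nat (- k)) else 0)"

lemma grad_eq: "grad a i = svar (ct (idx10 a) (int (idx16 i)))"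
proof -
  have "(\<Sum>l\<in>UNIV. cpoly (sv k l) * xv l) = svar k" if "\<bar>k\<bar> \<le> 16" for k
    using that
  proof (cases k rule: index_cases)
    case (2 m)
    then show ?thesis using idx16(1)[of m]
      by (simp add: sv_idx svar_def xv_def of_bool_def if_distrib[of cpoly] if_distrib[of "\<lambda>xv. xv * _"] cpoly_simps cong: if_cong)
  next
    case (3 m)
    then show ?thesis using idx16(1)[of m]
      by (simp add: sv_idx sv_minus svar_def xv_def of_bool_def if_distrib[of cpoly] if_distrib[of "\<lambda>xv. xv * _"]
          if_distrib[of uminus] cpoly_simps cong: if_cong)
  qed (simp add: sv_0 svar_def cpoly_simps)
  then show ?thesis using ct_bound by (simp add: grad_def Cm_def)
qed

lemma sum_1_16: "(\<Sum>n\<in>{1..16::nat}. f n) = f 1 + f 2 + f 3 + f 4 + f 5 + f 6 + f 7 + f 8 + f 9 + f 10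
    + f 11 + f 12 + f 13 + f 14 + f 15 + f 16"
  by (simp add: numeral_eq_Suc add.assoc)

lemma sum_1_10: "(\<Sum>n\<in>{1..10::nat}. f n) = f 1 + f 2 + f 3 + f 4 + f 5 + f 6 + f 7 + f 8 + f 9 + f 10"
  by (simp add: numeral_eq_Suc add.assoc)

lemma range_10: "n \<in> {1..10} \<Longrightarrow> n = 1 \<or> n = 2 \<or> n = 3 \<or> n = 4 \<or> n = 5 \<or> n = 6 \<or> n = 7 \<or> n = 8 \<or> n = 9 \<or> n = (10::nat)"
  unfolding atLeastAtMost_iff by presburger

lemma range_16: "n \<in> {1..16} \<Longrightarrow> n = 1 \<or> n = 2 \<or> n = 3 \<or> n = 4 \<or> n = 5 \<or> n = 6 \<or> n = 7 \<or> n = 8 \<or> n = 9 \<or> n = 10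
  \<or> n = 11 \<or> n = 12 \<or> n = 13 \<or> n = 14 \<or> n = 15 \<or> n = (16::nat)"
  unfolding atLeastAtMost_iff by presburger

lemma euler_zeta:
  assumes "n \<in> {1..10}"
  shows "(\<Sum>i\<in>{1..16}. Xvar i * svar (ct n (int i))) = 2 * zeta n"
  using range_10[OF assms] unfolding sum_1_16
  by (elim disjE) (simp_all add: ct_def ctab_def svar_def zeta_def)

text \<open>Up to a factor 2, the gradient of the sum of all
  \<open>zeta n * zeta (prime10 n)\<close>, which vanishes: the vector formed quadratically from a
  spinor is isotropic.\<close>

lemma fierz_zeta:
  assumes "i \<in> {1..16}"
  shows "(\<Sum>n\<in>{1..10}. zeta n * svar (ct (prime10 n) (int i))) = 0"
  using range_16[OF assms] unfolding sum_1_10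
  by (elim disjE) (simp_all add: ct_def ctab_def svar_def zeta_def prime10_def algebra_simps)

lemma euler: "(\<Sum>i\<in>UNIV. xv i * grad a i) = 2 * zt a"
  using euler_zeta[OF idx10(1), of a] unfolding sum_idx16 by (simp add: grad_eq xv_def zt_def)

lemma fierz: "(\<Sum>a\<in>UNIV. zt a * grad (a + 5) i) = 0"
  using fierz_zeta[OF idx16(1), of i] unfolding sum_idx10 by (simp add: grad_eq zt_def idx10_add_5)

lemma dx_grad: "dx j (grad a i) = cpoly (Cm a $ i $ j)"
  by (simp add: grad_def dx_simps dx_xv of_bool_def if_distrib[of "\<lambda>xv. _ * xv"] cong: if_cong)

text \<open>Obtained by differentiating Euler's identity instead of the ten explicit
  quadrics.\<close>

lemma dx_zt: "dx i (zt a) = grad a i"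
proof -
  have "2 * dx i (zt a) = dx i (2 * zt a)"
    using dx_simps(5)[of i 2 "zt a"] by (simp add: cpoly_simps)
  also have "\<dots> = (\<Sum>j\<in>UNIV. of_bool (i = j) * grad a j + xv j * cpoly (Cm a $ i $ j))"
    unfolding euler[symmetric] by (simp add: dx_simps dx_xv dx_grad Cm_symmetric[of a i])
  also have "\<dots> = 2 * grad a i"
    by (simp add: sum.distrib) (simp add: grad_def mult.commute)
  finally have "cpoly (1/2) * (2 * dx i (zt a)) = cpoly (1/2) * (2 * grad a i)" by simp
  moreover have "cpoly (1/2) * (2 * f) = f" for f
    using cpoly_simps(6)[of "1/2" 2] by (simp add: cpoly_simps mult.assoc[symmetric])
  ultimately show ?thesis by simp
qed

definition eul :: "poly16 \<Rightarrow> poly16" where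
  "eul f = (\<Sum>i\<in>UNIV. xv i * dx i f)"

lemma Pop_eq: "Pop (idx16 i) f = xv i * eul f - (\<Sum>a\<in>UNIV. zt a * (\<Sum>j\<in>UNIV. cpoly (Cm a $ i $ j) * dx j f))"
proof -
  have "pd (idx16 i) (pd (idx16 j) (zeta (idx10 a))) = cpoly (Cm a $ i $ j)" for j a
    using dx_zt[of j a] dx_grad[of i a j] by (simp add: zt_def dx_def Cm_symmetric[of a j])
  then show ?thesis unfolding Pop_def Dop_def sum_idx16 sum_idx10 by (simp add: xv_def eul_def dx_def zt_def)
qed

lemma eul_add: "eul (f + g) = eul f + eul g"
  by (simp add: eul_def dx_simps distrib_left sum.distrib)

lemma eul_mult: "eul (f * g) = eul f * g + f * eul g"
  by (simp add: eul_def dx_simps distrib_left sum.distrib sum_distrib_left sum_distrib_right mult_ac)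

lemma eul_xv: "eul (xv i) = xv i"
  by (simp add: eul_def dx_xv of_bool_def if_distrib[of "\<lambda>xv. _ * xv"] cong: if_cong)

lemma eul_grad: "eul (grad a i) = grad a i"
  unfolding eul_def dx_grad by (simp add: grad_def mult.commute)

text \<open>The Clifford relation replaces the product of two Hessians by a delta term minus the
  dual product in the opposite order, and the latter contributes 0 by \<open>fierz\<close>.\<close>

lemma cubic: "(\<Sum>a\<in>UNIV. zt a * (\<Sum>i\<in>UNIV. cpoly (Cm a $ i $ j) * grad m i)) = zt m * xv j"
proof -
  have P: "(\<Sum>k\<in>UNIV. cpoly (Cm a $ j $ k) * grad b k) = (\<Sum>l\<in>UNIV. cpoly ((Cm a ** Cm b) $ j $ l) * xv l)" for a b
    unfolding grad_def matrix_matrix_mult_def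
    by (simp add: cpoly_sum cpoly_simps sum_distrib_left sum_distrib_right mult.assoc) (rule sum.swap)
  have "(\<Sum>i\<in>UNIV. cpoly (Cm a $ i $ j) * grad m i)
      = of_bool (a = m) * xv j - (\<Sum>k\<in>UNIV. cpoly (Cm (m + 5) $ j $ k) * grad (a + 5) k)" for a
  proof -
    have "(\<Sum>i\<in>UNIV. cpoly (Cm a $ i $ j) * grad m i) = (\<Sum>l\<in>UNIV. cpoly ((Cm a ** Cm m) $ j $ l) * xv l)"
      unfolding Cm_symmetric[of a _ j] by (rule P)
    also have "\<dots> = (\<Sum>l\<in>UNIV. cpoly (dm (a = m) $ j $ l) * xv l)
        - (\<Sum>l\<in>UNIV. cpoly ((Cm (m + 5) ** Cm (a + 5)) $ j $ l) * xv l)"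
      unfolding Clifford_swap[of a m] by (simp add: cpoly_simps left_diff_distrib sum_subtractf)
    also have "(\<Sum>l\<in>UNIV. cpoly (dm (a = m) $ j $ l) * xv l) = of_bool (a = m) * xv j"
      by (simp add: dm_def mat_def cpoly_simps if_distrib[of cpoly] if_distrib[of "\<lambda>xv. xv * _"] cong: if_cong)
    finally show ?thesis unfolding P .
  qed
  then have "(\<Sum>a\<in>UNIV. zt a * (\<Sum>i\<in>UNIV. cpoly (Cm a $ i $ j) * grad m i))
      = (\<Sum>a\<in>UNIV. of_bool (a = m) * (zt a * xv j))
        - (\<Sum>a\<in>UNIV. \<Sum>k\<in>UNIV. cpoly (Cm (m + 5) $ j $ k) * (zt a * grad (a + 5) k))"
    by (simp add: right_diff_distrib sum_subtractf sum_distrib_left mult_ac)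
  also have "(\<Sum>a\<in>UNIV. \<Sum>k\<in>UNIV. cpoly (Cm (m + 5) $ j $ k) * (zt a * grad (a + 5) k))
      = (\<Sum>k\<in>UNIV. cpoly (Cm (m + 5) $ j $ k) * (\<Sum>a\<in>UNIV. zt a * grad (a + 5) k))"
    by (subst sum.swap) (simp add: sum_distrib_left)
  finally show ?thesis by (simp add: fierz)
qed

text \<open>The constant is 2 (n + 1) - 8 - n, where the three terms come from Euler's identity,
  from \<open>Cm_trace\<close> and from \<open>cubic\<close>.\<close>

lemma Pop_gradient:
  assumes "eul h = of_nat n * h"
  shows "(\<Sum>i\<in>UNIV. Pop (idx16 i) (grad m i * h)) = (of_nat n - 6) * (zt m * h)"
proof -
  have "Pop (idx16 i) (grad m i * h) = of_nat (Suc n) * (xv i * grad m i * h)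
      - (\<Sum>a\<in>UNIV. zt a * ((\<Sum>j\<in>UNIV. cpoly (Cm a $ i $ j * Cm m $ i $ j)) * h
         + (\<Sum>j\<in>UNIV. cpoly (Cm a $ i $ j) * grad m i * dx j h)))" for i
    unfolding Pop_eq eul_mult eul_grad assms
    by (simp add: dx_simps dx_grad sum.distrib distrib_left distrib_right cpoly_simps sum_distrib_left sum_distrib_right mult_ac)
  then have "(\<Sum>i\<in>UNIV. Pop (idx16 i) (grad m i * h)) = of_nat (Suc n) * ((\<Sum>i\<in>UNIV. xv i * grad m i) * h)
      - (\<Sum>i\<in>UNIV. \<Sum>a\<in>UNIV. zt a * ((\<Sum>j\<in>UNIV. cpoly (Cm a $ i $ j * Cm m $ i $ j)) * h))
      - (\<Sum>i\<in>UNIV. \<Sum>a\<in>UNIV. \<Sum>j\<in>UNIV. zt a * (cpoly (Cm a $ i $ j) * grad m i) * dx j h)"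
    by (simp only: sum_subtractf sum.distrib distrib_left sum_distrib_left sum_distrib_right diff_diff_eq mult.assoc)
  also have "(\<Sum>i\<in>UNIV. \<Sum>a\<in>UNIV. zt a * ((\<Sum>j\<in>UNIV. cpoly (Cm a $ i $ j * Cm m $ i $ j)) * h))
      = (\<Sum>a\<in>UNIV. zt a * (cpoly (\<Sum>i\<in>UNIV. \<Sum>j\<in>UNIV. Cm a $ i $ j * Cm m $ i $ j) * h))"
    by (subst sum.swap) (simp add: cpoly_sum sum_distrib_left sum_distrib_right)
  also have "\<dots> = 8 * (zt m * h)"
    by (simp add: Cm_trace cpoly_simps of_bool_def if_distrib[of cpoly] if_distrib[of "\<lambda>xv. _ * xv"]
        if_distrib[of "\<lambda>xv. xv * _"] mult_ac cong: if_cong)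
  also have "(\<Sum>i\<in>UNIV. \<Sum>a\<in>UNIV. \<Sum>j\<in>UNIV. zt a * (cpoly (Cm a $ i $ j) * grad m i) * dx j h)
      = (\<Sum>j\<in>UNIV. (\<Sum>a\<in>UNIV. zt a * (\<Sum>i\<in>UNIV. cpoly (Cm a $ i $ j) * grad m i)) * dx j h)"
  proof -
    have "(\<Sum>i\<in>UNIV. \<Sum>a\<in>UNIV. \<Sum>j\<in>UNIV. zt a * (cpoly (Cm a $ i $ j) * grad m i) * dx j h)
        = (\<Sum>a\<in>UNIV. \<Sum>j\<in>UNIV. \<Sum>i\<in>UNIV. zt a * (cpoly (Cm a $ i $ j) * grad m i) * dx j h)"
      by (subst sum.swap) (rule sum.cong[OF refl], rule sum.swap)
    also have "\<dots> = (\<Sum>j\<in>UNIV. \<Sum>a\<in>UNIV. \<Sum>i\<in>UNIV. zt a * (cpoly (Cm a $ i $ j) * grad m i) * dx j h)"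
      by (rule sum.swap)
    finally show ?thesis by (simp only: sum_distrib_left sum_distrib_right)
  qed
  also have "\<dots> = zt m * eul h"
    unfolding cubic eul_def by (simp add: sum_distrib_left mult.assoc)
  finally show ?thesis
    unfolding euler assms by (simp add: algebra_simps)
qed

section \<open>Homogeneous polynomials\<close>

inductive homog :: "nat \<Rightarrow> poly16 \<Rightarrow> bool" where
  const: "homog 0 (cpoly a)"
| mult: "homog n f \<Longrightarrow> homog (Suc n) (xv i * f)"
| add: "homog n f \<Longrightarrow> homog n g \<Longrightarrow> homog n (f + g)"

lemma homog_0: "homog n 0"
proof (induction n)
  case 0
  show ?case using homog.const[of 0] by (simp add: cpoly_simps)
next
  case (Suc n)
  then show ?case using homog.mult[of n 0 undefined] by simp
qed

lemma homog_sum: "(\<And>k. k \<in> I \<Longrightarrow> homog n (f k)) \<Longrightarrow> homog n ((\<Sum>k\<in>I. f k))"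
  by (induction I rule: infinite_finite_induct) (simp_all add: homog_0 homog.add)

lemma homog_cpoly_mult: "homog n f \<Longrightarrow> homog n (cpoly a * f)"
proof (induction rule: homog.induct)
  case (const b)
  show ?case using homog.const[of "a * b"] by (simp add: cpoly_simps)
next
  case (mult n f i)
  then show ?case using homog.mult[of n "cpoly a * f" i] by (simp add: mult.left_commute)
next
  case (add n f g)
  then show ?case using homog.add by (simp add: distrib_left)
qed

lemma homog_eul: "homog n f \<Longrightarrow> eul f = of_nat n * f"
  by (induction rule: homog.induct) (simp_all add: eul_mult eul_xv eul_add algebra_simps, simp add: eul_def dx_simps)

lemma homog_dx: "homog n f \<Longrightarrow> (n = 0 \<longrightarrow> dx j f = 0) \<and> (\<forall>k. n = Suc k \<longrightarrow> homog k (dx j f))"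
proof (induction rule: homog.induct)
  case (mult n f i)
  have "homog n (xv i * dx j f)" using mult by (cases n rule: nat.exhaust) (simp_all add: homog_0 homog.mult)
  then show ?case using mult by (auto simp: dx_simps dx_xv of_bool_def homog_0 intro: homog.add)
qed (auto simp: dx_simps intro: homog.add)

lemma homog_Suc: "homog (Suc n) f \<Longrightarrow> \<exists>g. (\<forall>i. homog n (g i)) \<and> f = (\<Sum>i\<in>UNIV. xv i * g i)"
proof (induction "Suc n" f rule: homog.induct)
  case (mult f i)
  then show ?case
    by (intro exI[of _ "\<lambda>j. if j = i then f else 0"])
      (auto simp: homog_0 if_distrib[of "\<lambda>xv. _ * xv"] cong: if_cong)
next
  case (add f g)
  then obtain f' g' where "\<And>i. homog n (f' i)" "f = (\<Sum>i\<in>UNIV. xv i * f' i)" "\<And>i. homog n (g' i)" "g = (\<Sum>i\<in>UNIV. xv i * g' i)"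
    by blast
  then show ?case
    by (intro exI[of _ "\<lambda>i. f' i + g' i"]) (auto simp: distrib_left sum.distrib intro: homog.add)
qed

lemma homog_grad_mult: "homog n h \<Longrightarrow> homog (Suc n) (grad a i * h)"
  unfolding grad_def sum_distrib_right mult.assoc by (intro homog_sum homog_cpoly_mult homog.mult)

lemma monomial_homog: "\<exists>n. homog n (Poly_Mapping.single m 1)"
proof (induction "\<Sum>i\<in>UNIV. Poly_Mapping.lookup m i" arbitrary: m)
  case 0
  then have "m = 0" by (intro poly_mapping_eqI) simp
  then show ?case using homog.const[of 1] by (auto simp: cpoly_def)
next
  case (Suc k)
  then obtain i where i: "Poly_Mapping.lookup m i \<noteq> 0" by (metis nat.distinct(1) sum.neutral)
  let ?n = "m - Poly_Mapping.single i 1"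
  have m: "m = Poly_Mapping.single i 1 + ?n"
    using i by (intro poly_mapping_eqI) (auto simp: lookup_add lookup_minus lookup_single when_def)
  have "(\<Sum>i\<in>UNIV. Poly_Mapping.lookup m i) = Suc (\<Sum>i\<in>UNIV. Poly_Mapping.lookup ?n i)"
    by (subst m) (simp add: lookup_add sum.distrib lookup_single when_def del: add_diff_inverse)
  then obtain l where "homog l (Poly_Mapping.single ?n 1)" using Suc by fastforce
  then have "homog (Suc l) (xv i * Poly_Mapping.single ?n 1)" by (rule homog.mult)
  moreover have "xv i * Poly_Mapping.single ?n 1 = Poly_Mapping.single m 1"
    by (subst (2) m) (simp add: xv_def Xvar_def mult_single idx16)
  ultimately show ?case by auto
qed

text \<open>The quadratic form of a matrix does not change under transposition, so twice the left
  side is the form of the symmetric matrix computed in \<open>XM_Cm\<close>.\<close>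

lemma XS_zt: "(\<Sum>i\<in>UNIV. \<Sum>j\<in>UNIV. cpoly (XS a b i j) * xv j * dx i (zt m))
    = (if b = m then zt a else 0) - (if a + 5 = m then zt (b + 5) else 0)"
proof -
  let ?q = "\<lambda>M :: complex ^ 16 ^ 16. \<Sum>j\<in>UNIV. \<Sum>l\<in>UNIV. cpoly (M $ j $ l) * (xv j * xv l)"
  have q_add: "?q (M + N) = ?q M + ?q N" "?q (M - N) = ?q M - ?q N" for M N
    by (simp_all add: cpoly_simps distrib_right left_diff_distrib sum.distrib sum_subtractf)
  have qZ: "?q (Cm a) = 2 * zt a" for a
    unfolding euler[symmetric] grad_def by (simp add: sum_distrib_left mult_ac)
  have qt: "?q (transpose M) = ?q M" for M
    by (subst sum.swap) (simp add: transpose_def mult.commute)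
  let ?S = "\<Sum>i\<in>UNIV. \<Sum>j\<in>UNIV. cpoly (XS a b i j) * xv j * dx i (zt m)"
  have "?S = (\<Sum>i\<in>UNIV. \<Sum>j\<in>UNIV. \<Sum>l\<in>UNIV. cpoly (XM a b $ i $ j * Cm m $ i $ l) * (xv j * xv l))"
    unfolding dx_zt grad_def XM_nth by (simp add: sum_distrib_left cpoly_simps mult_ac)
  also have "\<dots> = (\<Sum>j\<in>UNIV. \<Sum>l\<in>UNIV. \<Sum>i\<in>UNIV. cpoly (XM a b $ i $ j * Cm m $ i $ l) * (xv j * xv l))"
    by (subst sum.swap) (rule sum.cong[OF refl], rule sum.swap)
  also have "\<dots> = ?q (transpose (XM a b) ** Cm m)"
    by (simp add: matrix_matrix_mult_def transpose_def cpoly_sum sum_distrib_right)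
  finally have S: "?S = ?q (transpose (XM a b) ** Cm m)" .
  have tC: "transpose (Cm m) = Cm m" by (simp add: transpose_def vec_eq_iff Cm_symmetric[of m])
  have "transpose (transpose (XM a b) ** Cm m) = Cm m ** XM a b"
    by (simp add: matrix_transpose_mul tC)
  then have "?q (Cm m ** XM a b) = ?S" unfolding S using qt[of "transpose (XM a b) ** Cm m"] by simp
  then have "2 * ?S = ?q (transpose (XM a b) ** Cm m + Cm m ** XM a b)"
    unfolding q_add S by simp
  also have "\<dots> = 2 * ((if b = m then zt a else 0) - (if a + 5 = m then zt (b + 5) else 0))"
    unfolding XM_Cm q_add using qZ by (auto simp: cpoly_simps right_diff_distrib)
  finally have "cpoly (1/2) * (2 * ?S) = cpoly (1/2) * (2 * ((if b = m then zt a else 0) - (if a + 5 = m then zt (b + 5) else 0)))"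
    by (rule arg_cong)
  moreover have "cpoly (1/2) * (2 * f) = f" for f
    using cpoly_simps(6)[of "1/2" 2] by (simp add: cpoly_simps mult.assoc[symmetric])
  ultimately show ?thesis by (simp only:)
qed

section \<open>Root vectors of the subalgebra of type D5\<close>

definition Fm :: "10 \<Rightarrow> 10 \<Rightarrow> mat10" where
  "Fm a b = (\<chi> p q. of_bool (p = a \<and> q = b) - of_bool (p = b + 5 \<and> q = a + 5))"

lemma Fm_nth: "Fm a b $ p $ q = XU a b q p"
  by (simp add: Fm_def XU_def)

lemma Fm_skew: "Fm (b + 5) (a + 5) = - Fm a b"
  by (simp add: Fm_def vec_eq_iff)

lemma Fm_self: "Fm a (a + 5) = 0"
  by (simp add: Fm_def vec_eq_iff)

lemma mscale_minus_1: "mscale (-1) A = - A"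
  by (simp add: mscale_def vec_eq_iff)

interpretation mat: vector_space mscale
  by (rule vector_space_mscale)

lemma Fm_eq_Emat:
  assumes "p \<in> {1..10}" "q \<in> {1..10}"
  shows "Fm (of_nat p) (of_nat q) = Emat p q - Emat (prime10 q) (prime10 p)"
  using assms by (auto simp: Fm_def Emat_def vec_eq_iff of_nat_prime10 of_bool_def)

lemma mbracket_Fm: "mbracket (Fm a b) (Fm c d) = (if b = c then Fm a d else 0) - (if a = d then Fm c b else 0)
      - (if b = d + 5 then Fm a (c + 5) else 0) - (if a + 5 = c then Fm (b + 5) d else 0)"
proof -
  have "mbracket (Fm a b) (Fm c d) $ p $ q = (\<Sum>k\<in>UNIV. XU c d q k * XU a b k p) - (\<Sum>k\<in>UNIV. XU a b q k * XU c d k p)" for p q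
    by (simp add: mbracket_def matrix_matrix_mult_def Fm_nth mult.commute)
  then show ?thesis unfolding XU_comm by (simp add: vec_eq_iff Fm_nth)
qed

lemma Fm_o10: "Fm a b \<in> o10"
proof -
  let ?S = "{Emat i j - Emat (5 + j) (5 + i) | i j. i \<in> {1..5} \<and> j \<in> {1..5}}
      \<union> {Emat p (5 + q) - Emat q (5 + p) | p q. 1 \<le> p \<and> p < q \<and> q \<le> 5}
      \<union> {Emat (5 + p) q - Emat (5 + q) p | p q. 1 \<le> p \<and> p < q \<and> q \<le> 5}"
  have neg: "A \<in> o10 \<Longrightarrow> - A \<in> o10" for A unfolding o10_def by (rule mat.span_neg)
  have base: "A \<in> ?S \<Longrightarrow> A \<in> o10" for A unfolding o10_def by (rule mat.span_base)
  have low: "Fm (of_nat p) (of_nat q) \<in> o10" if "p \<in> {1..5}" "q \<in> {1..10}" for p q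
  proof (cases "q \<le> 5")
    case True
    then have "Fm (of_nat p) (of_nat q) = Emat p q - Emat (5 + q) (5 + p)"
      using that by (simp add: Fm_eq_Emat prime10_def add.commute)
    then show ?thesis using that True by (intro base) auto
  next
    case False
    define r where "r = q - 5"
    have r: "q = 5 + r" "r \<in> {1..5}" using that False by (auto simp: r_def)
    have e: "Fm (of_nat p) (of_nat q) = Emat p (5 + r) - Emat r (5 + p)" if "p \<in> {1..5}" "r \<in> {1..5}" "q = 5 + r" for p q r
      using that Fm_eq_Emat[of p q] by (auto simp: prime10_def add.commute)
    consider "p < r" | "p = r" | "r < p" by linarith
    then show ?thesis
    proof cases
      case 1
      then show ?thesis using that r unfolding e[OF that(1) r(2,1)] by (intro base) auto
    next
      case 2
      then show ?thesis unfolding e[OF that(1) r(2,1)] o10_def by (simp add: mat.span_zero)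
    next
      case 3
      then have "Emat r (5 + p) - Emat p (5 + r) \<in> o10" using that r by (intro base) auto
      then show ?thesis using neg unfolding e[OF that(1) r(2,1)] by force
    qed
  qed
  have high: "Fm (of_nat p) (of_nat q) \<in> o10" if "p \<in> {6..10}" "q \<in> {1..5}" for p q
  proof -
    define r where "r = p - 5"
    have r: "r \<in> {1..5}" "p = 5 + r" using that by (auto simp: r_def)
    have e: "Fm (of_nat p) (of_nat q) = Emat (5 + r) q - Emat (5 + q) r"
      using r that Fm_eq_Emat[of p q] by (auto simp: prime10_def add.commute)
    consider "r < q" | "r = q" | "q < r" by linarith
    then show ?thesis
    proof cases
      case 1
      then show ?thesis unfolding e
        using that r by (intro base UnI2 CollectI exI[of _ r] exI[of _ q]) simp
    next
      case 2
      then show ?thesis unfolding e o10_def by (simp add: mat.span_zero)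
    next
      case 3
      then have "Emat (5 + q) r - Emat (5 + r) q \<in> o10"
        using that r by (intro base UnI2 CollectI exI[of _ q] exI[of _ r]) simp
      then show ?thesis using neg unfolding e by force
    qed
  qed
  have nat: "Fm (of_nat p) (of_nat q) \<in> o10" if "p \<in> {1..10}" "q \<in> {1..10}" for p q
  proof -
    consider "p \<in> {1..5}" | "p \<in> {6..10}" "q \<in> {1..5}" | "p \<in> {6..10}" "q \<in> {6..10}"
      using \<open>p \<in> {1..10}\<close> \<open>q \<in> {1..10}\<close> by force
    then show ?thesis
    proof cases
      case 3
      have "Fm (of_nat p) (of_nat q) = - Fm (of_nat q + 5) (of_nat p + 5)"
        using Fm_skew[of "of_nat p" "of_nat q"] by (metis add_5_5 Fm_skew minus_minus)
      also have "\<dots> = - Fm (of_nat (prime10 q)) (of_nat (prime10 p))"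
        using that by (simp add: of_nat_prime10)
      also have "\<dots> \<in> o10"
        using 3 by (intro neg low) (auto simp: prime10_def)
      finally show ?thesis .
    qed (use that low high in blast)+
  qed
  show ?thesis using nat[OF idx10(1)[of a] idx10(1)[of b]] by (simp add: idx10)
qed

lemma o10_span: "o10 = mat.span (range (\<lambda>(a, b). Fm a b))"
proof
  have F: "Emat p q - Emat (prime10 q) (prime10 p) \<in> mat.span (range (\<lambda>(a, b). Fm a b))"
    if "p \<in> {1..10}" "q \<in> {1..10}" for p q
    unfolding Fm_eq_Emat[OF that, symmetric] by (rule mat.span_base) auto
  show "o10 \<subseteq> mat.span (range (\<lambda>(a, b). Fm a b))"
    unfolding o10_def
  proof (rule mat.span_minimal, safe)
    fix i j :: nat assume "i \<in> {1..5}" "j \<in> {1..5}"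
    then show "Emat i j - Emat (5 + j) (5 + i) \<in> mat.span (range (\<lambda>(a, b). Fm a b))"
      using F[of i j] by (auto simp: prime10_def add.commute)
  next
    fix p q :: nat assume "1 \<le> p" "p < q" "q \<le> 5"
    then show "Emat p (5 + q) - Emat q (5 + p) \<in> mat.span (range (\<lambda>(a, b). Fm a b))"
      "Emat (5 + p) q - Emat (5 + q) p \<in> mat.span (range (\<lambda>(a, b). Fm a b))"
      using F[of p "5 + q"] F[of "5 + p" q] by (auto simp: prime10_def add.commute)
  qed
  show "mat.span (range (\<lambda>(a, b). Fm a b)) \<subseteq> o10"
  proof (rule mat.span_minimal)
    show "mat.subspace o10" unfolding o10_def by (rule mat.subspace_span)
  qed (use Fm_o10 in auto)
qed

text \<open>Elements of the root lattice are given by the lists of their coordinates with respect to the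
  simple roots, the weights \<open>\<epsilon>\<^sub>a\<close> by the doubled lists \<open>ev a\<close>. The isomorphism \<open>\<nu>\<close> maps \<open>Fm a b\<close> to
  the multiple by the sign \<open>sg a b\<close> of the root vector for \<open>rt a b\<close>.\<close>

definition btab :: "int list list" where
  "btab =
  [[0, 0, 0, 0, 0, 1],
   [0, 0, 0, 0, 1, 1],
   [0, 0, 0, 1, 1, 1],
   [0, 0, 1, 1, 1, 1],
   [0, 1, 0, 1, 1, 1],
   [0, 1, 1, 1, 1, 1],
   [1, 0, 1, 1, 1, 1],
   [1, 1, 1, 1, 1, 1],
   [0, 1, 1, 2, 1, 1],
   [1, 1, 1, 2, 1, 1],
   [0, 1, 1, 2, 2, 1],
   [1, 1, 2, 2, 1, 1],
   [1, 1, 1, 2, 2, 1],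
   [1, 1, 2, 2, 2, 1],
   [1, 1, 2, 3, 2, 1],
   [1, 2, 2, 3, 2, 1]]"

definition etab :: "int list list" where
  "etab =
  [[2, 1, 2, 2, 1, 0],
   [0, 1, 2, 2, 1, 0],
   [0, 1, 0, 2, 1, 0],
   [0, 1, 0, 0, 1, 0],
   [0, 1, 0, 0, -1, 0],
   [-2, -1, -2, -2, -1, 0],
   [0, -1, -2, -2, -1, 0],
   [0, -1, 0, -2, -1, 0],
   [0, -1, 0, 0, -1, 0],
   [0, -1, 0, 0, 1, 0]]"

definition stab :: "int list list" where
  "stab =
  [[0, 1, -1, 1, 1, 0, -1, 1, 1, -1],
   [-1, 0, 1, -1, -1, 1, 0, -1, -1, 1],
   [1, -1, 0, 1, 1, -1, 1, 0, 1, -1],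
   [-1, 1, -1, 0, 1, -1, 1, -1, 0, 1],
   [-1, 1, -1, -1, 0, 1, -1, 1, -1, 0],
   [0, -1, 1, 1, -1, 0, 1, -1, 1, 1],
   [1, 0, -1, -1, 1, -1, 0, 1, -1, -1],
   [-1, 1, 0, 1, -1, 1, -1, 0, 1, 1],
   [-1, 1, -1, 0, 1, -1, 1, -1, 0, 1],
   [1, -1, 1, -1, 0, -1, 1, -1, -1, 0]]"

definition be :: "nat \<Rightarrow> int list" where "be i = btab ! (i - 1)"
definition ev :: "nat \<Rightarrow> int list" where "ev a = etab ! (a - 1)"
definition sg :: "nat \<Rightarrow> nat \<Rightarrow> int" where "sg a b = stab ! (a - 1) ! (b - 1)"

definition add6 :: "int list \<Rightarrow> int list \<Rightarrow> int list" where "add6 k l = map2 (+) k l"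
definition neg6 :: "int list \<Rightarrow> int list" where "neg6 l = map uminus l"

text \<open>The doubled coordinates are needed because the weights of the natural module are
  half-integral in the simple roots; their differences are even.\<close>

definition rt :: "nat \<Rightarrow> nat \<Rightarrow> int list" where
  "rt a b = map (\<lambda>k. k div 2) (add6 (ev a) (neg6 (ev b)))"

text \<open>\<open>form6\<close> and \<open>sign6\<close> are executable counterparts of
  \<open>qform\<close> and \<open>Fsign\<close>, which make statements about roots decidable by
  evaluation.\<close>

fun form6 :: "int list \<Rightarrow> int list \<Rightarrow> int" where
  "form6 [a, b, c, d, e, f] [a', b', c', d', e', f'] =
     2 * (a * a' + b * b' + c * c' + d * d' + e * e' + f * f')
     - (a * c' + c * a' + c * d' + d * c' + d * e' + e * d' + e * f' + f * e' + b * d' + d * b')"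
| "form6 _ _ = 0"

fun sign6 :: "int list \<Rightarrow> int list \<Rightarrow> int" where
  "sign6 [a, b, c, d, e, f] [a', b', c', d', e', f'] =
     (if (a * a' + b * b' + c * c' + d * d' + e * e' + f * f' + a * c' + d * b' + c * d' + e * d' + f * e') mod 2 = 0
      then 1 else -1)"
| "sign6 _ _ = 0"

lemma list6: "length l = 6 \<Longrightarrow> \<exists>a b c d e f. l = [a, b, c, d, e, f]"
  by (auto simp: length_Suc_conv numeral_eq_Suc)

lemma UNIV_6: "(UNIV :: 6 set) = {1, 2, 3, 4, 5, 6}"
  by (rule sym, rule card_subset_eq) simp_all

lemma sum_6: "(\<Sum>i\<in>(UNIV::6 set). f i) = f 1 + f 2 + f 3 + f 4 + f 5 + f 6"
proof -
  have "(\<Sum>i\<in>(UNIV::6 set). f i) = f 1 + (f 2 + (f 3 + (f 4 + (f 5 + f 6))))"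
    unfolding UNIV_6 by simp
  then show ?thesis by (simp only: add.assoc)
qed

lemma forall_6: "(\<forall>i::6. P i) \<longleftrightarrow> P 1 \<and> P 2 \<and> P 3 \<and> P 4 \<and> P 5 \<and> P 6"
  by (metis UNIV_6 UNIV_I empty_iff insertE)

lemma vector_add6: "length k = 6 \<Longrightarrow> length l = 6 \<Longrightarrow> vector k + vector l = (vector (add6 k l) :: lattice)"
  by (auto dest!: list6 simp: add6_def vec_eq_iff forall_6 vector_6 simp del: num1_eq1)

lemma vector_neg6: "length l = 6 \<Longrightarrow> - vector l = (vector (neg6 l) :: lattice)"
  by (auto dest!: list6 simp: neg6_def vec_eq_iff forall_6 vector_6)

lemma vector_inj6: "length k = 6 \<Longrightarrow> length l = 6 \<Longrightarrow> (vector k = (vector l :: lattice)) = (k = l)"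
  by (auto dest!: list6 simp: vec_eq_iff forall_6 vector_6)

lemma qform_vector: "length k = 6 \<Longrightarrow> length l = 6 \<Longrightarrow> qform (vector k) (vector l) = form6 k l"
  by (auto dest!: list6 simp: qform_def sum_6 vector_6 cartan_def edges_def algebra_simps)

lemma hform_vector: "length k = 6 \<Longrightarrow> length l = 6 \<Longrightarrow> hform (\<chi> i. of_int (vector k $ i)) (vector l) = of_int (form6 k l)"
  by (auto dest!: list6 simp: hform_def sum_6 vector_6 cartan_def edges_def algebra_simps)

lemma Fsign_vector: "length k = 6 \<Longrightarrow> length l = 6 \<Longrightarrow> Fsign (vector k) (vector l) = of_int (sign6 k l)"
  by (auto dest!: list6 simp: Fsign_def sum_6 vector_6 even_iff_mod_2_eq_zero)

lemma length_add6: "length k = 6 \<Longrightarrow> length l = 6 \<Longrightarrow> length (add6 k l) = 6" and length_neg6: "length (neg6 l) = length l"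
  by (simp_all add: add6_def neg6_def)

lemma length_tables: "i \<in> {1..16} \<Longrightarrow> length (be i) = 6" "a \<in> {1..10} \<Longrightarrow> length (ev a) = 6"
proof -
  have "list_all (\<lambda>l. length l = 6) btab" "list_all (\<lambda>l. length l = 6) etab" "length btab = 16" "length etab = 10"
    by code_simp+
  then show "i \<in> {1..16} \<Longrightarrow> length (be i) = 6" "a \<in> {1..10} \<Longrightarrow> length (ev a) = 6"
    by (auto simp: be_def ev_def list_all_length)
qed

lemma length_rt: "a \<in> {1..10} \<Longrightarrow> b \<in> {1..10} \<Longrightarrow> length (rt a b) = 6"
  by (simp add: rt_def add6_def neg6_def length_tables del: atLeastAtMost_iff)

lemma beta_eq: "i \<in> {1..16} \<Longrightarrow> beta i = vector (be i)"
  by (drule range_16) (elim disjE; simp add: beta_def be_def btab_def)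

lemma fst_escale [simp]: "fst (escale a u) $ k = a * fst u $ k"
  and lookup_escale [simp]: "Poly_Mapping.lookup (snd (escale a u)) m = a * Poly_Mapping.lookup (snd u) m"
  by (simp_all add: escale_def lookup_map_zero)

lemma e6_eqI:
  assumes "\<And>k. fst u $ k = fst w $ k" "\<And>m. Poly_Mapping.lookup (snd u) m = Poly_Mapping.lookup (snd w) m"
  shows "u = (w :: e6)"
  using assms by (intro prod_eqI poly_mapping_eqI) (simp_all add: vec_eq_iff)

lemma vector_space_escale: "vector_space escale"
  by unfold_locales (auto intro!: e6_eqI simp: lookup_add algebra_simps)

interpretation e6: vector_space escale
  by (rule vector_space_escale)

lemma snd_escale_Eroot: "snd (escale s (Eroot \<alpha>)) = Poly_Mapping.single \<alpha> s"
  by (rule poly_mapping_eqI) (simp add: Eroot_def lookup_single when_def)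

lemma fst_escale_Eroot: "fst (escale s (Eroot \<alpha>)) = 0"
  by (simp add: vec_eq_iff Eroot_def)

lemma hform_0: "hform 0 \<beta> = 0"
  by (simp add: hform_def)

lemma bracket_Eroot: "bracket (escale s (Eroot \<alpha>)) (escale s' (Eroot \<beta>)) = escale (s * s') (root_bracket \<alpha> \<beta>)"
  unfolding bracket_def fst_escale_Eroot snd_escale_Eroot by (simp add: hform_0)

lemma bracket_Cartan: "bracket (h, 0) (escale s (Eroot \<beta>)) = escale (hform h \<beta> * s) (Eroot \<beta>)"
  unfolding bracket_def snd_escale_Eroot by (simp add: hform_0)

lemma eta_eq: "i \<in> {1..16} \<Longrightarrow> eta i = escale 1 (Eroot (vector (neg6 (be i))))"
  by (simp add: eta_def beta_eq vector_neg6 length_tables del: atLeastAtMost_iff)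

lemma xi_eq: "i \<in> {1..16} \<Longrightarrow> xi i = escale 1 (Eroot (vector (be i)))"
  by (simp add: xi_def beta_eq del: atLeastAtMost_iff)

text \<open>The inequalities reduce the commutator of \<open>Fm a b\<close> and
  \<open>Fm b c\<close> to \<open>Fm a c\<close>. The other conditions make the bracket of the two
  images the signed root vector predicted for (a, c).\<close>

definition step_ok :: "nat \<Rightarrow> nat \<Rightarrow> nat \<Rightarrow> bool" where
  "step_ok a b c \<longleftrightarrow> a \<noteq> c \<and> b \<noteq> prime10 c \<and> b \<noteq> prime10 a \<and> rt a c = add6 (rt a b) (rt b c) \<and>
    form6 (rt a c) (rt a c) = 2 \<and> sg a c = sg a b * sg b c * sign6 (rt a b) (rt b c)"

definition skew_ok :: "nat \<Rightarrow> nat \<Rightarrow> bool" where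
  "skew_ok a b \<longleftrightarrow> rt (prime10 b) (prime10 a) = rt a b \<and> sg (prime10 b) (prime10 a) = - sg a b"

text \<open>A triple \<open>(a, b, c)\<close> stands for the commutator of \<open>Fm a b\<close> and \<open>Fm b c\<close>; each pair is
  accompanied by its image under skew symmetry.\<close>

fun commutators :: "(nat \<times> nat) list \<Rightarrow> (nat \<times> nat \<times> nat) list \<Rightarrow> (nat \<times> nat) list" where
  "commutators K [] = K"
| "commutators K ((a, b, c) # ts) = (if (a, b) \<in> set K \<and> (b, c) \<in> set K \<and> step_ok a b c \<and> skew_ok a c
     then commutators ((a, c) # (prime10 c, prime10 a) # K) ts else [])"

definition simple_pairs :: "(nat \<times> nat) list" where
  "simple_pairs = [(1, 2), (2, 3), (3, 4), (4, 5), (4, 10), (2, 1), (3, 2), (4, 3), (5, 4), (10, 4)]"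

text \<open>Ordered so that each triple uses pairs already reached. The ten generators and thirty
  commutators, with their skew images, account for all 80 pairs.\<close>

definition triples :: "(nat \<times> nat \<times> nat) list" where
  "triples = [(1, 2, 3), (2, 3, 4), (3, 2, 1), (3, 4, 5), (3, 4, 10), (4, 3, 1), (4, 3, 2), (4, 5, 8), (5, 4, 1), (5, 4, 2), (5, 4, 3), (5, 9, 7), (8, 9, 5), (9, 5, 1), (9, 5, 2), (9, 5, 3), (9, 8, 6), (10, 4, 1), (10, 4, 2), (10, 9, 6), (10, 9, 7), (1, 2, 10), (1, 3, 9), (1, 4, 8), (1, 5, 7), (2, 1, 8), (2, 1, 9), (6, 4, 2), (6, 4, 3), (7, 4, 3)]"

lemma of_nat_10_eq: "a \<in> {1..10} \<Longrightarrow> b \<in> {1..10} \<Longrightarrow> (of_nat a = (of_nat b :: 10)) = (a = b)"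
  by (metis idx10_of_nat)

lemma vector_zero6: "(vector [0, 0, 0, 0, 0, 0] :: lattice) = 0"
  by (simp add: vec_eq_iff forall_6 vector_6)

text \<open>Compares the action of the D5 root vectors on the \<open>eta i\<close> with the
  half-spin matrices, including signs; \<open>ev_D1_check\<close> does the same for the
  weights.\<close>

lemma rt_D1_check:
  "list_all (\<lambda>a. list_all (\<lambda>b. a = b \<or> b = prime10 a \<or> list_all (\<lambda>i.
     let k = ct a (ct b i); g = neg6 (add6 (rt a b) (neg6 (be (nat i)))) in
     if k = 0 then g \<notin> set btab
     else be (nat \<bar>k\<bar>) = g \<and> sgn k = sg a b * sign6 (rt a b) (neg6 (be (nat i)))) [1..16]) [1..<11]) [1..<11]"
  by code_simp

lemma ev_D1_check:
  "list_all (\<lambda>a. list_all (\<lambda>i. form6 (ev a) (neg6 (be (nat i))) = (if ct a i = 0 then - 1 else 1)) [1..16]) [1..<11]"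
  by code_simp

definition pairs :: "(nat \<times> nat) list" where
  "pairs = filter (\<lambda>p. fst p \<noteq> snd p \<and> snd p \<noteq> prime10 (fst p)) (List.product [1..<11] [1..<11])"

definition pair_ok :: "int list \<Rightarrow> int \<Rightarrow> (nat \<times> nat) \<times> int \<Rightarrow> bool" where
  "pair_ok g s pk \<longleftrightarrow> rt (snd (fst pk)) (fst (fst pk)) = g \<and> sgn (snd pk) * sg (snd (fst pk)) (fst (fst pk)) = s"

definition pairs_ok :: "bool \<Rightarrow> int list \<Rightarrow> int \<Rightarrow> ((nat \<times> nat) \<times> int) list \<Rightarrow> bool" where
  "pairs_ok b g s L \<longleftrightarrow> (if b then length L = 2 \<and> list_all (pair_ok g s) L else L = [])"

fun row_ok :: "int \<Rightarrow> ((nat \<times> nat) \<times> int) list \<Rightarrow> int list \<Rightarrow> bool" where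
  "row_ok i Ks [] = True"
| "row_ok i Ks (r # rs) \<longleftrightarrow>
     pairs_ok (r \<noteq> i \<and> form6 (add6 (be (nat r)) (neg6 (be (nat i)))) (add6 (be (nat r)) (neg6 (be (nat i)))) = 2)
       (add6 (be (nat r)) (neg6 (be (nat i)))) (sign6 (be (nat r)) (neg6 (be (nat i))))
       (filter (\<lambda>pk. \<bar>snd pk\<bar> = r) Ks)
     \<and> row_ok i Ks rs"

lemma commutators_check:
  "list_all (\<lambda>p. skew_ok (fst p) (snd p)) simple_pairs"
  "list_all (\<lambda>p. p \<in> set (commutators (simple_pairs @ map (\<lambda>p. (prime10 (snd p), prime10 (fst p))) simple_pairs) triples)) pairs"
  by code_simp+

lemma D2_check:
  "list_all (\<lambda>i. row_ok i (filter (\<lambda>pk. snd pk \<noteq> 0) (map (\<lambda>p. (p, ct (fst p) (ct (snd p) i))) pairs)) [1..16]) [1..16]"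
  by code_simp

text \<open>The last list is twice \<open>alhat\<close>. After division by 8 the Cartan part of
  \<open>M i i\<close> becomes -\<beta>_i plus a quarter of \<open>alhat\<close>.\<close>

lemma D2_Cartan_check:
  "list_all (\<lambda>i. foldr add6 (map (\<lambda>a. map ((*) (if ct a i = 0 then - 1 else 1)) (ev a)) [1..<11]) [0, 0, 0, 0, 0, 0]
     = add6 (map ((*) (- 8)) (be (nat i))) [4, 6, 8, 12, 10, 8]) [1..16]"
  by code_simp

lemma be_check: "list_all (\<lambda>l. form6 l l = 2 \<and> l ! 5 = 1) btab" "distinct btab" "length btab = 16"
  by code_simp+

lemma Cartan_check:
  "list_all (\<lambda>a. list_all (\<lambda>b. a = b \<or> b = prime10 a \<or> rt b a = neg6 (rt a b) \<and> sg a b * sg b a = - 1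
     \<and> add6 (rt a b) (rt a (prime10 b)) = ev a \<and> rt a b ! 5 = 0) [1..<11]) [1..<11]"
  by code_simp

section \<open>The values of \<nu> and the brackets between the positive and the negative
  part\<close>

locale nu_iso =
  fixes nu :: "mat10 \<Rightarrow> e6"
  assumes is_nu: "is_nu nu"
begin

lemma bij_nu: "bij_betw nu o10 GD5"
  using is_nu by (simp add: is_nu_def)

lemma inv_nu: "B \<in> o10 \<Longrightarrow> inv_into o10 nu (nu B) = B"
  using bij_nu by (simp add: bij_betw_def)

lemma nu_add: "B \<in> o10 \<Longrightarrow> C \<in> o10 \<Longrightarrow> nu (B + C) = nu B + nu C"
  and nu_scale: "B \<in> o10 \<Longrightarrow> nu (mscale a B) = escale a (nu B)"
  and nu_bracket: "B \<in> o10 \<Longrightarrow> C \<in> o10 \<Longrightarrow> nu (mbracket B C) = bracket (nu B) (nu C)"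
  using is_nu unfolding is_nu_def by blast+

lemma o10_sum: "(\<And>k. k \<in> I \<Longrightarrow> f k \<in> o10) \<Longrightarrow> (\<Sum>k\<in>I. f k) \<in> o10"
  and o10_scale: "B \<in> o10 \<Longrightarrow> mscale a B \<in> o10"
  and o10_0: "0 \<in> o10"
  and o10_add: "B \<in> o10 \<Longrightarrow> C \<in> o10 \<Longrightarrow> B + C \<in> o10"
  unfolding o10_def by (rule mat.span_sum mat.span_scale mat.span_zero mat.span_add; assumption?)+

lemma nu_0: "nu 0 = 0"
  using nu_scale[OF o10_0, of 0] by simp

lemma nu_minus: "B \<in> o10 \<Longrightarrow> nu (- B) = - nu B"
  using nu_scale[of B "-1"] by (simp add: mscale_minus_1)

lemma nu_sum: "(\<And>k. k \<in> I \<Longrightarrow> f k \<in> o10) \<Longrightarrow> nu (\<Sum>k\<in>I. f k) = (\<Sum>k\<in>I. nu (f k))"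
  by (induction I rule: infinite_finite_induct) (simp_all add: nu_0 nu_add o10_sum)

text \<open>Since \<nu> is prescribed only on generators, \<open>N a b\<close> records the pairs at
  which its value has been identified.\<close>

definition N :: "nat \<Rightarrow> nat \<Rightarrow> bool" where
  "N a b \<longleftrightarrow> a \<in> {1..10} \<and> b \<in> {1..10} \<and>
    nu (Fm (of_nat a) (of_nat b)) = escale (of_int (sg a b)) (Eroot (vector (rt a b)))"

lemma N_base: "N 1 2" "N 2 3" "N 3 4" "N 4 5" "N 4 10" "N 2 1" "N 3 2" "N 4 3" "N 5 4" "N 10 4"
proof -
  have a: "axis 1 1 = (vector [1, 0, 0, 0, 0, 0] :: lattice)" "axis 2 1 = (vector [0, 1, 0, 0, 0, 0] :: lattice)"
    "axis 3 1 = (vector [0, 0, 1, 0, 0, 0] :: lattice)" "axis 4 1 = (vector [0, 0, 0, 1, 0, 0] :: lattice)"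
    "axis 5 1 = (vector [0, 0, 0, 0, 1, 0] :: lattice)"
    by (simp_all add: vec_eq_iff forall_6 vector_6 axis_def)
  have F: "Emat 1 2 - Emat 7 6 = Fm (of_nat 1) (of_nat 2)" "Emat 2 3 - Emat 8 7 = Fm (of_nat 2) (of_nat 3)"
    "Emat 3 4 - Emat 9 8 = Fm (of_nat 3) (of_nat 4)" "Emat 4 5 - Emat 10 9 = Fm (of_nat 4) (of_nat 5)"
    "Emat 4 10 - Emat 5 9 = Fm (of_nat 4) (of_nat 10)" "Emat 2 1 - Emat 6 7 = Fm (of_nat 2) (of_nat 1)"
    "Emat 3 2 - Emat 7 8 = Fm (of_nat 3) (of_nat 2)" "Emat 4 3 - Emat 8 9 = Fm (of_nat 4) (of_nat 3)"
    "Emat 5 4 - Emat 9 10 = Fm (of_nat 5) (of_nat 4)" "Emat 10 4 - Emat 9 5 = Fm (of_nat 10) (of_nat 4)"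
    by (subst Fm_eq_Emat; simp add: prime10_def)+
  have r: "rt 1 2 = [1, 0, 0, 0, 0, 0]" "rt 2 3 = [0, 0, 1, 0, 0, 0]" "rt 3 4 = [0, 0, 0, 1, 0, 0]" "rt 4 5 = [0, 0, 0, 0, 1, 0]"
    "rt 4 10 = [0, 1, 0, 0, 0, 0]" "rt 2 1 = neg6 [1, 0, 0, 0, 0, 0]" "rt 3 2 = neg6 [0, 0, 1, 0, 0, 0]"
    "rt 4 3 = neg6 [0, 0, 0, 1, 0, 0]" "rt 5 4 = neg6 [0, 0, 0, 0, 1, 0]" "rt 10 4 = neg6 [0, 1, 0, 0, 0, 0]"
    by code_simp+
  have g: "sg 1 2 = 1" "sg 2 3 = 1" "sg 3 4 = 1" "sg 4 5 = 1" "sg 4 10 = 1" "sg 2 1 = -1" "sg 3 2 = -1" "sg 4 3 = -1"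
    "sg 5 4 = -1" "sg 10 4 = -1"
    by code_simp+
  show "N 1 2" "N 2 3" "N 3 4" "N 4 5" "N 4 10" "N 2 1" "N 3 2" "N 4 3" "N 5 4" "N 10 4"
    using is_nu unfolding is_nu_def F a N_def r g by (simp_all add: vector_neg6)
qed

lemma N_step:
  assumes "N a b" "N b c" "step_ok a b c"
  shows "N a c"
proof -
  have m: "a \<in> {1..10}" "b \<in> {1..10}" "c \<in> {1..10}" using assms by (auto simp: N_def)
  have "Fm (of_nat a) (of_nat c) = mbracket (Fm (of_nat a) (of_nat b)) (Fm (of_nat b) (of_nat c))"
  proof -
    have "(of_nat a :: 10) \<noteq> of_nat c" "(of_nat b :: 10) \<noteq> of_nat c + 5" "(of_nat a :: 10) + 5 \<noteq> of_nat b"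
      using m assms(3) of_nat_10_eq prime10_range unfolding step_ok_def of_nat_prime10[symmetric, OF m(1)]
        of_nat_prime10[symmetric, OF m(3)] by metis+
    then show ?thesis unfolding mbracket_Fm by simp
  qed
  then have "nu (Fm (of_nat a) (of_nat c)) = bracket (nu (Fm (of_nat a) (of_nat b))) (nu (Fm (of_nat b) (of_nat c)))"
    by (simp add: nu_bracket Fm_o10)
  also have "\<dots> = escale (of_int (sg a b) * of_int (sg b c)) (root_bracket (vector (rt a b)) (vector (rt b c)))"
    using assms(1,2) by (simp add: N_def bracket_Eroot)
  also have "root_bracket (vector (rt a b)) (vector (rt b c)) = escale (of_int (sign6 (rt a b) (rt b c))) (Eroot (vector (rt a c)))"
  proof -
    have s: "vector (rt a b) + vector (rt b c) = (vector (rt a c) :: lattice)"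
      using m assms(3) by (simp add: vector_add6 length_rt step_ok_def del: atLeastAtMost_iff)
    have P: "vector (rt a c) \<in> Phi"
    proof -
      have "form6 (rt a c) (rt a c) = 2" using assms(3) unfolding step_ok_def by blast
      then show ?thesis using qform_vector[OF length_rt length_rt, OF m(1,3) m(1,3)] by (simp add: Phi_def)
    qed
    then have "vector (rt a c) \<noteq> (0 :: lattice)" by (auto simp: Phi_def qform_def)
    then show ?thesis using P m unfolding root_bracket_def s
      by (simp add: Fsign_vector length_rt del: atLeastAtMost_iff)
  qed
  finally show ?thesis using m assms(3) by (simp add: N_def step_ok_def del: atLeastAtMost_iff)
qed

lemma N_skew:
  assumes "N a b" "skew_ok a b"
  shows "N (prime10 b) (prime10 a)"
proof -
  have m: "a \<in> {1..10}" "b \<in> {1..10}" using assms by (auto simp: N_def)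
  have "Fm (of_nat (prime10 b)) (of_nat (prime10 a)) = - Fm (of_nat a) (of_nat b)"
    using m by (simp add: of_nat_prime10 Fm_skew del: atLeastAtMost_iff)
  then have "nu (Fm (of_nat (prime10 b)) (of_nat (prime10 a))) = - nu (Fm (of_nat a) (of_nat b))"
    by (simp add: nu_minus Fm_o10)
  then show ?thesis
    using assms m prime10_range unfolding N_def skew_ok_def by simp
qed

lemma N_commutators:
  assumes "\<And>a b. (a, b) \<in> set K \<Longrightarrow> N a b"
  shows "(a, b) \<in> set (commutators K ts) \<Longrightarrow> N a b"
  using assms
proof (induction K ts rule: commutators.induct)
  case (2 K a' b' c' ts)
  show ?case
  proof (cases "(a', b') \<in> set K \<and> (b', c') \<in> set K \<and> step_ok a' b' c' \<and> skew_ok a' c'")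
    case True
    then have "N a' c'" using N_step 2(3) by blast
    then have "N a b" if "(a, b) \<in> set ((a', c') # (prime10 c', prime10 a') # K)" for a b
      using that N_skew True 2(3) by auto
    moreover have "(a, b) \<in> set (commutators ((a', c') # (prime10 c', prime10 a') # K) ts)"
      using 2(2) True by simp
    ultimately show ?thesis using 2(1)[OF True] by blast
  next
    case False
    then show ?thesis using 2(2) by simp
  qed
qed simp

lemma N_all:
  assumes "a \<in> {1..10}" "b \<in> {1..10}" "a \<noteq> b" "b \<noteq> prime10 a"
  shows "N a b"
proof -
  have s: "N a b" if "(a, b) \<in> set simple_pairs" for a b
    using that N_base by (auto simp: simple_pairs_def)
  have "(a, b) \<in> set pairs" using assms by (auto simp: pairs_def)
  then have "(a, b) \<in> set (commutators (simple_pairs @ map (\<lambda>p. (prime10 (snd p), prime10 (fst p))) simple_pairs) triples)"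
    using commutators_check(2) by (simp add: list_all_iff)
  then show ?thesis
  proof (rule N_commutators[rotated])
    fix a b assume "(a, b) \<in> set (simple_pairs @ map (\<lambda>p. (prime10 (snd p), prime10 (fst p))) simple_pairs)"
    then show "N a b" using s N_skew commutators_check(1) by (auto simp: list_all_iff)
  qed
qed

end

definition cartan_elt :: "int list \<Rightarrow> e6" where
  "cartan_elt l = of_root (vector l)"

lemma cartan_elt_eq: "cartan_elt l = ((\<chi> i. of_int (vector l $ i)), 0)"
  by (simp add: cartan_elt_def of_root_def)

lemma of_root_add: "of_root (\<alpha> + \<beta>) = of_root \<alpha> + of_root \<beta>"
  by (simp add: of_root_def vec_eq_iff)

lemma in_list_all: "list_all P xs \<Longrightarrow> y \<in> set xs \<Longrightarrow> P y"
  by (simp add: list_all_iff)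

lemma int_mem_16: "i \<in> {1..16} \<Longrightarrow> int i \<in> set [1..16]"
  by simp

lemma nat_mem_10: "a \<in> {1..10} \<Longrightarrow> a \<in> set [1..<11]"
  by auto

lemma be_props:
  assumes "i \<in> {1..16}"
  shows "form6 (be i) (be i) = 2" "be i ! 5 = 1" "be i \<in> set btab"
proof -
  have "be i \<in> set btab" using assms be_check(3) by (auto simp: be_def)
  then show "form6 (be i) (be i) = 2" "be i ! 5 = 1" "be i \<in> set btab"
    using be_check(1) by (auto simp: list_all_iff)
qed

lemma be_inj: "i \<in> {1..16} \<Longrightarrow> j \<in> {1..16} \<Longrightarrow> be i = be j \<longleftrightarrow> i = j"
  unfolding be_def using be_check(2,3) by (auto simp: nth_eq_iff_index_eq)

lemma neg6_neg6: "neg6 (neg6 l) = l"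
  by (simp add: neg6_def)

lemma phi_root:
  assumes "length g = 6" "i \<in> {1..16}" "j \<in> {1..16}"
  shows "phi (escale s (Eroot (vector g))) i j =
    (if neg6 (add6 g (neg6 (be i))) = be j then s * of_int (sign6 g (neg6 (be i))) else 0)"
proof -
  have l: "length (be i) = 6" "length (neg6 (be i)) = 6" "length (neg6 (be j)) = 6" "length (add6 g (neg6 (be i))) = 6"
    using assms by (simp_all add: length_tables length_neg6 length_add6 del: atLeastAtMost_iff)
  have b: "- beta j = vector (neg6 (be j))"
    using assms(3) by (simp add: beta_eq vector_neg6 length_tables del: atLeastAtMost_iff)
  have br: "bracket (escale s (Eroot (vector g))) (eta i) = escale s (root_bracket (vector g) (vector (neg6 (be i))))"
    by (simp only: eta_eq[OF assms(2)] bracket_Eroot mult_1_right)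
  have sum: "vector g + vector (neg6 (be i)) = (vector (add6 g (neg6 (be i))) :: lattice)"
    using assms(1) l by (simp add: vector_add6)
  have eq: "(vector (add6 g (neg6 (be i))) = - beta j) = (neg6 (add6 g (neg6 (be i))) = be j)"
    unfolding b vector_inj6[OF l(4,3)] by (metis neg6_neg6)
  have P: "- beta j \<in> Phi"
  proof -
    have "qform (vector (neg6 (be j))) (vector (neg6 (be j))) = qform (beta j) (beta j)"
      unfolding b[symmetric] by (simp add: qform_def)
    then show ?thesis unfolding b Phi_def
      using qform_vector[OF length_tables(1) length_tables(1), OF assms(3) assms(3)] be_props(1)[OF assms(3)]
      by (simp add: beta_eq[OF assms(3)])
  qed
  have nz: "- beta j \<noteq> 0" using P by (auto simp: Phi_def qform_def)
  show ?thesis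
  proof (cases "vector (add6 g (neg6 (be i))) = - beta j")
    case True
    then have "phi (escale s (Eroot (vector g))) i j = s * Fsign (vector g) (vector (neg6 (be i)))"
      unfolding phi_def br root_bracket_def sum using P nz by (simp add: Eroot_def)
    then show ?thesis using True assms(1) l unfolding eq by (simp add: Fsign_vector)
  next
    case False
    then have "phi (escale s (Eroot (vector g))) i j = 0"
      unfolding phi_def br root_bracket_def sum
      by (simp add: Eroot_def of_root_def lookup_single when_def)
    then show ?thesis using False unfolding eq by simp
  qed
qed

lemma XS_of_nat:
  assumes "a \<in> {1..10}" "b \<in> {1..10}" "i \<in> {1..16}" "j \<in> {1..16}" "a \<noteq> b"
  shows "XS (of_nat a) (of_nat b) (of_nat i) (of_nat j) =
    (let k = ct a (ct b (int i)) in if k = int j then 1 else if k = - int j then -1 else 0)"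
  using assms by (simp add: XS_def Cm_mult of_nat_10_eq idx10_of_nat idx16_of_nat sv_def del: atLeastAtMost_iff)

lemma XS_self: "XS a (a + 5) i j = 0"
  using XS_skew[of "a + 5" a i j] by simp

context nu_iso
begin

lemma nu_diag_diff:
  assumes "a \<in> {1..10}" "b \<in> {1..10}" "a \<noteq> b" "b \<noteq> prime10 a"
  shows "nu (Fm (of_nat a) (of_nat a)) - nu (Fm (of_nat b) (of_nat b)) = cartan_elt (rt a b)"
proof -
  have c: "rt b a = neg6 (rt a b)" "sg a b * sg b a = - 1"
    using in_list_all[OF in_list_all[OF Cartan_check nat_mem_10[OF assms(1)]] nat_mem_10[OF assms(2)]] assms(3,4) by auto
  have p: "a \<noteq> prime10 b" using assms by (auto simp: prime10_def split: if_splits)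
  have n: "N a b" "N b a" using N_all assms p by auto
  have "(of_nat a :: 10) \<noteq> of_nat b" "(of_nat b :: 10) \<noteq> of_nat a + 5"
    using assms of_nat_10_eq prime10_range unfolding of_nat_prime10[symmetric, OF assms(1)] by metis+
  then have "mbracket (Fm (of_nat a) (of_nat b)) (Fm (of_nat b) (of_nat a)) = Fm (of_nat a) (of_nat a) - Fm (of_nat b) (of_nat b)"
    unfolding mbracket_Fm by (auto simp: add_5_eq_iff)
  then have "nu (Fm (of_nat a) (of_nat a) - Fm (of_nat b) (of_nat b)) =
      bracket (nu (Fm (of_nat a) (of_nat b))) (nu (Fm (of_nat b) (of_nat a)))"
    by (metis nu_bracket Fm_o10)
  also have "\<dots> = escale (of_int (sg a b) * of_int (sg b a)) (root_bracket (vector (rt a b)) (vector (rt b a)))"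
    using n by (simp only: N_def bracket_Eroot)
  also have "root_bracket (vector (rt a b)) (vector (rt b a)) = - of_root (vector (rt a b))"
    unfolding c(1) root_bracket_def vector_neg6[OF length_rt, OF assms(1,2), symmetric] by simp
  also have "complex_of_int (sg a b) * of_int (sg b a) = -1"
    using c(2) by (metis of_int_1 of_int_minus of_int_mult)
  finally have "nu (Fm (of_nat a) (of_nat a) - Fm (of_nat b) (of_nat b)) = cartan_elt (rt a b)"
    by (simp add: cartan_elt_def)
  moreover have "nu (Fm (of_nat a) (of_nat a) - Fm (of_nat b) (of_nat b))
      = nu (Fm (of_nat a) (of_nat a)) - nu (Fm (of_nat b) (of_nat b))"
    using nu_add[of "Fm (of_nat a) (of_nat a)" "- Fm (of_nat b) (of_nat b)"]
    by (simp add: nu_minus Fm_o10) (metis Fm_o10 Fm_skew nu_minus uminus_add_conv_diff add.commute diff_conv_add_uminus)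
  ultimately show ?thesis by simp
qed

text \<open>Adding the differences for b and for its dual removes \<open>Fm b b\<close>, which
  changes sign under duality. Any b other than a and its dual will do.\<close>

lemma nu_diag:
  assumes "a \<in> {1..10}"
  shows "nu (Fm (of_nat a) (of_nat a)) = escale (1/2) (cartan_elt (ev a))"
proof -
  define b :: nat where "b = (if a = 1 \<or> a = 6 then 2 else 1)"
  have b: "b \<in> {1..10}" "a \<noteq> b" "b \<noteq> prime10 a" "prime10 b \<in> {1..10}" "a \<noteq> prime10 b" "prime10 b \<noteq> prime10 a"
    using range_10[OF assms] by (auto simp: b_def prime10_def)
  have e: "add6 (rt a b) (rt a (prime10 b)) = ev a"
    using in_list_all[OF in_list_all[OF Cartan_check nat_mem_10[OF assms(1)]] nat_mem_10[OF b(1)]] b by auto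
  have "nu (Fm (of_nat (prime10 b)) (of_nat (prime10 b))) = - nu (Fm (of_nat b) (of_nat b))"
    unfolding of_nat_prime10[OF b(1)] Fm_skew by (simp add: nu_minus Fm_o10)
  then have "nu (Fm (of_nat a) (of_nat a)) + nu (Fm (of_nat a) (of_nat a)) = cartan_elt (rt a b) + cartan_elt (rt a (prime10 b))"
    using nu_diag_diff[OF assms b(1-3)] nu_diag_diff[OF assms b(4-6)] by (simp add: algebra_simps)
  also have "\<dots> = cartan_elt (ev a)"
    unfolding cartan_elt_def e[symmetric] vector_add6[OF length_rt[OF assms b(1)] length_rt[OF assms b(4)], symmetric]
    by (simp add: of_root_add)
  finally have "escale (1/2) (nu (Fm (of_nat a) (of_nat a)) + nu (Fm (of_nat a) (of_nat a))) = escale (1/2) (cartan_elt (ev a))"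
    by simp
  then show ?thesis
    unfolding e6.scale_right_distrib e6.scale_left_distrib[symmetric] by simp
qed

text \<open>The diagonal case compares weights, in the case of dual indices both sides are 0, and
  root vectors are compared by \<open>rt_D1_check\<close>.\<close>

lemma phi_nu_nat:
  assumes "a \<in> {1..10}" "b \<in> {1..10}" "i \<in> {1..16}" "j \<in> {1..16}"
  shows "phi (nu (Fm (of_nat a) (of_nat b))) i j = XS (of_nat a) (of_nat b) (of_nat i) (of_nat j)"
proof -
  consider "a = b" | "b = prime10 a" | "a \<noteq> b" "b \<noteq> prime10 a" by blast
  then show ?thesis
  proof cases
    case 1
    let ?e = "(\<chi> k. of_int (vector (ev a) $ k)) :: complex ^ 6"
    have n: "nu (Fm (of_nat a) (of_nat a)) = ((1/2) *s ?e, 0)"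
      unfolding nu_diag[OF assms(1)] cartan_elt_eq by (simp add: escale_def) (rule poly_mapping_eqI, simp add: lookup_map_zero)
    have h: "hform ((1/2) *s ?e) (- beta i) = hform ?e (- beta i) / 2"
      by (simp add: hform_def sum_divide_distrib)
    have "hform ?e (- beta i) = of_int (form6 (ev a) (neg6 (be i)))"
      using hform_vector[of "ev a" "neg6 (be i)"] assms
      by (simp add: beta_eq vector_neg6 length_tables length_neg6 del: atLeastAtMost_iff)
    also have "form6 (ev a) (neg6 (be i)) = (if ct a (int i) = 0 then - 1 else 1)"
      using in_list_all[OF in_list_all[OF ev_D1_check nat_mem_10[OF assms(1)]] int_mem_16[OF assms(3)]] by simp
    finally have h2: "hform ((1/2) *s ?e) (- beta i) = of_real (wS (of_nat i) (of_nat a))"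
      unfolding h wS_def using assms by (simp add: idx10_of_nat idx16_of_nat del: atLeastAtMost_iff)
    have "(- beta i = - beta j) = (i = j)"
      using assms(3,4) by (simp add: beta_eq vector_inj6 length_tables be_inj del: atLeastAtMost_iff)
    moreover have "(of_nat i = (of_nat j :: 16)) = (i = j)"
      using assms(3,4) by (metis idx16_of_nat)
    ultimately show ?thesis
      unfolding 1[symmetric] n phi_def eta_eq[OF assms(3)] bracket_Cartan XS_diag
      using h2 assms(3)
      by (simp add: snd_escale_Eroot lookup_single when_def beta_eq[symmetric] vector_neg6[symmetric] length_tables del: atLeastAtMost_iff)
  next
    case 2
    then have "Fm (of_nat a) (of_nat b) = 0" "XS (of_nat a) (of_nat b) (of_nat i) (of_nat j) = 0"
      using of_nat_prime10[OF assms(1)] by (simp_all add: Fm_self XS_self)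
    moreover have "bracket 0 (eta i) = 0"
      using bracket_Eroot[of 0 0 1 "- beta i"] by (simp add: eta_def)
    ultimately show ?thesis by (simp add: nu_0 phi_def)
  next
    case 3
    let ?k = "ct a (ct b (int i))"
    let ?g = "neg6 (add6 (rt a b) (neg6 (be i)))"
    have c: "if ?k = 0 then ?g \<notin> set btab else be (nat \<bar>?k\<bar>) = ?g \<and> sgn ?k = sg a b * sign6 (rt a b) (neg6 (be i))"
    proof -
      have "list_all (\<lambda>i. let k = ct a (ct b i); g = neg6 (add6 (rt a b) (neg6 (be (nat i)))) in
         if k = 0 then g \<notin> set btab
         else be (nat \<bar>k\<bar>) = g \<and> sgn k = sg a b * sign6 (rt a b) (neg6 (be (nat i)))) [1..16]"
        using in_list_all[OF in_list_all[OF rt_D1_check nat_mem_10[OF assms(1)]] nat_mem_10[OF assms(2)]] 3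
        by blast
      from in_list_all[OF this int_mem_16[OF assms(3)]] show ?thesis by (simp only: Let_def nat_int)
    qed
    have p: "phi (nu (Fm (of_nat a) (of_nat b))) i j =
        (if ?g = be j then of_int (sg a b) * of_int (sign6 (rt a b) (neg6 (be i))) else 0)"
      using N_all[OF assms(1,2) 3] phi_root[OF length_rt[OF assms(1,2)] assms(3,4)] by (simp add: N_def)
    show ?thesis
    proof (cases "?k = 0")
      case True
      then have "?g \<noteq> be j" using c be_props(3)[OF assms(4)] by auto
      then show ?thesis unfolding p XS_of_nat[OF assms 3(1)] using True assms(4) by (simp add: Let_def)
    next
      case False
      have "\<bar>ct b (int i)\<bar> \<le> 16"
        using ct_bound[of "of_nat b" "of_nat i"] assms
        by (simp add: idx10_of_nat idx16_of_nat del: atLeastAtMost_iff One_nat_def)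
      then have "\<bar>?k\<bar> \<le> 16"
      proof (cases "ct b (int i)" rule: index_cases)
        case 1
        then show ?thesis by (simp add: ct_0)
      next
        case (2 m)
        then show ?thesis using ct_bound[of "of_nat a" m] assms by (simp add: idx10_of_nat del: atLeastAtMost_iff One_nat_def)
      next
        case (3 m)
        then show ?thesis using ct_bound[of "of_nat a" m] assms by (simp add: idx10_of_nat ct_minus del: atLeastAtMost_iff One_nat_def)
      qed
      then have k: "nat \<bar>?k\<bar> \<in> {1..16}" using False by auto
      have "(?g = be j) = (nat \<bar>?k\<bar> = j)"
        using c False be_inj[OF k assms(4)] by auto
      moreover have "of_int (sg a b) * of_int (sign6 (rt a b) (neg6 (be i))) = (of_int (sgn ?k) :: complex)"
        using c False by simp
      ultimately show ?thesis unfolding p XS_of_nat[OF assms 3(1)] Let_def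
        using False by (auto simp: sgn_if)
    qed
  qed
qed

lemma phi_nu: "phi (nu (Fm a b)) (idx16 i) (idx16 j) = XS a b i j"
  using phi_nu_nat[OF idx10(1) idx10(1) idx16(1) idx16(1), of a b i j] by (simp add: idx10 idx16)

text \<open>The component in o(10) of \<open>bracket (xi r) (eta i)\<close>, by
  \<open>nu_M_off\<close> and \<open>nu_M_diag\<close>. Written in this way, the sum over r in the
  action of \<open>eta i\<close> turns into \<open>Theta\<close>.\<close>

definition M :: "16 \<Rightarrow> 16 \<Rightarrow> mat10" where
  "M r i = mscale (1/2) (\<Sum>a\<in>UNIV. \<Sum>b\<in>UNIV. mscale (XS a b i r) (Fm b a))"

lemma M_o10: "M r i \<in> o10"
  unfolding M_def by (intro o10_scale o10_sum Fm_o10)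

lemma nu_M: "nu (M r i) = escale (1/2) (\<Sum>a\<in>UNIV. \<Sum>b\<in>UNIV. escale (XS a b i r) (nu (Fm b a)))"
  unfolding M_def by (simp add: nu_scale nu_sum o10_sum o10_scale Fm_o10)

lemma nu_M_nat:
  assumes "r \<in> {1..16}" "i \<in> {1..16}"
  shows "nu (M (of_nat r) (of_nat i)) = escale (1/2) ((\<Sum>a\<in>{1..10}. escale (XS (of_nat a) (of_nat a) (of_nat i) (of_nat r)) (nu (Fm (of_nat a) (of_nat a))))
     + (\<Sum>p\<in>set pairs. escale (XS (of_nat (fst p)) (of_nat (snd p)) (of_nat i) (of_nat r)) (nu (Fm (of_nat (snd p)) (of_nat (fst p))))))"
proof -
  let ?f = "\<lambda>a b. escale (XS (of_nat a) (of_nat b) (of_nat i) (of_nat r)) (nu (Fm (of_nat b) (of_nat a)))"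
  have s: "(\<Sum>a\<in>(UNIV::10 set). g a) = (\<Sum>n\<in>{1..10}. g (of_nat n))" for g :: "10 \<Rightarrow> e6"
    using sum_idx10[of "\<lambda>n. g (of_nat n)"] by (simp add: idx10)
  have "nu (M (of_nat r) (of_nat i)) = escale (1/2) (\<Sum>a\<in>{1..10}. \<Sum>b\<in>{1..10}. ?f a b)"
    unfolding nu_M s ..
  also have "(\<Sum>a\<in>{1..10}. \<Sum>b\<in>{1..10}. ?f a b) = (\<Sum>p\<in>{1..10} \<times> {1..10}. ?f (fst p) (snd p))"
    by (simp add: sum.cartesian_product case_prod_beta)
  also have "\<dots> = (\<Sum>p\<in>(\<lambda>a. (a, a)) ` {1..10} \<union> set pairs. ?f (fst p) (snd p))"
  proof (rule sum.mono_neutral_right)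
    show "\<forall>p\<in>{1..10} \<times> {1..10} - ((\<lambda>a. (a, a)) ` {1..10} \<union> set pairs). ?f (fst p) (snd p) = 0"
    proof
      fix p assume p: "p \<in> {1..10} \<times> {1..10} - ((\<lambda>a. (a, a)) ` {1..10} \<union> set pairs)"
      then have "snd p = prime10 (fst p)" "fst p \<in> {1..10}" by (auto simp: pairs_def)
      then show "?f (fst p) (snd p) = 0" using of_nat_prime10[of "fst p"] by (simp add: XS_self)
    qed
  qed (auto simp: pairs_def)
  also have "\<dots> = (\<Sum>p\<in>(\<lambda>a. (a, a)) ` {1..10}. ?f (fst p) (snd p)) + (\<Sum>p\<in>set pairs. ?f (fst p) (snd p))"
    by (rule sum.union_disjoint) (auto simp: pairs_def)
  also have "(\<Sum>p\<in>(\<lambda>a. (a, a)) ` {1..10}. ?f (fst p) (snd p)) = (\<Sum>a\<in>{1..10}. ?f a a)"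
    by (subst sum.reindex) (auto simp: inj_on_def)
  finally show ?thesis .
qed

lemma row_ok_iff: "row_ok i Ks rs \<longleftrightarrow> (\<forall>r\<in>set rs. pairs_ok
    (r \<noteq> i \<and> form6 (add6 (be (nat r)) (neg6 (be (nat i)))) (add6 (be (nat r)) (neg6 (be (nat i)))) = 2)
       (add6 (be (nat r)) (neg6 (be (nat i)))) (sign6 (be (nat r)) (neg6 (be (nat i))))
       (filter (\<lambda>pk. \<bar>snd pk\<bar> = r) Ks))"
  by (induction rs) auto

lemma distinct_pairs: "distinct pairs"
  by (simp add: pairs_def distinct_product)

text \<open>The off-diagonal part of \<open>M r i\<close>: the root \<open>\<beta>\<^sub>r - \<beta>\<^sub>i\<close> of D5 belongs to the two equal terms
  \<open>(a, b)\<close> and \<open>(b', a')\<close>.\<close>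

lemma sum_pairs:
  assumes "r \<in> {1..16}" "i \<in> {1..16}"
  shows "(\<Sum>p\<in>set pairs. escale (XS (of_nat (fst p)) (of_nat (snd p)) (of_nat i) (of_nat r)) (nu (Fm (of_nat (snd p)) (of_nat (fst p)))))
    = (if r \<noteq> i \<and> form6 (add6 (be r) (neg6 (be i))) (add6 (be r) (neg6 (be i))) = 2
       then escale (2 * of_int (sign6 (be r) (neg6 (be i)))) (Eroot (vector (add6 (be r) (neg6 (be i))))) else 0)"
proof -
  let ?k = "\<lambda>p. ct (fst p) (ct (snd p) (int i))"
  let ?f = "\<lambda>p. escale (XS (of_nat (fst p)) (of_nat (snd p)) (of_nat i) (of_nat r)) (nu (Fm (of_nat (snd p)) (of_nat (fst p))))"
  let ?g = "add6 (be r) (neg6 (be i))" and ?s = "sign6 (be r) (neg6 (be i))"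
  let ?L = "filter (\<lambda>p. \<bar>?k p\<bar> = int r) pairs"
  have "pairs_ok (int r \<noteq> int i \<and> form6 ?g ?g = 2) ?g ?s
     (filter (\<lambda>pk. \<bar>snd pk\<bar> = int r) (filter (\<lambda>pk. snd pk \<noteq> 0) (map (\<lambda>p. (p, ?k p)) pairs)))"
    using in_list_all[OF D2_check int_mem_16[OF assms(2)]] int_mem_16[OF assms(1)] unfolding row_ok_iff by fastforce
  also have "filter (\<lambda>pk. \<bar>snd pk\<bar> = int r) (filter (\<lambda>pk. snd pk \<noteq> 0) (map (\<lambda>p. (p, ?k p)) pairs))
      = map (\<lambda>p. (p, ?k p)) ?L"
    using assms(1) by (auto simp: filter_map o_def intro!: arg_cong[of _ _ "map _"] filter_cong)
  finally have ok: "pairs_ok (int r \<noteq> int i \<and> form6 ?g ?g = 2) ?g ?s (map (\<lambda>p. (p, ?k p)) ?L)" .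
  have mem: "fst p \<in> {1..10}" "snd p \<in> {1..10}" "fst p \<noteq> snd p" "snd p \<noteq> prime10 (fst p)" "fst p \<noteq> prime10 (snd p)" if "p \<in> set pairs" for p
    using that by (auto simp: pairs_def prime10_def split: if_splits)
  have XS: "XS (of_nat (fst p)) (of_nat (snd p)) (of_nat i) (of_nat r) = (if \<bar>?k p\<bar> = int r then of_int (sgn (?k p)) else 0)"
    if "p \<in> set pairs" for p
    using mem[OF that] assms by (auto simp: XS_of_nat Let_def sgn_if simp del: atLeastAtMost_iff)
      (auto split: if_splits)
  have "(\<Sum>p\<in>set pairs. ?f p) = (\<Sum>p\<in>set ?L. ?f p)"
    by (rule sum.mono_neutral_right) (auto simp: XS)
  also have "\<dots> = sum_list (map ?f ?L)"
    by (rule sum.distinct_set_conv_list) (simp add: distinct_pairs)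
  also have "\<dots> = (if r \<noteq> i \<and> form6 ?g ?g = 2 then escale (2 * of_int ?s) (Eroot (vector ?g)) else 0)"
  proof (cases "r \<noteq> i \<and> form6 ?g ?g = 2")
    case True
    have val: "?f p = escale (of_int ?s) (Eroot (vector ?g))" if "p \<in> set ?L" for p
    proof -
      have p: "p \<in> set pairs" "\<bar>?k p\<bar> = int r" using that by auto
      have o: "rt (snd p) (fst p) = ?g" "sgn (?k p) * sg (snd p) (fst p) = ?s"
        using ok True that by (auto simp: pairs_ok_def pair_ok_def list_all_iff)
      have "N (snd p) (fst p)" using mem[OF p(1)] by (intro N_all) auto
      then have "?f p = escale (of_int (sgn (?k p)) * of_int (sg (snd p) (fst p))) (Eroot (vector ?g))"
        using XS[OF p(1)] p(2) o(1) by (simp add: N_def)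
      then show ?thesis using o(2) by (metis of_int_mult)
    qed
    have "length ?L = 2" using ok True by (simp add: pairs_ok_def)
    then obtain p q where L: "?L = [p, q]" by (auto simp: length_Suc_conv numeral_eq_Suc)
    then have "sum_list (map ?f ?L) = escale (of_int ?s) (Eroot (vector ?g)) + escale (of_int ?s) (Eroot (vector ?g))"
      using val[of p] val[of q] by simp
    then show ?thesis using True by (simp flip: e6.scale_left_distrib)
  next
    case False
    then have "?L = []" using ok by (auto simp: pairs_ok_def)
    then show ?thesis unfolding if_not_P[OF False] by simp
  qed
  finally show ?thesis .
qed

lemma nu_M_off:
  assumes "r \<in> {1..16}" "i \<in> {1..16}" "r \<noteq> i"
  shows "nu (M (of_nat r) (of_nat i)) = bracket (xi r) (eta i)" "fst (bracket (xi r) (eta i)) = 0"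
proof -
  let ?g = "add6 (be r) (neg6 (be i))"
  have l: "length (be r) = 6" "length (neg6 (be i)) = 6" "length ?g = 6"
    using assms by (simp_all add: length_tables length_neg6 length_add6 del: atLeastAtMost_iff)
  have "XS (of_nat a) (of_nat a) (of_nat i) (of_nat r) = 0" for a
    unfolding XS_diag using assms by (metis idx16_of_nat)
  then have n: "nu (M (of_nat r) (of_nat i)) = (if form6 ?g ?g = 2 then escale (of_int (sign6 (be r) (neg6 (be i)))) (Eroot (vector ?g)) else 0)"
    unfolding nu_M_nat[OF assms(1,2)] sum_pairs[OF assms(1,2)] using assms(3) by simp
  have nz: "vector (be r) + vector (neg6 (be i)) \<noteq> (0 :: lattice)"
  proof
    assume "vector (be r) + vector (neg6 (be i)) = (0 :: lattice)"
    then have "vector (be r) = - (vector (neg6 (be i)) :: lattice)" by (simp only: eq_neg_iff_add_eq_0)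
    also have "\<dots> = vector (be i)" unfolding vector_neg6[OF l(2)] neg6_neg6 ..
    finally have "vector (be r) = (vector (be i) :: lattice)" .
    then show False using assms l length_tables(1)[OF assms(2)] by (simp add: vector_inj6 be_inj del: atLeastAtMost_iff)
  qed
  have "bracket (xi r) (eta i) = root_bracket (vector (be r)) (vector (neg6 (be i)))"
    unfolding xi_eq[OF assms(1)] eta_eq[OF assms(2)] bracket_Eroot by simp
  also have "\<dots> = (if form6 ?g ?g = 2 then escale (of_int (sign6 (be r) (neg6 (be i)))) (Eroot (vector ?g)) else 0)"
    using nz l unfolding root_bracket_def
    by (simp add: vector_add6 Phi_def qform_vector Fsign_vector)
  finally have b: "bracket (xi r) (eta i) = (if form6 ?g ?g = 2 then escale (of_int (sign6 (be r) (neg6 (be i)))) (Eroot (vector ?g)) else 0)" .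
  show "nu (M (of_nat r) (of_nat i)) = bracket (xi r) (eta i)" unfolding n b ..
  show "fst (bracket (xi r) (eta i)) = 0" unfolding b by (simp add: fst_escale_Eroot)
qed

text \<open>The component of the bracket along \<open>alhat\<close> is -1/4. As \<open>alhat\<close>
  acts by 2c, this is the origin of the term -c/2 in \<open>eta_act_T\<close>.\<close>

lemma nu_M_diag:
  assumes "i \<in> {1..16}"
  shows "nu (M (of_nat i) (of_nat i)) = bracket (xi i) (eta i) - escale (- (1/4)) alhat" "fst (bracket (xi i) (eta i)) $ 6 = - 1"
proof -
  let ?c = "\<lambda>a. if ct a (int i) = 0 then - 1 else (1::int)"
  have l: "length (be i) = 6" using assms by (rule length_tables)
  have br: "bracket (xi i) (eta i) = - of_root (vector (be i))"
    unfolding xi_eq[OF assms] eta_eq[OF assms] bracket_Eroot root_bracket_def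
    by (simp add: l flip: vector_neg6)
  have w: "wS (of_nat i) (of_nat a) = of_int (?c a) / 2" if "a \<in> {1..10}" for a
    using that assms by (simp add: wS_def idx10_of_nat idx16_of_nat del: atLeastAtMost_iff)
  have "nu (M (of_nat i) (of_nat i)) = escale (1/2) (\<Sum>a\<in>{1..10}. escale (of_real (wS (of_nat i) (of_nat a))) (escale (1/2) (cartan_elt (ev a))))"
    unfolding nu_M_nat[OF assms assms] sum_pairs[OF assms assms] XS_diag
    by (simp add: nu_diag del: One_nat_def atLeastAtMost_iff cong: sum.cong)
  also have "\<dots> = escale (1/8) (\<Sum>a\<in>{1..10}. escale (of_int (?c a)) (cartan_elt (ev a)))"
    unfolding e6.scale_sum_right by (rule sum.cong) (simp_all add: w)
  also have "(\<Sum>a\<in>{1..10}. escale (of_int (?c a)) (cartan_elt (ev a)))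
      = cartan_elt (foldr add6 (map (\<lambda>a. map ((*) (?c a)) (ev a)) [1..<11]) [0, 0, 0, 0, 0, 0])"
  proof -
    have sc: "escale (of_int n) (cartan_elt k) = cartan_elt (map ((*) n) k)" if len: "length k = 6" for n k
    proof -
      obtain a b c d e f where k: "k = [a, b, c, d, e, f]" using list6[OF len] by blast
      have "\<forall>j. fst (escale (of_int n) (cartan_elt k)) $ j = fst (cartan_elt (map ((*) n) k)) $ j"
        unfolding forall_6 k by (simp add: cartan_elt_eq vector_6)
      then show ?thesis by (intro e6_eqI) (simp_all add: cartan_elt_eq)
    qed
    have "foldr add6 (map (\<lambda>a. map ((*) (?c a)) (ev a)) xs) [0, 0, 0, 0, 0, 0] = l \<longrightarrow>
       length l = 6 \<and> sum_list (map (\<lambda>a. escale (of_int (?c a)) (cartan_elt (ev a))) xs) = cartan_elt l"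
      if "set xs \<subseteq> {1..10}" for xs l
      using that
    proof (induction xs arbitrary: l)
      case Nil
      have "cartan_elt [0, 0, 0, 0, 0, 0] = 0"
        by (simp add: cartan_elt_def vector_zero6 of_root_def vec_eq_iff zero_prod_def)
      then show ?case by auto
    next
      case (Cons a xs)
      let ?l = "foldr add6 (map (\<lambda>a. map ((*) (?c a)) (ev a)) xs) [0, 0, 0, 0, 0, 0]"
      have 1: "length ?l = 6" "sum_list (map (\<lambda>a. escale (of_int (?c a)) (cartan_elt (ev a))) xs) = cartan_elt ?l"
        using Cons by auto
      have 2: "length (ev a) = 6" using Cons.prems by (intro length_tables) auto
      have "cartan_elt (map ((*) (?c a)) (ev a)) + cartan_elt ?l = cartan_elt (add6 (map ((*) (?c a)) (ev a)) ?l)"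
        using 1 2 by (simp add: cartan_elt_def vector_add6[symmetric] of_root_add)
      then show ?case using 1 2 sc[OF 2, of "?c a"] by (auto simp: length_add6)
    qed
    moreover have sub: "set [1..<11] \<subseteq> {1..10::nat}" by auto
    ultimately have "sum_list (map (\<lambda>a. escale (of_int (?c a)) (cartan_elt (ev a))) [1..<11])
        = cartan_elt (foldr add6 (map (\<lambda>a. map ((*) (?c a)) (ev a)) [1..<11]) [0, 0, 0, 0, 0, 0])"
      by blast
    moreover have "sum_list (map (\<lambda>a. escale (of_int (?c a)) (cartan_elt (ev a))) [1..<11])
        = (\<Sum>a\<in>{1..10}. escale (of_int (?c a)) (cartan_elt (ev a)))"
      by (subst sum.distinct_set_conv_list[symmetric]) (auto intro!: sum.cong)
    ultimately show ?thesis by simp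
  qed
  also have "foldr add6 (map (\<lambda>a. map ((*) (?c a)) (ev a)) [1..<11]) [0, 0, 0, 0, 0, 0] = add6 (map ((*) (- 8)) (be i)) [4, 6, 8, 12, 10, 8]"
    using in_list_all[OF D2_Cartan_check int_mem_16[OF assms]] by simp
  finally have n: "nu (M (of_nat i) (of_nat i)) = escale (1/8) (cartan_elt (add6 (map ((*) (- 8)) (be i)) [4, 6, 8, 12, 10, 8]))" .
  obtain a b c d e f where k: "be i = [a, b, c, d, e, f]" using list6[OF l] by blast
  have "f = 1" using be_props(2)[OF assms] k by simp
  then show "fst (bracket (xi i) (eta i)) $ 6 = - 1"
    unfolding br k by (simp add: of_root_def vector_6)
  have "fst (nu (M (of_nat i) (of_nat i))) $ j = fst (bracket (xi i) (eta i) - escale (- (1/4)) alhat) $ j" for j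
  proof -
    have "\<forall>j. fst (nu (M (of_nat i) (of_nat i))) $ j = fst (bracket (xi i) (eta i) - escale (- (1/4)) alhat) $ j"
      unfolding forall_6 n br k by (simp add: cartan_elt_def of_root_def alhat_def add6_def vector_6)
    then show ?thesis by blast
  qed
  then show "nu (M (of_nat i) (of_nat i)) = bracket (xi i) (eta i) - escale (- (1/4)) alhat"
    by (rule e6_eqI) (simp add: n br cartan_elt_def of_root_def alhat_def)
qed

end

section \<open>Weights\<close>

text \<open>Extends the five coordinates to the ten indices by oddness, which is the form of weights
  in \<open>o10_module\<close>.\<close>

definition wfun :: "real ^ 5 \<Rightarrow> 10 \<Rightarrow> real" where
  "wfun \<mu> a = (if a = 1 then \<mu> $ 1 else if a = 2 then \<mu> $ 2 else if a = 3 then \<mu> $ 3 else if a = 4 then \<mu> $ 4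
     else if a = 5 then \<mu> $ 5 else if a = 6 then - \<mu> $ 1 else if a = 7 then - \<mu> $ 2 else if a = 8 then - \<mu> $ 3
     else if a = 9 then - \<mu> $ 4 else - \<mu> $ 5)"

lemma wfun_simps [simp]: "wfun \<mu> 1 = \<mu> $ 1" "wfun \<mu> 2 = \<mu> $ 2" "wfun \<mu> 3 = \<mu> $ 3" "wfun \<mu> 4 = \<mu> $ 4" "wfun \<mu> 5 = \<mu> $ 5"
  "wfun \<mu> 6 = - \<mu> $ 1" "wfun \<mu> 7 = - \<mu> $ 2" "wfun \<mu> 8 = - \<mu> $ 3" "wfun \<mu> 9 = - \<mu> $ 4" "wfun \<mu> 0 = - \<mu> $ 5"
  by (simp_all add: wfun_def)

lemma wfun_odd: "wfun \<mu> (a + 5) = - wfun \<mu> a"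
  using exhaust_10[of a] by (elim disjE) simp_all

lemma wfun_add: "wfun (\<mu> + \<mu>') a = wfun \<mu> a + wfun \<mu>' a"
  using exhaust_10[of a] by (elim disjE) simp_all

lemma odd_eq_wfun:
  assumes "\<And>a. m (a + 5) = - m a" "m 1 = \<mu> $ 1" "m 2 = \<mu> $ 2" "m 3 = \<mu> $ 3" "m 4 = \<mu> $ 4" "m 5 = \<mu> $ 5"
  shows "m a = wfun \<mu> a"
  using exhaust_10[of a] assms(1)[of 1] assms(1)[of 2] assms(1)[of 3] assms(1)[of 4] assms(1)[of 5] assms(2-)
  by (elim disjE) simp_all

lemma UNIV_5: "(UNIV :: 5 set) = {1, 2, 3, 4, 5}"
  by (rule sym, rule card_subset_eq) simp_all

lemma sum_5: "(\<Sum>i\<in>(UNIV::5 set). f i) = f 1 + f 2 + f 3 + f 4 + f 5"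
proof -
  have "(\<Sum>i\<in>(UNIV::5 set). f i) = f 1 + (f 2 + (f 3 + (f 4 + f 5)))"
    unfolding UNIV_5 by simp
  then show ?thesis by (simp only: add.assoc)
qed

lemma forall_5: "(\<forall>i::5. P i) \<longleftrightarrow> P 1 \<and> P 2 \<and> P 3 \<and> P 4 \<and> P 5"
  by (metis UNIV_5 UNIV_I empty_iff insertE)

lemma dominant_iff: "\<mu> \<in> dominant \<longleftrightarrow> 2 * \<mu> $ 1 \<in> \<int> \<and> 2 * \<mu> $ 2 \<in> \<int> \<and> 2 * \<mu> $ 3 \<in> \<int> \<and> 2 * \<mu> $ 4 \<in> \<int> \<and> 2 * \<mu> $ 5 \<in> \<int> \<and>
   \<mu> $ 1 - \<mu> $ 2 \<in> \<nat> \<and> \<mu> $ 2 - \<mu> $ 3 \<in> \<nat> \<and> \<mu> $ 3 - \<mu> $ 4 \<in> \<nat> \<and> \<mu> $ 4 - \<mu> $ 5 \<in> \<nat> \<and> \<mu> $ 4 + \<mu> $ 5 \<in> \<nat>"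
proof -
  have "{1..4::nat} = {1, 2, 3, 4}" by auto
  then show ?thesis by (auto simp: dominant_def forall_5)
qed

lemma dominant_int:
  assumes "\<mu> \<in> dominant"
  shows "wfun \<mu> a - wfun \<mu> b \<in> \<int>"
proof -
  have i: "2 * \<mu> $ 1 \<in> \<int>" "\<mu> $ 1 - \<mu> $ 2 \<in> \<int>" "\<mu> $ 2 - \<mu> $ 3 \<in> \<int>" "\<mu> $ 3 - \<mu> $ 4 \<in> \<int>" "\<mu> $ 4 - \<mu> $ 5 \<in> \<int>"
    using assms by (auto simp: dominant_iff intro: subsetD[OF Nats_subset_Ints])
  have 1: "\<mu> $ 1 - \<mu> $ 3 \<in> \<int>" using Ints_add[OF i(2,3)] by simp
  have 2: "\<mu> $ 1 - \<mu> $ 4 \<in> \<int>" using Ints_add[OF 1 i(4)] by simp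
  have 3: "\<mu> $ 1 - \<mu> $ 5 \<in> \<int>" using Ints_add[OF 2 i(5)] by simp
  have "wfun \<mu> 1 - wfun \<mu> a \<in> \<int>" for a
  proof -
    have n: "\<mu> $ 1 + x \<in> \<int>" if "\<mu> $ 1 - x \<in> \<int>" for x
      using Ints_diff[OF i(1) that] by simp
    show ?thesis
      using exhaust_10[of a] i 1 2 3 n[OF i(2)] n[OF 1] n[OF 2] n[OF 3] by (elim disjE) simp_all
  qed
  from Ints_diff[OF this[of b] this[of a]] show ?thesis by simp
qed

lemma Nats_iff: "(x::real) \<in> \<nat> \<longleftrightarrow> x \<in> \<int> \<and> x \<ge> 0"
  by (auto simp: Nats_altdef2)

lemma dominant_nat:
  assumes "\<mu> \<in> dominant" "pos a < pos b" "b \<noteq> a + 5"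
  shows "wfun \<mu> a - wfun \<mu> b \<in> \<nat>"
proof -
  have "\<mu> $ 1 - \<mu> $ 2 \<ge> 0" "\<mu> $ 2 - \<mu> $ 3 \<ge> 0" "\<mu> $ 3 - \<mu> $ 4 \<ge> 0" "\<mu> $ 4 - \<mu> $ 5 \<ge> 0" "\<mu> $ 4 + \<mu> $ 5 \<ge> 0"
    using assms(1) unfolding dominant_iff Nats_iff by auto
  then have "wfun \<mu> a - wfun \<mu> b \<ge> 0"
    using exhaust_10[of a] exhaust_10[of b] assms(2,3) by (elim disjE) simp_all
  then show ?thesis using dominant_int[OF assms(1)] by (simp add: Nats_iff)
qed

lemma dominantI:
  assumes "\<And>a b. pos a < pos b \<Longrightarrow> b \<noteq> a + 5 \<Longrightarrow> wfun \<mu> a - wfun \<mu> b \<in> \<nat>" "\<And>i. 2 * \<mu> $ i \<in> \<int>"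
  shows "\<mu> \<in> dominant"
  using assms(1)[of 1 2] assms(1)[of 2 3] assms(1)[of 3 4] assms(1)[of 4 5] assms(1)[of 4 10] assms(2)
  unfolding dominant_iff by simp

lemma cas_wfun: "cas (wfun \<mu>) = 2 * ((\<mu> + 2 *\<^sub>R rho) \<bullet> \<mu>)"
proof -
  have "{1..4::nat} = {1, 2, 3, 4}" by auto
  then have r: "rho $ 1 = 4" "rho $ 2 = 3" "rho $ 3 = 2" "rho $ 4 = 1" "rho $ 5 = 0"
    by (simp_all add: rho_def eps_def axis_def)
  show ?thesis unfolding cas_eq[of "wfun \<mu>", OF wfun_odd]
    by (simp add: inner_vec_def sum_5 r power2_eq_square algebra_simps)
qed

definition muU :: "10 \<Rightarrow> real ^ 5" where
  "muU j = (\<chi> k. wU j (if k = 1 then 1 else if k = 2 then 2 else if k = 3 then 3 else if k = 4 then 4 else 5))"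

definition muS :: "16 \<Rightarrow> real ^ 5" where
  "muS i = (\<chi> k. wS i (if k = 1 then 1 else if k = 2 then 2 else if k = 3 then 3 else if k = 4 then 4 else 5))"

lemma wfun_muU: "wfun (muU j) a = wU j a"
proof -
  have "wU j (a + 5) = - wU j a" for a by (auto simp: wU_def add_5_eq_iff)
  then show ?thesis by (intro odd_eq_wfun[symmetric]) (simp_all add: muU_def)
qed

lemma wS_odd: "wS i (a + 5) = - wS i a"
proof -
  have "(of_real (wS i (a + 5)) :: complex) = - of_real (wS i a)"
    using XS_skew[of a a i i] unfolding XS_diag by simp
  then have "(of_real (wS i (a + 5)) :: complex) = of_real (- wS i a)" by simp
  then show ?thesis unfolding of_real_eq_iff .
qed

lemma wfun_muS: "wfun (muS i) a = wS i a"
  by (intro odd_eq_wfun[symmetric] wS_odd) (simp_all add: muS_def)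

lemma range_muU: "range muU = range eps \<union> range (\<lambda>i. - eps i)"
proof -
  have u: "muU 1 = eps 1" "muU 2 = eps 2" "muU 3 = eps 3" "muU 4 = eps 4" "muU 5 = eps 5"
    "muU 6 = - eps 1" "muU 7 = - eps 2" "muU 8 = - eps 3" "muU 9 = - eps 4" "muU 0 = - eps 5"
    by (simp_all add: vec_eq_iff forall_5 muU_def wU_def eps_def axis_def)
  have "range muU = {muU 1, muU 2, muU 3, muU 4, muU 5, muU 6, muU 7, muU 8, muU 9, muU 0}"
    unfolding UNIV_10 by auto
  then show ?thesis unfolding u UNIV_5 by auto
qed

lemma odd_weight_check:
  "list_all (\<lambda>i. odd (length (filter (\<lambda>a. ct a i = 0) [1..<6]))) [1..16]"
  by code_simp

lemma muS_Pi: "muS i \<in> Pi_A1"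
proof -
  let ?k = "\<lambda>j::5. if muS i $ j = 1 / 2 then 0 else 1 :: nat"
  have pm: "wS i a = 1/2 \<or> wS i a = - (1/2)" for a by (auto simp: wS_def)
  have g: "x = 1/2 \<or> x = - (1/2) \<Longrightarrow> x = (-1) ^ (if x = 1/2 then 0 else 1 :: nat) / 2" for x :: real by auto
  have k: "muS i = (1/2) *\<^sub>R (\<Sum>j\<in>UNIV. (-1) ^ ?k j *\<^sub>R eps j)"
  proof -
    have "((1/2) *\<^sub>R (\<Sum>j\<in>UNIV. (-1) ^ ?k j *\<^sub>R eps j)) $ j = (-1) ^ ?k j / 2" for j
      by (simp add: eps_def axis_def if_distrib[of "\<lambda>x. _ * x"] cong: if_cong)
    moreover have "muS i $ j = (-1) ^ ?k j / 2" for j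
      unfolding muS_def vec_lambda_beta by (rule g[OF pm])
    ultimately show ?thesis by (simp add: vec_eq_iff)
  qed
  have i: "idx10 1 = 1" "idx10 2 = 2" "idx10 3 = 3" "idx10 4 = 4" "idx10 5 = 5"
    using idx10_of_nat[of 1] idx10_of_nat[of 2] idx10_of_nat[of 3] idx10_of_nat[of 4] idx10_of_nat[of 5] by simp_all
  have "odd (length (filter (\<lambda>a. ct a (int (idx16 i)) = 0) [1..<6]))"
    using in_list_all[OF odd_weight_check int_mem_16[OF idx16(1)[of i]]] .
  moreover have "[1..<6] = [1, 2, 3, 4, 5::nat]" by (simp add: upt_rec)
  moreover have "length (filter (\<lambda>a. ct a (int (idx16 i)) = 0) [1, 2, 3, 4, 5]) = (\<Sum>j\<in>UNIV. ?k j)"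
    by (simp add: sum_5 muS_def wS_def i)
  ultimately have "odd (\<Sum>j\<in>UNIV. ?k j)" by metis
  then show ?thesis unfolding Pi_A1_def using k by (intro CollectI exI[of _ ?k]) auto
qed

lemma Pi_A1_finite: "finite Pi_A1"
proof -
  have "Pi_A1 \<subseteq> (\<lambda>k. (1/2) *\<^sub>R (\<Sum>i\<in>UNIV. (-1) ^ k i *\<^sub>R eps i)) ` (UNIV \<rightarrow>\<^sub>E {0, 1::nat})"
    unfolding Pi_A1_def by (auto simp: PiE_def)
  moreover have "finite (UNIV \<rightarrow>\<^sub>E {0, 1::nat} :: (5 \<Rightarrow> nat) set)" by (intro finite_PiE) auto
  ultimately show ?thesis by (meson finite_imageI finite_subset)
qed

text \<open>Both weights have an odd number of minus signs, so their difference has integral entries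
  with even sum. Its pairing with a half-integral \<lambda> is therefore still an integer.\<close>

lemma Pi_A1_diff:
  assumes "\<mu> \<in> Pi_A1" "\<mu>' \<in> Pi_A1" "lam \<in> dominant"
  shows "lam \<bullet> (\<mu> - \<mu>') \<in> \<int>" "\<mu> \<bullet> \<mu> = 5/4" "\<mu> $ k - \<mu>' $ k \<in> \<int>" "2 * \<mu> $ k \<in> \<int>"
proof -
  have *: "\<exists>k. (\<forall>i. k i \<in> {0, 1::nat} \<and> \<mu> $ i = (-1) ^ k i / 2) \<and> odd (\<Sum>i\<in>UNIV. k i)" if mu: "\<mu> \<in> Pi_A1" for \<mu>
  proof -
    obtain k where k: "\<mu> = (1/2) *\<^sub>R (\<Sum>i\<in>UNIV. (-1) ^ k i *\<^sub>R eps i)" "\<forall>i. k i \<in> {0, 1::nat}" "odd (\<Sum>i\<in>UNIV. k i)"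
      using mu unfolding Pi_A1_def by blast
    have "\<mu> $ i = (-1) ^ k i / 2" for i
      unfolding k(1) by (simp add: eps_def axis_def if_distrib[of "\<lambda>x. _ * x"] cong: if_cong)
    then show ?thesis using k by blast
  qed
  obtain k where k: "\<And>i. k i \<in> {0, 1::nat}" "\<And>i. \<mu> $ i = (-1) ^ k i / 2" "odd (\<Sum>i\<in>UNIV. k i)"
    using *[OF assms(1)] by blast
  obtain k' where k': "\<And>i. k' i \<in> {0, 1::nat}" "\<And>i. \<mu>' $ i = (-1) ^ k' i / 2" "odd (\<Sum>i\<in>UNIV. k' i)"
    using *[OF assms(2)] by blast
  have e: "(-1) ^ n / 2 = (1/2 - real n)" if "n \<in> {0, 1}" for n using that by auto
  have d: "\<mu> $ i - \<mu>' $ i = of_int (int (k' i) - int (k i))" for i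
    using e[OF k(1)[of i]] e[OF k'(1)[of i]] by (simp add: k(2) k'(2) field_simps)
  then show "\<mu> $ k - \<mu>' $ k \<in> \<int>" for k by (metis Ints_of_int)
  show "2 * \<mu> $ k \<in> \<int>" for k unfolding k(2) by simp
  have s: "(\<mu> $ i) * (\<mu> $ i) = 1/4" for i using k(1)[of i] by (auto simp: k(2))
  show "\<mu> \<bullet> \<mu> = 5/4" by (simp add: inner_vec_def sum_5 s)
  have "even ((\<Sum>i\<in>UNIV. int (k' i)) - (\<Sum>i\<in>UNIV. int (k i)))"
    using k(3) k'(3) by (simp flip: of_nat_sum)
  then obtain z where z: "(\<Sum>i\<in>UNIV. int (k' i)) - (\<Sum>i\<in>UNIV. int (k i)) = 2 * z" by (elim evenE)
  have "(\<Sum>i\<in>UNIV. \<mu> $ i - \<mu>' $ i) = of_int ((\<Sum>i\<in>UNIV. int (k' i)) - (\<Sum>i\<in>UNIV. int (k i)))"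
    unfolding d by (simp add: sum_subtractf)
  then have sd: "(\<Sum>i\<in>UNIV. \<mu> $ i - \<mu>' $ i) = 2 * of_int z" unfolding z by simp
  have "lam \<bullet> (\<mu> - \<mu>') = (\<Sum>i\<in>UNIV. (lam $ i - lam $ 1) * (\<mu> $ i - \<mu>' $ i)) + lam $ 1 * (\<Sum>i\<in>UNIV. \<mu> $ i - \<mu>' $ i)"
    by (simp add: inner_vec_def sum_5 algebra_simps)
  also have "\<dots> = (\<Sum>i\<in>UNIV. (lam $ i - lam $ 1) * (\<mu> $ i - \<mu>' $ i)) + of_int z * (2 * lam $ 1)"
    unfolding sd by simp
  also have "\<dots> \<in> \<int>"
  proof (rule Ints_add)
    have "\<forall>i. lam $ i - lam $ 1 \<in> \<int>"
      using dominant_int[OF assms(3), of 1 1] dominant_int[OF assms(3), of 2 1] dominant_int[OF assms(3), of 3 1]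
        dominant_int[OF assms(3), of 4 1] dominant_int[OF assms(3), of 5 1] by (simp add: forall_5)
    moreover have "\<mu> $ i - \<mu>' $ i \<in> \<int>" for i using d by (metis Ints_of_int)
    ultimately show "(\<Sum>i\<in>UNIV. (lam $ i - lam $ 1) * (\<mu> $ i - \<mu>' $ i)) \<in> \<int>"
      by (intro Ints_sum Ints_mult) auto
    have "2 * lam $ 1 \<in> \<int>" using assms(3) by (simp add: dominant_iff)
    then show "of_int z * (2 * lam $ 1) \<in> \<int>" by (rule Ints_mult[OF Ints_of_int])
  qed
  finally show "lam \<bullet> (\<mu> - \<mu>') \<in> \<int>" .
qed

definition evS :: "real ^ 5 \<Rightarrow> real ^ 5 \<Rightarrow> real" where
  "evS lam lam' = (1/2) * ((lam' + 2 *\<^sub>R rho) \<bullet> lam' - (lam + 2 *\<^sub>R rho) \<bullet> lam - (lambda4 + 2 *\<^sub>R rho) \<bullet> lambda4)"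

lemma evS_cas: "evS lam lam' = (cas (wfun lam') - 45/2 - cas (wfun lam)) / 4"
proof -
  have "{1..4::nat} = {1, 2, 3, 4}" by auto
  then have r: "rho $ 1 = 4" "rho $ 2 = 3" "rho $ 3 = 2" "rho $ 4 = 1" "rho $ 5 = 0"
    by (simp_all add: rho_def eps_def axis_def)
  have "(lambda4 + 2 *\<^sub>R rho) \<bullet> lambda4 = 45/4"
    by (simp add: inner_vec_def sum_5 r lambda4_def eps_def axis_def)
  then show ?thesis unfolding evS_def cas_wfun by simp
qed

text \<open>All weights in \<open>Pi_A1\<close> have square length 5/4, so two values of
  \<open>evS\<close> differ by the pairing of \<lambda> + \<rho> with a difference of such
  weights.\<close>

lemma evS_ge_ell:
  assumes "lam \<in> dominant" "lam' \<in> Upsilon lam"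
  shows "evS lam lam' - ell lam \<in> \<nat>"
proof -
  have fin: "finite (Upsilon lam)"
  proof -
    have "Upsilon lam \<subseteq> (\<lambda>\<mu>. lam + \<mu>) ` Pi_A1" by (auto simp: Upsilon_def)
    then show ?thesis using Pi_A1_finite by (meson finite_imageI finite_subset)
  qed
  have ell: "ell lam = Min (evS lam ` Upsilon lam)" by (simp add: ell_def evS_def[abs_def])
  have "ell lam \<in> evS lam ` Upsilon lam" unfolding ell using fin assms(2) by (intro Min_in) auto
  then obtain lam'' where l: "lam'' \<in> Upsilon lam" "ell lam = evS lam lam''" by blast
  obtain \<mu> where m: "\<mu> \<in> Pi_A1" "lam' = lam + \<mu>" using assms(2) by (auto simp: Upsilon_def)
  obtain \<mu>' where m': "\<mu>' \<in> Pi_A1" "lam'' = lam + \<mu>'" using l by (auto simp: Upsilon_def)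
  have "evS lam lam' - evS lam lam'' = lam \<bullet> (\<mu> - \<mu>') + rho \<bullet> (\<mu> - \<mu>') + (\<mu> \<bullet> \<mu> - \<mu>' \<bullet> \<mu>') / 2"
    unfolding evS_def m m' by (simp add: inner_add inner_diff inner_commute algebra_simps add_divide_distrib diff_divide_distrib)
  also have "\<dots> = lam \<bullet> (\<mu> - \<mu>') + rho \<bullet> (\<mu> - \<mu>')"
    using Pi_A1_diff(2)[OF m(1) m'(1) assms(1)] Pi_A1_diff(2)[OF m'(1) m(1) assms(1)] by simp
  also have "\<dots> \<in> \<int>"
  proof (rule Ints_add)
    show "lam \<bullet> (\<mu> - \<mu>') \<in> \<int>" by (rule Pi_A1_diff[OF m(1) m'(1) assms(1)])
    have "{1..4::nat} = {1, 2, 3, 4}" by auto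
    then have "rho $ i \<in> \<int>" for i by (simp add: rho_def eps_def axis_def)
    then show "rho \<bullet> (\<mu> - \<mu>') \<in> \<int>"
      unfolding inner_vec_def using Pi_A1_diff(3)[OF m(1) m'(1) assms(1)] by (auto intro!: Ints_sum Ints_mult)
  qed
  finally have "evS lam lam' - ell lam \<in> \<int>" using l(2) by simp
  moreover have "ell lam \<le> evS lam lam'" unfolding ell using fin assms(2) by (intro Min_le) auto
  ultimately show ?thesis by (simp add: Nats_iff)
qed

section \<open>The module of polynomials with coefficients in V\<close>

lemma lookup_cpoly_mult: "Poly_Mapping.lookup (cpoly a * f) m = a * Poly_Mapping.lookup f m"
proof (induction f rule: poly_mapping_induct)
  case (single n b)
  then show ?case by (simp add: cpoly_def mult_single lookup_single when_def)
next
  case (add f g)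
  then show ?case by (simp add: distrib_left lookup_add)
qed

lemma Pop_add: "Pop i (f + g) = Pop i f + Pop i g"
  by (simp add: Pop_def Dop_def pd_add distrib_left sum.distrib algebra_simps)

lemma Pop_cpoly_mult: "Pop i (cpoly a * f) = cpoly a * Pop i f"
  unfolding Pop_def Dop_def pd_cpoly_mult by (simp add: sum_distrib_left algebra_simps)

lemma on_A_add: "on_A u (f + g) = on_A u f + on_A u g"
  by (simp add: on_A_def pd_add distrib_left sum.distrib)

lemma on_A_cpoly_mult: "on_A u (cpoly a * f) = cpoly a * on_A u f"
  unfolding on_A_def pd_cpoly_mult by (simp add: sum_distrib_left mult_ac)

lemma singular_vector_iff:
  "singular_vector smul act \<mu> w \<longleftrightarrow> w \<noteq> 0 \<and> (\<forall>i\<in>{1..5::nat}. act (Fm (of_nat i) (of_nat i)) w = smul (of_real (\<mu> $ of_nat i)) w)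
     \<and> (\<forall>i j. 1 \<le> i \<and> i < j \<and> j \<le> (5::nat) \<longrightarrow> act (Fm (of_nat i) (of_nat j)) w = 0 \<and> act (Fm (of_nat i) (of_nat j + 5)) w = 0)"
proof -
  have 1: "Emat i i - Emat (5 + i) (5 + i) = Fm (of_nat i) (of_nat i)" if "i \<in> {1..5}" for i
    using that Fm_eq_Emat[of i i] by (simp add: prime10_def add.commute)
  have 2: "Emat i j - Emat (5 + j) (5 + i) = Fm (of_nat i) (of_nat j)"
    "Emat i (5 + j) - Emat j (5 + i) = Fm (of_nat i) (of_nat j + 5)" if "1 \<le> i" "i < j" "j \<le> 5" for i j
    using that Fm_eq_Emat[of i j] Fm_eq_Emat[of i "5 + j"] by (simp_all add: prime10_def add.commute)
  have P: "pos_root_vectors = {Fm (of_nat i) (of_nat j) | i j. 1 \<le> i \<and> i < j \<and> j \<le> (5::nat)}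
      \<union> {Fm (of_nat i) (of_nat j + 5) | i j. 1 \<le> i \<and> i < j \<and> j \<le> (5::nat)}"
    unfolding pos_root_vectors_def using 2 by (intro arg_cong2[of _ _ _ _ "(\<union>)"] Collect_cong) metis+
  have "(\<forall>B\<in>pos_root_vectors. act B w = 0) \<longleftrightarrow> (\<forall>i j. 1 \<le> i \<and> i < j \<and> j \<le> (5::nat) \<longrightarrow>
      act (Fm (of_nat i) (of_nat j)) w = 0 \<and> act (Fm (of_nat i) (of_nat j + 5)) w = 0)"
    unfolding P by blast
  then show ?thesis unfolding singular_vector_def using 1 by simp
qed

text \<open>The raising operators not listed, and the diagonal operators with index above 5, are
  negatives of listed ones by \<open>skew\<close>, or 0.\<close>

lemma (in o10_module) sing_iff:
  "sing (wfun \<mu>) w \<longleftrightarrow> w \<noteq> 0 \<and> (\<forall>i\<in>{1..5::nat}. F (of_nat i) (of_nat i) w = sc (of_real (\<mu> $ of_nat i)) w)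
     \<and> (\<forall>i j. 1 \<le> i \<and> i < j \<and> j \<le> (5::nat) \<longrightarrow> F (of_nat i) (of_nat j) w = 0 \<and> F (of_nat i) (of_nat j + 5) w = 0)"
  (is "_ \<longleftrightarrow> _ \<and> ?h \<and> ?e")
proof -
  have n5: "{1..5::nat} = {1, 2, 3, 4, 5}" by auto
  have z: "F a b w = 0 \<longleftrightarrow> F (b + 5) (a + 5) w = 0" for a b by (simp add: skew)
  have "?h \<longleftrightarrow> wvec (wfun \<mu>) w"
  proof
    assume h: ?h
    have "F a a w = sc (of_real (wfun \<mu> a)) w" for a
      using exhaust_10[of a] h skew[of 1 1 w] skew[of 2 2 w] skew[of 3 3 w] skew[of 4 4 w] skew[of 5 5 w]
      unfolding n5 by (elim disjE) simp_all
    then show "wvec (wfun \<mu>) w" by (simp add: wvec_def)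
  next
    assume "wvec (wfun \<mu>) w"
    then show ?h unfolding n5 by (simp add: wvec_def)
  qed
  moreover have "?e \<longleftrightarrow> (\<forall>a b. pos a < pos b \<longrightarrow> F a b w = 0)"
  proof
    assume e: ?e
    have e': "F 1 2 w = 0" "F 1 3 w = 0" "F 1 4 w = 0" "F 1 5 w = 0" "F 2 3 w = 0" "F 2 4 w = 0" "F 2 5 w = 0"
      "F 3 4 w = 0" "F 3 5 w = 0" "F 4 5 w = 0" "F 1 7 w = 0" "F 1 8 w = 0" "F 1 9 w = 0" "F 1 0 w = 0"
      "F 2 8 w = 0" "F 2 9 w = 0" "F 2 0 w = 0" "F 3 9 w = 0" "F 3 0 w = 0" "F 4 0 w = 0"
      using e[rule_format, of 1 2] e[rule_format, of 1 3] e[rule_format, of 1 4] e[rule_format, of 1 5]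
        e[rule_format, of 2 3] e[rule_format, of 2 4] e[rule_format, of 2 5] e[rule_format, of 3 4]
        e[rule_format, of 3 5] e[rule_format, of 4 5] by simp_all
    have "F a b w = 0" if "pos a < pos b" for a b
      using exhaust_10[of a] exhaust_10[of b] that e' e'[unfolded z[of 1] z[of 2] z[of 3] z[of 4]]
        F_self[of 1 w] F_self[of 2 w] F_self[of 3 w] F_self[of 4 w] F_self[of 5 w]
      by (elim disjE) simp_all
    then show "\<forall>a b. pos a < pos b \<longrightarrow> F a b w = 0" by blast
  next
    assume e: "\<forall>a b. pos a < pos b \<longrightarrow> F a b w = 0"
    show ?e
    proof (intro allI impI)
      fix i j :: nat assume ij: "1 \<le> i \<and> i < j \<and> j \<le> 5"
      then have "i = 1 \<or> i = 2 \<or> i = 3 \<or> i = 4" "j = 2 \<or> j = 3 \<or> j = 4 \<or> j = 5" by auto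
      then have "pos (of_nat i) < pos (of_nat j)" "pos (of_nat i) < pos (of_nat j + 5)"
        using ij by (auto simp: pos_add_5)
      then show "F (of_nat i) (of_nat j) w = 0 \<and> F (of_nat i) (of_nat j + 5) w = 0" using e by blast
    qed
  qed
  ultimately show ?thesis unfolding sing_def by blast
qed

locale hat_module = nu_iso nu
  for nu :: "mat10 \<Rightarrow> e6" +
  fixes sc :: "complex \<Rightarrow> 'v::ab_group_add \<Rightarrow> 'v" and act :: "mat10 \<Rightarrow> 'v \<Rightarrow> 'v" and lam :: "real ^ 5" and c :: complex
  assumes lam: "lam \<in> dominant"
    and hw: "is_irreducible_highest_weight_module sc act lam"
begin

lemma lie: "lie_module o10 mscale mbracket sc act"
  and fd: "finite_dimensional sc"
  and irr: "irreducible_module o10 sc act"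
  and ex_sing: "\<exists>v. singular_vector sc act lam v"
  using hw by (simp_all add: is_irreducible_highest_weight_module_def)

sublocale V: vector_space sc
  using lie by (simp add: lie_module_def)

lemma act_add_right: "B \<in> o10 \<Longrightarrow> act B (v + w) = act B v + act B w"
  and act_sc: "B \<in> o10 \<Longrightarrow> act B (sc a v) = sc a (act B v)"
  using lie unfolding lie_module_def Vector_Spaces.linear_iff by blast+

lemma act_add: "B \<in> o10 \<Longrightarrow> C \<in> o10 \<Longrightarrow> act (B + C) v = act B v + act C v"
  and act_scale: "B \<in> o10 \<Longrightarrow> act (mscale a B) v = sc a (act B v)"
  and act_bracket: "B \<in> o10 \<Longrightarrow> C \<in> o10 \<Longrightarrow> act (mbracket B C) v = act B (act C v) - act C (act B v)"
  using lie unfolding lie_module_def by blast+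

lemma act_0: "act 0 v = 0"
  using act_scale[OF o10_0, of 0 v] by simp

lemma act_minus: "B \<in> o10 \<Longrightarrow> act (- B) v = - act B v"
  using act_scale[of B "-1" v] by (simp add: mscale_minus_1)

lemma act_sum: "(\<And>k. k \<in> I \<Longrightarrow> f k \<in> o10) \<Longrightarrow> act (\<Sum>k\<in>I. f k) v = (\<Sum>k\<in>I. act (f k) v)"
  by (induction I rule: infinite_finite_induct) (simp_all add: act_0 act_add o10_sum)

definition F :: "10 \<Rightarrow> 10 \<Rightarrow> 'v \<Rightarrow> 'v" where
  "F a b = act (Fm a b)"

definition v0 :: 'v where
  "v0 = (SOME v. singular_vector sc act lam v)"

sublocale V: o10_module sc F
proof
  fix a b c d v w x
  show "F a b (v + w) = F a b v + F a b w" "F a b (sc x v) = sc x (F a b v)"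
    by (simp_all add: F_def act_add_right act_sc Fm_o10)
  show "F (b + 5) (a + 5) v = - F a b v"
    by (simp add: F_def Fm_skew act_minus Fm_o10)
  have i: "(if p then Fm a b else 0) \<in> o10" for p a b by (simp add: Fm_o10 o10_0)
  have d: "act (B - C) v = act B v - act C v" "B - C \<in> o10" if "B \<in> o10" "C \<in> o10" for B C
  proof -
    have m: "- C \<in> o10" using o10_scale[OF that(2), of "-1"] by (simp add: mscale_minus_1)
    show "act (B - C) v = act B v - act C v" using act_add[OF that(1) m] act_minus[OF that(2)] by simp
    show "B - C \<in> o10" using o10_add[OF that(1) m] by simp
  qed
  have "F a b (F c d v) - F c d (F a b v) = act (mbracket (Fm a b) (Fm c d)) v"
    by (simp add: F_def act_bracket Fm_o10)
  also have "\<dots> = act (if b = c then Fm a d else 0) v - act (if a = d then Fm c b else 0) v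
      - act (if b = d + 5 then Fm a (c + 5) else 0) v - act (if a + 5 = c then Fm (b + 5) d else 0) v"
    unfolding mbracket_Fm by (simp only: d i)
  finally show "F a b (F c d v) - F c d (F a b v) = (if b = c then F a d v else 0) - (if a = d then F c b v else 0)
      - (if b = d + 5 then F a (c + 5) v else 0) - (if a + 5 = c then F (b + 5) d v else 0)"
    by (simp add: F_def act_0)
qed

lemma stable_act:
  assumes "V.stable K" "B \<in> o10" "w \<in> K"
  shows "act B w \<in> K"
proof -
  have K: "V.subspace K" using assms(1) by (simp add: V.stable_def)
  have "B \<in> o10 \<and> act B w \<in> K"
    using assms(2) unfolding o10_span
  proof (induction rule: mat.span_induct_alt)
    case base
    then show ?case using K by (simp add: act_0 V.subspace_0 mat.span_zero)
  next
    case (step a A B)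
    then have o: "A \<in> o10" "B \<in> o10" using Fm_o10 by (auto simp: o10_span)
    have "act A w \<in> K" using step(1) assms(1,3) by (auto simp: V.stable_def F_def)
    moreover have "act (mscale a A + B) w = sc a (act A w) + act B w"
      using act_add[OF o10_scale[OF o(1)] o(2)] act_scale[OF o(1)] by simp
    moreover have "mscale a A + B \<in> mat.span (range (\<lambda>(a, b). Fm a b))"
      using o10_add[OF o10_scale[OF o(1)] o(2)] unfolding o10_span .
    ultimately show ?case using step(2) K by (simp add: V.subspace_add V.subspace_scale)
  qed
  then show ?thesis by blast
qed

sublocale V: hw_module sc F "wfun lam" v0
proof
  have "singular_vector sc act lam v0" unfolding v0_def using ex_sing by (rule someI_ex)
  then show "V.sing (wfun lam) v0" unfolding V.sing_iff singular_vector_iff F_def .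
  show "K = {0} \<or> K = UNIV" if "V.stable K" for K
    using irr stable_act[OF that] that unfolding irreducible_module_def V.stable_def by blast
  show "\<exists>B. finite B \<and> V.span B = UNIV" using fd by (simp add: finite_dimensional_def)
qed

sublocale V: natural_tensor sc F "wfun lam" v0
  by unfold_locales (rule wfun_odd)

sublocale V: spinor_tensor sc F "wfun lam" v0
  by unfold_locales (rule wfun_odd)

sublocale H: vector_space "hscale sc"
  by (rule vector_space_hscale) (rule V.vector_space_axioms)

abbreviation T :: "poly16 \<Rightarrow> 'v \<Rightarrow> 'v hat" where
  "T \<equiv> tens sc"

lemma lookup_T [simp]: "Poly_Mapping.lookup (T f v) m = sc (Poly_Mapping.lookup f m) v"
  by (simp add: tens_def lookup_map_zero)

lemma lookup_hscale [simp]: "Poly_Mapping.lookup (hscale sc a w) m = sc a (Poly_Mapping.lookup w m)"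
  by (simp add: hscale_def lookup_map_zero)

lemma T_add_left: "T (f + g) v = T f v + T g v"
  and T_add_right: "T f (v + w) = T f v + T f w"
  and T_sc: "T f (sc a v) = hscale sc a (T f v)"
  and T_0: "T 0 v = 0" "T f 0 = 0"
  and T_minus: "T (- f) v = - T f v"
  by (auto intro!: poly_mapping_eqI simp: lookup_add V.scale_left_distrib V.scale_right_distrib mult.commute)

lemma T_cpoly: "T (cpoly a * f) v = hscale sc a (T f v)"
  by (rule poly_mapping_eqI) (simp add: lookup_cpoly_mult)

lemma T_diff_left: "T (f - g) v = T f v - T g v"
  using T_add_left[of f "- g" v] by (simp add: T_minus)

lemma T_sum_left: "T (\<Sum>k\<in>I. f k) v = (\<Sum>k\<in>I. T (f k) v)"
  by (induction I rule: infinite_finite_induct) (simp_all add: T_0 T_add_left)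

lemma T_sum_right: "T f (\<Sum>k\<in>I. v k) = (\<Sum>k\<in>I. T f (v k))"
  by (induction I rule: infinite_finite_induct) (simp_all add: T_0 T_add_right)

lemma T_decomposition: "w = (\<Sum>m\<in>Poly_Mapping.keys w. T (Poly_Mapping.single m 1) (Poly_Mapping.lookup w m))"
  by (rule poly_mapping_eqI) (simp add: lookup_sum lookup_single when_def in_keys_iff
      if_distrib[of "\<lambda>x. sc x _"] cong: if_cong)

lemma tlift_T:
  assumes "\<And>f g v. b (f + g) v = b f v + b g v" "\<And>a f v. b (cpoly a * f) v = hscale sc a (b f v)"
    "\<And>f v w. b f (v + w) = b f v + b f w" "\<And>a f v. b f (sc a v) = hscale sc a (b f v)"
  shows "tlift b (T f v) = b f v"
  by (rule tlift_tens[OF V.vector_space_axioms H.vector_space_axioms]) (rule assms)+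

lemma tlift_add:
  assumes "\<And>f v w. b f (v + w) = b f v + (b f w :: 'v hat)"
  shows "tlift b (u + w) = tlift b u + tlift b w"
proof -
  let ?S = "Poly_Mapping.keys u \<union> Poly_Mapping.keys w"
  have b0: "b f 0 = 0" for f using assms[of f 0 0] by simp
  have S: "tlift b x = (\<Sum>m\<in>?S. b (Poly_Mapping.single m 1) (Poly_Mapping.lookup x m))"
    if "Poly_Mapping.keys x \<subseteq> ?S" for x
    unfolding tlift_def using that by (intro sum.mono_neutral_left) (auto simp: in_keys_iff b0)
  show ?thesis
    by (simp add: S Poly_Mapping.keys_add lookup_add assms sum.distrib)
qed

lemma xi_act_T: "xi_act sc i (T f v) = T (pd i f) v"
  unfolding xi_act_def by (rule tlift_T) (simp_all add: pd_add pd_cpoly_mult T_add_left T_add_right T_cpoly T_sc)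

lemma xi_act_add: "xi_act sc i (u + w) = xi_act sc i u + xi_act sc i w"
  unfolding xi_act_def by (rule tlift_add) (simp add: T_add_right)

lemma xi_act_sum: "xi_act sc i (\<Sum>k\<in>I. f k) = (\<Sum>k\<in>I. xi_act sc i (f k))"
proof (induction I rule: infinite_finite_induct)
  have "xi_act sc i 0 = 0" using xi_act_add[of i 0 0] by simp
  then show "infinite A \<Longrightarrow> xi_act sc i (sum f A) = (\<Sum>k\<in>A. xi_act sc i (f k))" for A by simp
  show "xi_act sc i (sum f {}) = (\<Sum>k\<in>{}. xi_act sc i (f k))" using \<open>xi_act sc i 0 = 0\<close> by simp
qed (simp add: xi_act_add)

lemma act_M: "act (M r i) v = sc (1/2) (\<Sum>a\<in>UNIV. \<Sum>b\<in>UNIV. sc (XS a b i r) (F b a v))"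
  unfolding M_def by (simp add: act_scale act_sum o10_sum o10_scale Fm_o10 F_def)

lemma rho_root: "rho_c nu sc act c (bracket (xi (idx16 r)) (eta (idx16 i))) v
    = act (M r i) v - sc (if r = i then c / 2 else 0) v"
proof (cases "r = i")
  case True
  have "bracket (xi (idx16 i)) (eta (idx16 i)) - escale (- (1/4)) alhat = nu (M i i)"
    using nu_M_diag(1)[OF idx16(1)[of i]] by (simp add: idx16)
  then show ?thesis using nu_M_diag(2)[OF idx16(1)[of i]] True
    by (simp add: rho_c_def Let_def inv_nu M_o10 del: e6.scale_minus_left)
next
  case False
  then have "idx16 r \<noteq> idx16 i" by (simp add: idx16_inj)
  from nu_M_off[OF idx16(1) idx16(1) this] show ?thesis using False
    by (simp add: rho_c_def Let_def idx16) (metis M_o10 inv_nu)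
qed

lemma eta_act_T: "eta_act nu sc act c (idx16 i) (T f v) = T (Pop (idx16 i) f) v
    + (\<Sum>r\<in>UNIV. T (xv r * f) (act (M r i) v)) - hscale sc (c / 2) (T (xv i * f) v)"
proof -
  let ?R = "\<lambda>r v. act (M r i) v - sc (if r = i then c / 2 else 0) v"
  have R: "?R r (v + w) = ?R r v + ?R r w" "?R r (sc a v) = sc a (?R r v)" for r v w a
    by (simp_all add: act_add_right act_sc M_o10 V.scale_right_distrib V.scale_right_diff_distrib mult.commute)
  have e: "eta_act nu sc act c (idx16 i) = tlift (\<lambda>f v. T (Pop (idx16 i) f) v + (\<Sum>r\<in>UNIV. T (xv r * f) (?R r v)))"
    unfolding eta_act_def sum_idx16 rho_root xv_def ..
  have "eta_act nu sc act c (idx16 i) (T f v) = T (Pop (idx16 i) f) v + (\<Sum>r\<in>UNIV. T (xv r * f) (?R r v))"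
    unfolding e
  proof (rule tlift_T)
    fix f g v w a
    show "T (Pop (idx16 i) (f + g)) v + (\<Sum>r\<in>UNIV. T (xv r * (f + g)) (?R r v))
      = T (Pop (idx16 i) f) v + (\<Sum>r\<in>UNIV. T (xv r * f) (?R r v)) + (T (Pop (idx16 i) g) v + (\<Sum>r\<in>UNIV. T (xv r * g) (?R r v)))"
      by (simp only: Pop_add T_add_left distrib_left sum.distrib add_ac)
    show "T (Pop (idx16 i) (cpoly a * f)) v + (\<Sum>r\<in>UNIV. T (xv r * (cpoly a * f)) (?R r v))
      = hscale sc a (T (Pop (idx16 i) f) v + (\<Sum>r\<in>UNIV. T (xv r * f) (?R r v)))"
      by (simp only: Pop_cpoly_mult T_cpoly mult.left_commute[of _ "cpoly a"] H.scale_right_distrib H.scale_sum_right)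
    show "T (Pop (idx16 i) f) (v + w) + (\<Sum>r\<in>UNIV. T (xv r * f) (?R r (v + w)))
      = T (Pop (idx16 i) f) v + (\<Sum>r\<in>UNIV. T (xv r * f) (?R r v)) + (T (Pop (idx16 i) f) w + (\<Sum>r\<in>UNIV. T (xv r * f) (?R r w)))"
      by (simp only: R T_add_right sum.distrib add_ac)
    show "T (Pop (idx16 i) f) (sc a v) + (\<Sum>r\<in>UNIV. T (xv r * f) (?R r (sc a v)))
      = hscale sc a (T (Pop (idx16 i) f) v + (\<Sum>r\<in>UNIV. T (xv r * f) (?R r v)))"
      by (simp only: R T_sc H.scale_right_distrib H.scale_sum_right)
  qed
  also have "(\<Sum>r\<in>UNIV. T (xv r * f) (?R r v)) = (\<Sum>r\<in>UNIV. T (xv r * f) (act (M r i) v)) - hscale sc (c / 2) (T (xv i * f) v)"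
  proof -
    have "T (xv r * f) (?R r v) = T (xv r * f) (act (M r i) v) - (if r = i then hscale sc (c / 2) (T (xv i * f) v) else 0)" for r
      using T_add_right[of "xv r * f" "?R r v" "sc (if r = i then c / 2 else 0) v"]
      by (auto simp: T_sc algebra_simps)
    then show ?thesis by (simp add: sum_subtractf)
  qed
  finally show ?thesis by (simp add: algebra_simps)
qed

lemma o10_act_T: "B \<in> o10 \<Longrightarrow> o10_act nu sc act B (T f v) = T (on_A (nu B) f) v + T f (act B v)"
  unfolding o10_act_def by (rule tlift_T)
    (simp_all add: on_A_add on_A_cpoly_mult act_add_right act_sc T_add_left T_add_right T_cpoly T_sc H.scale_right_distrib add_ac)

lemma o10_act_add: "B \<in> o10 \<Longrightarrow> o10_act nu sc act B (u + w) = o10_act nu sc act B u + o10_act nu sc act B w"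
  unfolding o10_act_def by (rule tlift_add) (simp add: act_add_right T_add_right add_ac)

lemma o10_act_sum: "B \<in> o10 \<Longrightarrow> o10_act nu sc act B (\<Sum>k\<in>I. f k) = (\<Sum>k\<in>I. o10_act nu sc act B (f k))"
proof (induction I rule: infinite_finite_induct)
  case (insert x I)
  then show ?case by (simp add: o10_act_add)
qed (use o10_act_add[of B 0 0] in simp_all)

end

lemma XU_zt: "(\<Sum>n\<in>UNIV. cpoly (XU a b m n) * zt n) = (if b = m then zt a else 0) - (if a + 5 = m then zt (b + 5) else 0)"
proof -
  have "cpoly (XU a b m n) * zt n = (if n = a then (if b = m then zt a else 0) else 0)
      - (if n = b + 5 then (if a + 5 = m then zt (b + 5) else 0) else 0)" for n
    by (auto simp: XU_def cpoly_simps left_diff_distrib)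
  then show ?thesis by (simp add: sum_subtractf)
qed

context hat_module
begin

lemma on_A_Fm: "on_A (nu (Fm a b)) f = (\<Sum>i\<in>UNIV. \<Sum>j\<in>UNIV. cpoly (XS a b i j) * xv j * dx i f)"
  unfolding on_A_def sum_idx16 phi_nu xv_def dx_def ..

text \<open>Realizes the abstract tensor product with the natural module inside the polynomials with
  coefficients in V. It is equivariant and injective, so singular vectors correspond.\<close>

definition emb :: "'v ^ 10 \<Rightarrow> 'v hat" where
  "emb u = (\<Sum>a\<in>UNIV. T (zt a) (u $ a))"

lemma emb_add: "emb (u + w) = emb u + emb w"
  by (simp add: emb_def T_add_right sum.distrib)

lemma emb_tsc: "emb (V.N.tsc a u) = hscale sc a (emb u)"
  by (simp add: emb_def T_sc H.scale_sum_right)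

lemma emb_0: "emb 0 = 0"
  by (simp add: emb_def T_0)

lemma T_XU: "(\<Sum>m\<in>UNIV. T ((\<Sum>n\<in>UNIV. cpoly (XU a b m n) * zt n) * h) (v m))
    = (\<Sum>n\<in>UNIV. T (zt n * h) (\<Sum>m\<in>UNIV. sc (XU a b m n) (v m)))"
proof -
  have "(\<Sum>m\<in>UNIV. T ((\<Sum>n\<in>UNIV. cpoly (XU a b m n) * zt n) * h) (v m))
      = (\<Sum>m\<in>UNIV. \<Sum>n\<in>UNIV. hscale sc (XU a b m n) (T (zt n * h) (v m)))"
    by (simp add: sum_distrib_right T_sum_left T_cpoly mult.assoc)
  also have "\<dots> = (\<Sum>n\<in>UNIV. \<Sum>m\<in>UNIV. hscale sc (XU a b m n) (T (zt n * h) (v m)))"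
    by (rule sum.swap)
  finally show ?thesis by (simp add: T_sum_right T_sc)
qed

lemma o10_act_emb: "o10_act nu sc act (Fm a b) (emb u) = emb (V.N.TF a b u)"
proof -
  have "o10_act nu sc act (Fm a b) (emb u) = (\<Sum>m\<in>UNIV. T ((\<Sum>n\<in>UNIV. cpoly (XU a b m n) * zt n) * 1) (u $ m)) + (\<Sum>m\<in>UNIV. T (zt m) (F a b (u $ m)))"
    unfolding emb_def
    by (simp add: o10_act_sum Fm_o10 o10_act_T on_A_Fm XS_zt XU_zt F_def sum.distrib)
  also have "\<dots> = emb (V.N.TF a b u)"
    unfolding T_XU by (simp add: emb_def V.N.TF_def T_add_right sum.distrib)
  finally show ?thesis .
qed

text \<open>The second derivatives of \<open>emb u\<close> are combinations of the components of \<open>u\<close>, which the trace form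
  of the Hessian matrices separates.\<close>

lemma emb_eq_0:
  assumes "emb u = 0"
  shows "u = 0"
proof -
  have 0: "(\<Sum>a\<in>UNIV. sc (Cm a $ i $ j) (u $ a)) = 0" for i j
  proof -
    have z: "xi_act sc k 0 = 0" for k using xi_act_add[of k 0 0] by simp
    have "xi_act sc (idx16 j) (xi_act sc (idx16 i) (emb u)) = (\<Sum>a\<in>UNIV. T (dx j (dx i (zt a))) (u $ a))"
      unfolding emb_def by (simp add: xi_act_sum xi_act_T dx_def)
    also have "\<dots> = (\<Sum>a\<in>UNIV. T (cpoly (Cm a $ i $ j) * 1) (u $ a))" by (simp add: dx_zt dx_grad)
    also have "\<dots> = T 1 (\<Sum>a\<in>UNIV. sc (Cm a $ i $ j) (u $ a))"
      unfolding T_cpoly T_sum_right T_sc ..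
    finally have "T 1 (\<Sum>a\<in>UNIV. sc (Cm a $ i $ j) (u $ a)) = 0" using assms z by simp
    then have "Poly_Mapping.lookup (T 1 (\<Sum>a\<in>UNIV. sc (Cm a $ i $ j) (u $ a))) 0 = 0" by simp
    then show ?thesis by (simp add: lookup_one)
  qed
  have "u $ b = 0" for b
  proof -
    have "(\<Sum>i\<in>UNIV. \<Sum>j\<in>UNIV. sc (Cm b $ i $ j) (\<Sum>a\<in>UNIV. sc (Cm a $ i $ j) (u $ a))) = 0"
      unfolding 0 by simp
    also have "(\<Sum>i\<in>UNIV. \<Sum>j\<in>UNIV. sc (Cm b $ i $ j) (\<Sum>a\<in>UNIV. sc (Cm a $ i $ j) (u $ a)))
        = (\<Sum>a\<in>UNIV. \<Sum>i\<in>UNIV. \<Sum>j\<in>UNIV. sc (Cm b $ i $ j * Cm a $ i $ j) (u $ a))"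
      unfolding V.scale_sum_right V.scale_scale
      by (subst (3) sum.swap, subst sum.swap, rule sum.cong[OF refl], rule sum.cong[OF refl], rule refl)
    also have "\<dots> = (\<Sum>a\<in>UNIV. sc (\<Sum>i\<in>UNIV. \<Sum>j\<in>UNIV. Cm b $ i $ j * Cm a $ i $ j) (u $ a))"
      by (simp add: V.scale_sum_left)
    also have "\<dots> = sc 8 (u $ b)"
      unfolding Cm_trace by (simp add: of_bool_def if_distrib[of "\<lambda>x. sc x _"] if_distrib[of "\<lambda>x. 8 * x"] cong: if_cong)
    finally show ?thesis by simp
  qed
  then show ?thesis by (simp add: vec_eq_iff)
qed

lemma emb_eq_iff: "emb u = emb w \<longleftrightarrow> u = w"
proof
  assume "emb u = emb w"
  then have "emb (u - w) = 0" using emb_add[of "u - w" w] by simp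
  from emb_eq_0[OF this] show "u = w" by simp
qed simp

lemma singular_vector_emb:
  "singular_vector (hscale sc) (o10_act nu sc act) \<mu> (emb u) \<longleftrightarrow> V.N.T.sing (wfun \<mu>) u"
proof -
  have "emb w = 0 \<longleftrightarrow> w = 0" for w using emb_eq_iff[of w 0] by (simp add: emb_0)
  then show ?thesis
    unfolding singular_vector_iff V.N.T.sing_iff o10_act_emb emb_tsc[symmetric] emb_eq_iff by simp
qed

lemma wt_eq: "V.N.wt j = wfun (lam + muU j)" "V.S.wt i = wfun (lam + muS i)"
  by (auto simp: fun_eq_iff V.N.wt_def V.S.wt_def wfun_add wfun_muU wfun_muS)

lemma T'_emb: "(\<Sum>i\<in>{1..10}. T' sc act i (u i)) = emb (V.N.Theta (\<chi> a. u (idx10 a)))"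
proof -
  have Fm: "Emat (idx10 a) (idx10 b) - Emat (prime10 (idx10 b)) (prime10 (idx10 a)) = Fm a b" for a b
    using Fm_eq_Emat[OF idx10(1) idx10(1), of a b] by (simp add: idx10)
  have "(\<Sum>i\<in>{1..10}. T' sc act i (u i)) = (\<Sum>a\<in>UNIV. \<Sum>b\<in>UNIV. T (zt b) (F a b (u (idx10 a))))"
    unfolding T'_def sum_idx10 Fm F_def zt_def ..
  also have "\<dots> = (\<Sum>b\<in>UNIV. \<Sum>a\<in>UNIV. T (zt b) (F a b (u (idx10 a))))" by (rule sum.swap)
  finally show ?thesis unfolding emb_def V.Theta_nth by (simp add: T_sum_right)
qed

lemma sum_zeta_emb: "(\<Sum>i\<in>{1..10}. T (zeta i) (u i)) = emb (\<chi> a. u (idx10 a))"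
  unfolding sum_idx10 emb_def zt_def by simp

lemma dominant_wt:
  assumes "lam + muU j \<in> dominant"
  shows "V.N.T.sing (V.N.wt j) (V.W j)"
  using V.W_singular_if_dominant dominant_nat[OF assms] unfolding wt_eq by blast

text \<open>Existence is provided by \<open>V.W j\<close>. The scalar is unique because
  \<open>Theta\<close>, as a Casimir expression, has the same eigenvalue on all singular vectors of
  this weight.\<close>

lemma flat_at_eq:
  assumes "lam + muU j \<in> dominant"
  shows "flat_at nu sc act (lam + muU j) = of_real (V.t j)"
  unfolding flat_at_def
proof (rule the_equality)
  have s: "V.N.T.sing (wfun (lam + muU j)) (V.W j)" using dominant_wt[OF assms] by (simp add: wt_eq)
  have "V.N.Theta (V.W j) = V.N.tsc (of_real (V.t j)) (V.W j)"
    using V.N.Theta_singular[OF s] unfolding V.t_def wt_eq .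
  moreover have "(\<chi> a. V.W j $ (of_nat (idx10 a))) = V.W j" by (simp add: idx10 vec_eq_iff)
  ultimately show "\<exists>u. singular_vector (hscale sc) (o10_act nu sc act) (lam + muU j) (\<Sum>i\<in>{1..10}. T (zeta i) (u i)) \<and>
        (\<Sum>i\<in>{1..10}. T' sc act i (u i)) = hscale sc (of_real (V.t j)) (\<Sum>i\<in>{1..10}. T (zeta i) (u i))"
    using s unfolding T'_emb sum_zeta_emb singular_vector_emb emb_tsc[symmetric] emb_eq_iff
    by (intro exI[of _ "\<lambda>n. V.W j $ of_nat n"]) simp
next
  fix b assume "\<exists>u. singular_vector (hscale sc) (o10_act nu sc act) (lam + muU j) (\<Sum>i\<in>{1..10}. T (zeta i) (u i)) \<and>
        (\<Sum>i\<in>{1..10}. T' sc act i (u i)) = hscale sc b (\<Sum>i\<in>{1..10}. T (zeta i) (u i))"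
  then obtain u where s: "V.N.T.sing (wfun (lam + muU j)) u" and e: "V.N.Theta u = V.N.tsc b u"
    unfolding T'_emb sum_zeta_emb singular_vector_emb emb_tsc[symmetric] emb_eq_iff by blast
  have "V.N.tsc b u = V.N.tsc (of_real (V.t j)) u"
    using V.N.Theta_singular[OF s] unfolding e V.t_def wt_eq .
  then show "b = of_real (V.t j)" using s by (simp add: V.N.T.sing_def)
qed

lemma flat_eq: "flat nu sc act lam = Min (V.t ` {j. lam + muU j \<in> dominant})"
proof -
  have "Upsilon' lam = (\<lambda>j. lam + muU j) ` {j. lam + muU j \<in> dominant}"
    unfolding Upsilon'_def range_muU[symmetric] by auto
  then have "(\<lambda>lam'. Re (flat_at nu sc act lam')) ` Upsilon' lam = V.t ` {j. lam + muU j \<in> dominant}"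
    by (auto simp: image_image flat_at_eq intro!: image_eqI)
  then show ?thesis unfolding flat_def by simp
qed

lemma t_minus_flat:
  assumes "lam + muU j \<in> dominant"
  shows "V.t j - flat nu sc act lam \<in> \<nat>"
proof -
  let ?S = "V.t ` {j. lam + muU j \<in> dominant}"
  have fin: "finite ?S" "V.t j \<in> ?S" using assms by auto
  then have "flat nu sc act lam \<in> ?S" unfolding flat_eq by (intro Min_in) auto
  then obtain k where k: "flat nu sc act lam = V.t k" by blast
  have z: "(\<Sum>r\<in>UNIV. of_bool (before r j)) \<in> (\<int> :: real set)" for j by (intro Ints_sum) auto
  have "V.t j - V.t k = (wfun lam j - wfun lam k) - ((\<Sum>r\<in>UNIV. of_bool (before r j)) - (\<Sum>r\<in>UNIV. of_bool (before r k)))"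
    by (simp add: V.t_eq)
  also have "\<dots> \<in> \<int>" by (intro Ints_diff dominant_int[OF lam] z)
  finally have "V.t j - flat nu sc act lam \<in> \<int>" unfolding k .
  moreover have "flat nu sc act lam \<le> V.t j" unfolding flat_eq using fin by (intro Min_le) auto
  ultimately show ?thesis by (simp add: Nats_iff)
qed

lemma Theta_N_injective:
  assumes "c \<notin> {complex_of_real (flat nu sc act lam) - 6 + of_nat n | n. True}"
    and "V.N.Theta w = V.N.tsc (c + 6 - of_nat n) w"
  shows "w = 0"
proof (rule ccontr)
  assume "w \<noteq> 0"
  from V.N.Theta_eigenvector[OF assms(2) this] obtain j where j: "c + 6 - of_nat n = of_real (V.t j)"
    "\<And>a b. pos a < pos b \<Longrightarrow> b \<noteq> a + 5 \<Longrightarrow> wfun (lam + muU j) a - wfun (lam + muU j) b \<in> \<nat>"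
    unfolding V.t_def wt_eq by blast
  \<comment> \<open>\<open>Theta_eigenvector\<close> controls only differences of coordinates;
    membership in \<open>dominant\<close> also requires half-integrality.\<close>
  have "2 * (lam + muU j) $ i \<in> \<int>" for i
  proof -
    have "2 * lam $ i \<in> \<int>" using lam by (simp add: dominant_def)
    moreover have "2 * muU j $ i \<in> \<int>" by (simp add: muU_def wU_def)
    ultimately show ?thesis by (simp add: distrib_left)
  qed
  then have "lam + muU j \<in> dominant" using j(2) by (intro dominantI)
  from t_minus_flat[OF this] obtain k where "V.t j - flat nu sc act lam = real k" by (auto elim: Nats_cases)
  then have "of_real (V.t j) = complex_of_real (flat nu sc act lam) + of_nat k"
    by (metis add.commute diff_add_cancel of_real_add of_real_of_nat_eq)
  then have "c = complex_of_real (flat nu sc act lam) - 6 + of_nat (k + n)"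
    using j(1) by (simp add: algebra_simps)
  then show False using assms(1) by blast
qed

lemma Theta_S_injective:
  assumes "c \<notin> {2 * complex_of_real (ell lam) + 2 * of_nat n | n. True}"
    and "V.S.Theta w = V.S.tsc (c / 2 - of_nat n) w"
  shows "w = 0"
proof (rule ccontr)
  assume "w \<noteq> 0"
  from V.S.Theta_eigenvector[OF assms(2) this] obtain i where i: "c / 2 - of_nat n = of_real (evS lam (lam + muS i))"
    "\<And>a b. pos a < pos b \<Longrightarrow> b \<noteq> a + 5 \<Longrightarrow> wfun (lam + muS i) a - wfun (lam + muS i) b \<in> \<nat>"
    unfolding evS_cas wt_eq by blast
  have "2 * (lam + muS i) $ k \<in> \<int>" for k
  proof -
    have "2 * lam $ k \<in> \<int>" using lam by (simp add: dominant_def)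
    moreover have "2 * muS i $ k \<in> \<int>" using Pi_A1_diff(4)[OF muS_Pi muS_Pi lam] .
    ultimately show ?thesis by (simp add: distrib_left)
  qed
  then have "lam + muS i \<in> dominant" using i(2) by (intro dominantI)
  then have "lam + muS i \<in> Upsilon lam" unfolding Upsilon_def using muS_Pi by blast
  from evS_ge_ell[OF lam this] obtain k where "evS lam (lam + muS i) - ell lam = real k" by (auto elim: Nats_cases)
  then have "of_real (evS lam (lam + muS i)) = complex_of_real (ell lam) + of_nat k"
    by (metis add.commute diff_add_cancel of_real_add of_real_of_nat_eq)
  then have "c = 2 * complex_of_real (ell lam) + 2 * of_nat (k + n)"
    using i(1) by (simp add: field_simps)
  then show False using assms(1) by blast
qed

end

section \<open>Submodules\<close>

text \<open>The last coordinate is the grading that separates the positive part, the degree 0 part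
  and the negative part.\<close>

lemma beta_6: "i \<in> {1..16} \<Longrightarrow> beta i $ 6 = 1"
  unfolding beta_eq using be_props(2)[of i] length_tables(1)[of i]
  by (auto dest!: list6 simp: vector_6 simp del: atLeastAtMost_iff)

lemma beta_inj: "i \<in> {1..16} \<Longrightarrow> j \<in> {1..16} \<Longrightarrow> beta i = beta j \<longleftrightarrow> i = j"
  by (simp add: beta_eq vector_inj6 length_tables be_inj del: atLeastAtMost_iff)

lemma beta_neq_minus: "i \<in> {1..16} \<Longrightarrow> j \<in> {1..16} \<Longrightarrow> beta i \<noteq> - beta j"
  using beta_6[of i] beta_6[of j] by auto

lemma beta_notin_Phi': "i \<in> {1..16} \<Longrightarrow> beta i \<notin> Phi'" "i \<in> {1..16} \<Longrightarrow> - beta i \<notin> Phi'"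
  using beta_6[of i] by (auto simp: Phi'_def)

lemma beta_Phi: "i \<in> {1..16} \<Longrightarrow> beta i \<in> Phi" "i \<in> {1..16} \<Longrightarrow> - beta i \<in> Phi"
proof -
  assume i: "i \<in> {1..16}"
  have q: "qform (beta i) (beta i) = 2"
    using qform_vector[OF length_tables(1) length_tables(1), OF i i] be_props(1)[OF i] by (simp add: beta_eq[OF i])
  moreover have "qform (- beta i) (- beta i) = qform (beta i) (beta i)" by (simp add: qform_def)
  ultimately show "beta i \<in> Phi" "- beta i \<in> Phi" by (simp_all add: Phi_def)
qed

context hat_module
begin

lemma G0_act_0: "G0_act nu sc act c 0 w = 0"
proof -
  have b: "bracket 0 (eta i) = 0" for i
    using bracket_Eroot[of 0 0 1 "- beta i"] by (simp add: eta_def)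
  have "on_A 0 f = 0" for f by (simp add: on_A_def phi_def b cpoly_simps)
  moreover have "rho_c nu sc act c 0 v = 0" for v
    using inv_nu[OF o10_0] by (simp add: rho_c_def nu_0 act_0)
  ultimately show ?thesis by (simp add: G0_act_def T_0 tlift_def)
qed

lemma G0_part_Eroot: "\<alpha> \<notin> Phi' \<Longrightarrow> G0_part (Eroot \<alpha>) = 0"
  by (simp add: G0_part_def Eroot_def zero_prod_def)

lemma E6_act_xi:
  assumes "i \<in> {1..16}"
  shows "E6_act nu sc act c (xi i) w = xi_act sc i w"
proof -
  have 1: "hscale sc (Poly_Mapping.lookup (snd (xi i)) (beta j)) (xi_act sc j w) = (if j = i then xi_act sc i w else 0)"
    if "j \<in> {1..16}" for j
    using beta_inj[OF assms that] by (auto simp: xi_def Eroot_def lookup_single when_def)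
  have 2: "hscale sc (Poly_Mapping.lookup (snd (xi i)) (- beta j)) (eta_act nu sc act c j w) = 0" if "j \<in> {1..16}" for j
    using beta_neq_minus[OF assms that] by (simp add: xi_def Eroot_def lookup_single when_def)
  have
    "(\<Sum>j = 1..16. hscale sc (Poly_Mapping.lookup (snd (xi i)) (beta j)) (xi_act sc j w)) = xi_act sc i w"
    "(\<Sum>j = 1..16. hscale sc (Poly_Mapping.lookup (snd (xi i)) (- beta j)) (eta_act nu sc act c j w)) = 0"
    subgoal using assms by (subst sum.cong[OF refl 1]) (simp_all del: One_nat_def atLeastAtMost_iff)
    subgoal by (intro sum.neutral ballI 2)
    done
  moreover have "G0_part (xi i) = 0"
    using assms by (simp add: xi_def G0_part_Eroot beta_notin_Phi' del: One_nat_def atLeastAtMost_iff)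
  ultimately show ?thesis unfolding E6_act_def by (simp add: G0_act_0)
qed

lemma E6_act_eta:
  assumes "i \<in> {1..16}"
  shows "E6_act nu sc act c (eta i) w = eta_act nu sc act c i w"
proof -
  have 1: "hscale sc (Poly_Mapping.lookup (snd (eta i)) (- beta j)) (eta_act nu sc act c j w) = (if j = i then eta_act nu sc act c i w else 0)"
    if "j \<in> {1..16}" for j
    using beta_inj[OF assms that] by (auto simp: eta_def Eroot_def lookup_single when_def)
  have 2: "hscale sc (Poly_Mapping.lookup (snd (eta i)) (beta j)) (xi_act sc j w) = 0" if "j \<in> {1..16}" for j
    using beta_neq_minus[OF that assms] by (auto simp: eta_def Eroot_def lookup_single when_def)
  have
    "(\<Sum>j = 1..16. hscale sc (Poly_Mapping.lookup (snd (eta i)) (- beta j)) (eta_act nu sc act c j w)) = eta_act nu sc act c i w"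
    "(\<Sum>j = 1..16. hscale sc (Poly_Mapping.lookup (snd (eta i)) (beta j)) (xi_act sc j w)) = 0"
    subgoal using assms by (subst sum.cong[OF refl 1]) (simp_all del: One_nat_def atLeastAtMost_iff)
    subgoal by (intro sum.neutral ballI 2)
    done
  moreover have "G0_part (eta i) = 0"
    using assms by (simp add: eta_def G0_part_Eroot beta_notin_Phi' del: One_nat_def atLeastAtMost_iff)
  ultimately show ?thesis unfolding E6_act_def by (simp add: G0_act_0)
qed

lemma E6_act_nu:
  assumes "B \<in> o10"
  shows "nu B \<in> GE6" "E6_act nu sc act c (nu B) (T 1 v) = T 1 (act B v)"
proof -
  have g: "nu B \<in> GD5" using assms bij_nu by (auto simp: bij_betw_def)
  then have k: "Poly_Mapping.keys (snd (nu B)) \<subseteq> Phi'" and f: "fst (nu B) $ 6 = 0" by (simp_all add: GD5_def)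
  show "nu B \<in> GE6" using k by (auto simp: GE6_def Phi'_def)
  have l: "Poly_Mapping.lookup (snd (nu B)) (beta j) = 0" "Poly_Mapping.lookup (snd (nu B)) (- beta j) = 0" if "j \<in> {1..16}" for j
    using k beta_notin_Phi'[OF that] by (auto simp: in_keys_iff subset_iff)
  have "G0_part (nu B) = nu B"
  proof (rule prod_eqI)
    have "Poly_Mapping.keys (snd (nu B)) \<inter> Phi' = Poly_Mapping.keys (snd (nu B))" using k by blast
    then show "snd (G0_part (nu B)) = snd (nu B)" by (simp add: G0_part_def poly_mapping_sum)
  qed (simp add: G0_part_def)
  moreover have "rho_c nu sc act c (nu B) v = act B v" for v
    by (simp add: rho_c_def f inv_nu assms)
  ultimately have "E6_act nu sc act c (nu B) (T 1 v) = tlift (\<lambda>f v. T (on_A (nu B) f) v + T f (act B v)) (T 1 v)"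
    unfolding E6_act_def G0_act_def using l by (simp del: atLeastAtMost_iff cong: sum.cong)
  also have "\<dots> = T (on_A (nu B) 1) v + T 1 (act B v)"
    by (rule tlift_T) (simp_all add: on_A_add on_A_cpoly_mult act_add_right act_sc assms T_add_left T_add_right T_cpoly T_sc H.scale_right_distrib add_ac)
  also have "on_A (nu B) 1 = 0"
    using pd_cpoly[of _ 1] by (simp add: on_A_def cpoly_simps)
  finally show "E6_act nu sc act c (nu B) (T 1 v) = T 1 (act B v)" by (simp add: T_0)
qed

lemma lookup_xi_act:
  "Poly_Mapping.lookup (xi_act sc (idx16 i) w) n
    = sc (of_nat (Suc (Poly_Mapping.lookup n i))) (Poly_Mapping.lookup w (n + Poly_Mapping.single i 1))"
proof -
  let ?e = "Poly_Mapping.single i 1 :: monomial"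
  have eq: "(m - ?e = n \<and> Poly_Mapping.lookup m i \<noteq> 0) \<longleftrightarrow> m = n + ?e" for m
  proof
    assume m: "m - ?e = n \<and> Poly_Mapping.lookup m i \<noteq> 0"
    then show "m = n + ?e"
      by (intro poly_mapping_eqI) (auto simp: lookup_add lookup_minus lookup_single when_def)
  qed (auto simp: lookup_add)
  have "Poly_Mapping.lookup (xi_act sc (idx16 i) w) n
      = (\<Sum>m\<in>Poly_Mapping.keys w. sc (Poly_Mapping.lookup (pd (idx16 i) (Poly_Mapping.single m 1)) n) (Poly_Mapping.lookup w m))"
    by (simp add: xi_act_def tlift_def lookup_sum)
  also have "\<dots> = (\<Sum>m\<in>Poly_Mapping.keys w. if m = n + ?e then sc (of_nat (Suc (Poly_Mapping.lookup n i))) (Poly_Mapping.lookup w m) else 0)"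
  proof (rule sum.cong[OF refl])
    fix m
    show "sc (Poly_Mapping.lookup (pd (idx16 i) (Poly_Mapping.single m 1)) n) (Poly_Mapping.lookup w m)
      = (if m = n + ?e then sc (of_nat (Suc (Poly_Mapping.lookup n i))) (Poly_Mapping.lookup w m) else 0)"
    proof (cases "m = n + ?e")
      case True
      then show ?thesis by (simp add: pd_single idx16 lookup_add)
    next
      case False
      then have "m - ?e \<noteq> n \<or> Poly_Mapping.lookup m i = 0" using eq[of m] by blast
      then show ?thesis using False by (auto simp: pd_single idx16 lookup_single when_def)
    qed
  qed
  also have "\<dots> = sc (of_nat (Suc (Poly_Mapping.lookup n i))) (Poly_Mapping.lookup w (n + ?e))"
    by (simp add: in_keys_iff)
  finally show ?thesis .
qed

definition submodule :: "'v hat set \<Rightarrow> bool" where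
  "submodule W \<longleftrightarrow> H.subspace W \<and> (\<forall>u\<in>GE6. \<forall>w\<in>W. E6_act nu sc act c u w \<in> W)"

lemma submodule_xi: "submodule W \<Longrightarrow> w \<in> W \<Longrightarrow> xi_act sc (idx16 i) w \<in> W"
  and submodule_eta: "submodule W \<Longrightarrow> w \<in> W \<Longrightarrow> eta_act nu sc act c (idx16 i) w \<in> W"
proof -
  have "xi (idx16 i) \<in> GE6" "eta (idx16 i) \<in> GE6"
    using beta_Phi[OF idx16(1)[of i]] by (auto simp: GE6_def xi_def eta_def Eroot_def)
  then show "submodule W \<Longrightarrow> w \<in> W \<Longrightarrow> xi_act sc (idx16 i) w \<in> W"
    "submodule W \<Longrightarrow> w \<in> W \<Longrightarrow> eta_act nu sc act c (idx16 i) w \<in> W"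
    unfolding submodule_def by (metis E6_act_xi E6_act_eta idx16(1))+
qed

lemma submodule_degree_0:
  assumes "submodule W" "w \<in> W" "w \<noteq> 0"
  shows "\<exists>v. v \<noteq> 0 \<and> T 1 v \<in> W"
proof -
  let ?deg = "\<lambda>m :: monomial. \<Sum>i\<in>UNIV. Poly_Mapping.lookup m i"
  \<comment> \<open>In characteristic 0 only constants have all partial derivatives 0, so repeated
    differentiation stops at a nonzero constant.\<close>
  have const: "w = T 1 (Poly_Mapping.lookup w 0)" if "\<And>i. xi_act sc (idx16 i) w = 0" for w
  proof (rule poly_mapping_eqI)
    fix m
    show "Poly_Mapping.lookup w m = Poly_Mapping.lookup (T 1 (Poly_Mapping.lookup w 0)) m"
    proof (cases "m = 0")
      case True
      then show ?thesis by (simp add: lookup_one)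
    next
      case False
      then obtain i where i: "Poly_Mapping.lookup m i \<noteq> 0" by (metis lookup_zero poly_mapping_eqI)
      then have "m = (m - Poly_Mapping.single i 1) + Poly_Mapping.single i 1"
        by (intro poly_mapping_eqI) (auto simp: lookup_add lookup_minus lookup_single when_def)
      then have "Poly_Mapping.lookup w m = 0"
        using lookup_xi_act[of i w "m - Poly_Mapping.single i 1"] that[of i] by (simp del: of_nat_Suc)
      then show ?thesis using False by (simp add: lookup_one)
    qed
  qed
  have "\<exists>v. v \<noteq> 0 \<and> T 1 v \<in> W" if "w \<in> W" "w \<noteq> 0" "\<forall>m\<in>Poly_Mapping.keys w. ?deg m < k" for k w
    using that
  proof (induction k arbitrary: w)
    case 0
    then have "Poly_Mapping.keys w = {}" by auto
    then show ?case using 0 by simp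
  next
    case (Suc k)
    show ?case
    proof (cases "\<forall>i. xi_act sc (idx16 i) w = 0")
      case True
      then show ?thesis using const[of w] Suc.prems by (metis T_0(2))
    next
      case False
      then obtain i where i: "xi_act sc (idx16 i) w \<noteq> 0" by blast
      have "\<forall>n\<in>Poly_Mapping.keys (xi_act sc (idx16 i) w). ?deg n < k"
      proof
        fix n assume "n \<in> Poly_Mapping.keys (xi_act sc (idx16 i) w)"
        then have "Poly_Mapping.lookup w (n + Poly_Mapping.single i 1) \<noteq> 0"
          unfolding in_keys_iff lookup_xi_act by (metis V.scale_zero_right)
        then have "?deg (n + Poly_Mapping.single i 1) < Suc k" using Suc.prems(3) by (simp add: in_keys_iff)
        then show "?deg n < k" by (simp add: lookup_add sum.distrib lookup_single when_def)
      qed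
      then show ?thesis by (rule Suc.IH[OF submodule_xi[OF assms(1) Suc.prems(1)] i])
    qed
  qed
  note nilp = this
  have "\<forall>m\<in>Poly_Mapping.keys w. ?deg m < Suc (Max (?deg ` Poly_Mapping.keys w))"
  proof
    fix m assume "m \<in> Poly_Mapping.keys w"
    then have "?deg m \<le> Max (?deg ` Poly_Mapping.keys w)"
      by (intro Max_ge finite_imageI finite_keys imageI)
    then show "?deg m < Suc (Max (?deg ` Poly_Mapping.keys w))" by (rule le_imp_less_Suc)
  qed
  then show ?thesis by (rule nilp[OF assms(2,3)])
qed

lemma submodule_V:
  assumes "submodule W" "w \<in> W" "w \<noteq> 0"
  shows "T 1 v \<in> W"
proof -
  have W: "H.subspace W" using assms(1) by (simp add: submodule_def)
  have "V.stable {v. T 1 v \<in> W}"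
    unfolding V.stable_def V.subspace_def
  proof (intro conjI allI ballI; clarsimp simp: T_0 T_add_right T_sc H.subspace_0[OF W] H.subspace_add[OF W] H.subspace_scale[OF W])
    fix a b v assume "T 1 v \<in> W"
    then have "E6_act nu sc act c (nu (Fm a b)) (T 1 v) \<in> W"
      using assms(1) E6_act_nu(1)[OF Fm_o10] by (simp add: submodule_def)
    then show "T 1 (F a b v) \<in> W" by (simp add: E6_act_nu(2)[OF Fm_o10] F_def)
  qed
  then show ?thesis
    using submodule_degree_0[OF assms] V.stable_eq_UNIV[of "{v. T 1 v \<in> W}"] by blast
qed

definition J :: "'v hat set \<Rightarrow> poly16 set" where
  "J W = {f. \<forall>v. T f v \<in> W}"

lemma J_closed:
  assumes "submodule W"
  shows "0 \<in> J W" "f \<in> J W \<Longrightarrow> g \<in> J W \<Longrightarrow> f + g \<in> J W" "f \<in> J W \<Longrightarrow> cpoly a * f \<in> J W"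
    "(\<And>k. k \<in> I \<Longrightarrow> h k \<in> J W) \<Longrightarrow> (\<Sum>k\<in>I. h k) \<in> J W"
proof -
  have W: "H.subspace W" using assms by (simp add: submodule_def)
  show "0 \<in> J W" "f \<in> J W \<Longrightarrow> g \<in> J W \<Longrightarrow> f + g \<in> J W" "f \<in> J W \<Longrightarrow> cpoly a * f \<in> J W"
    using W by (auto simp: J_def T_0 T_add_left T_cpoly H.subspace_0 H.subspace_add H.subspace_scale)
  show "(\<And>k. k \<in> I \<Longrightarrow> h k \<in> J W) \<Longrightarrow> (\<Sum>k\<in>I. h k) \<in> J W"
    using W by (auto simp: J_def T_sum_left intro: H.subspace_sum)
qed

text \<open>Although \<open>zt m * h\<close> has degree n + 2, the products
  \<open>grad m i * h\<close> have degree n + 1 and are covered by the hypothesis. Surjectivity of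
  \<open>Theta\<close> minus c + 6 - n then isolates a single quadric.\<close>

lemma zt_mult_J:
  assumes W: "submodule W" and h: "homog n h" and IH: "\<And>f. homog (Suc n) f \<Longrightarrow> f \<in> J W"
    and c: "c \<notin> {complex_of_real (flat nu sc act lam) - 6 + of_nat n | n. True}"
  shows "zt m * h \<in> J W"
proof -
  have S: "H.subspace W" using W by (simp add: submodule_def)
  have D: "(\<Sum>a\<in>UNIV. T (zt a * h) (V.N.Theta u $ a - sc (c + 6 - of_nat n) (u $ a))) \<in> W" for u
  proof -
    let ?e = "\<lambda>i f v. eta_act nu sc act c (idx16 i) (T f v)"
    have "(\<Sum>m\<in>UNIV. \<Sum>i\<in>UNIV. ?e i (grad m i * h) (u $ m)) \<in> W"
      using IH[OF homog_grad_mult[OF h]] by (intro H.subspace_sum[OF S] submodule_eta[OF W]) (auto simp: J_def)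
    also have "(\<Sum>m\<in>UNIV. \<Sum>i\<in>UNIV. ?e i (grad m i * h) (u $ m))
        = (\<Sum>m\<in>UNIV. T (\<Sum>i\<in>UNIV. Pop (idx16 i) (grad m i * h)) (u $ m))
         + (\<Sum>m\<in>UNIV. \<Sum>i\<in>UNIV. \<Sum>r\<in>UNIV. T (xv r * (grad m i * h)) (act (M r i) (u $ m)))
         - (\<Sum>m\<in>UNIV. hscale sc (c / 2) (T ((\<Sum>i\<in>UNIV. xv i * grad m i) * h) (u $ m)))"
      unfolding eta_act_T sum_subtractf sum.distrib T_sum_left
      by (simp add: sum_distrib_right T_sum_left H.scale_sum_right mult.assoc)
    also have "(\<Sum>m\<in>UNIV. T (\<Sum>i\<in>UNIV. Pop (idx16 i) (grad m i * h)) (u $ m))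
        = (\<Sum>m\<in>UNIV. T (zt m * h) (sc (of_nat n - 6) (u $ m)))"
    proof -
      have "of_nat n - 6 = cpoly (of_nat n - 6)" by (simp add: cpoly_simps)
      then show ?thesis unfolding Pop_gradient[OF homog_eul[OF h]] by (simp add: T_cpoly T_sc)
    qed
    also have "(\<Sum>m\<in>UNIV. hscale sc (c / 2) (T ((\<Sum>i\<in>UNIV. xv i * grad m i) * h) (u $ m)))
        = (\<Sum>m\<in>UNIV. T (zt m * h) (sc c (u $ m)))"
    proof -
      have "T (2 * zt m * h) v = hscale sc 2 (T (zt m * h) v)" for m v
        using T_cpoly[of 2 "zt m * h" v] by (simp add: cpoly_simps mult.assoc)
      then show ?thesis unfolding euler by (simp add: T_sc)
    qed
    also have "(\<Sum>m\<in>UNIV. \<Sum>i\<in>UNIV. \<Sum>r\<in>UNIV. T (xv r * (grad m i * h)) (act (M r i) (u $ m)))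
        = (\<Sum>a\<in>UNIV. T (zt a * h) (V.N.Theta u $ a))"
    proof -
      have "(\<Sum>i\<in>UNIV. \<Sum>r\<in>UNIV. T (xv r * (grad m i * h)) (act (M r i) (u $ m)))
          = hscale sc (1/2) (\<Sum>a\<in>UNIV. \<Sum>b\<in>UNIV. T ((\<Sum>i\<in>UNIV. \<Sum>r\<in>UNIV. cpoly (XS a b i r) * xv r * dx i (zt m)) * h) (F b a (u $ m)))" for m
      proof -
        have "(\<Sum>i\<in>UNIV. \<Sum>r\<in>UNIV. T (xv r * (grad m i * h)) (act (M r i) (u $ m)))
            = hscale sc (1/2) (\<Sum>i\<in>UNIV. \<Sum>r\<in>UNIV. \<Sum>a\<in>UNIV. \<Sum>b\<in>UNIV. hscale sc (XS a b i r) (T (xv r * grad m i * h) (F b a (u $ m))))"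
          by (simp add: act_M T_sc T_sum_right H.scale_sum_right mult.assoc)
        also have "(\<Sum>i\<in>UNIV. \<Sum>r\<in>UNIV. \<Sum>a\<in>UNIV. \<Sum>b\<in>UNIV. hscale sc (XS a b i r) (T (xv r * grad m i * h) (F b a (u $ m))))
            = (\<Sum>a\<in>UNIV. \<Sum>b\<in>UNIV. \<Sum>i\<in>UNIV. \<Sum>r\<in>UNIV. hscale sc (XS a b i r) (T (xv r * grad m i * h) (F b a (u $ m))))"
          (is "(\<Sum>i\<in>UNIV. \<Sum>r\<in>UNIV. \<Sum>a\<in>UNIV. \<Sum>b\<in>UNIV. ?f i r a b) = _")
        proof -
          have "(\<Sum>i\<in>UNIV. \<Sum>r\<in>UNIV. \<Sum>a\<in>UNIV. \<Sum>b\<in>UNIV. ?f i r a b) = (\<Sum>i\<in>UNIV. \<Sum>a\<in>UNIV. \<Sum>r\<in>UNIV. \<Sum>b\<in>UNIV. ?f i r a b)"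
            by (rule sum.cong[OF refl], rule sum.swap)
          also have "\<dots> = (\<Sum>a\<in>UNIV. \<Sum>i\<in>UNIV. \<Sum>r\<in>UNIV. \<Sum>b\<in>UNIV. ?f i r a b)" by (rule sum.swap)
          also have "\<dots> = (\<Sum>a\<in>UNIV. \<Sum>i\<in>UNIV. \<Sum>b\<in>UNIV. \<Sum>r\<in>UNIV. ?f i r a b)"
            by (rule sum.cong[OF refl], rule sum.cong[OF refl], rule sum.swap)
          also have "\<dots> = (\<Sum>a\<in>UNIV. \<Sum>b\<in>UNIV. \<Sum>i\<in>UNIV. \<Sum>r\<in>UNIV. ?f i r a b)"
            by (rule sum.cong[OF refl], rule sum.swap)
          finally show ?thesis .
        qed
        also have "\<dots> = (\<Sum>a\<in>UNIV. \<Sum>b\<in>UNIV. T ((\<Sum>i\<in>UNIV. \<Sum>r\<in>UNIV. cpoly (XS a b i r) * xv r * dx i (zt m)) * h) (F b a (u $ m)))"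
          by (simp add: sum_distrib_right T_sum_left T_cpoly dx_zt mult.assoc)
        finally show ?thesis .
      qed
      then have "(\<Sum>m\<in>UNIV. \<Sum>i\<in>UNIV. \<Sum>r\<in>UNIV. T (xv r * (grad m i * h)) (act (M r i) (u $ m)))
          = hscale sc (1/2) (\<Sum>m\<in>UNIV. \<Sum>a\<in>UNIV. \<Sum>b\<in>UNIV. T ((\<Sum>n\<in>UNIV. cpoly (XU a b m n) * zt n) * h) (F b a (u $ m)))"
        by (simp only: XS_zt XU_zt H.scale_sum_right)
      also have "(\<Sum>m\<in>UNIV. \<Sum>a\<in>UNIV. \<Sum>b\<in>UNIV. T ((\<Sum>n\<in>UNIV. cpoly (XU a b m n) * zt n) * h) (F b a (u $ m)))
          = (\<Sum>a\<in>UNIV. \<Sum>m\<in>UNIV. \<Sum>b\<in>UNIV. T ((\<Sum>n\<in>UNIV. cpoly (XU a b m n) * zt n) * h) (F b a (u $ m)))"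
        by (rule sum.swap)
      also have "\<dots> = (\<Sum>a\<in>UNIV. \<Sum>b\<in>UNIV. \<Sum>m\<in>UNIV. T ((\<Sum>n\<in>UNIV. cpoly (XU a b m n) * zt n) * h) (F b a (u $ m)))"
        by (rule sum.cong[OF refl], rule sum.swap)
      also have "\<dots> = (\<Sum>a\<in>UNIV. \<Sum>b\<in>UNIV. \<Sum>n\<in>UNIV. T (zt n * h) (\<Sum>m\<in>UNIV. sc (XU a b m n) (F b a (u $ m))))"
        unfolding T_XU ..
      also have "\<dots> = (\<Sum>a\<in>UNIV. \<Sum>n\<in>UNIV. \<Sum>b\<in>UNIV. T (zt n * h) (\<Sum>m\<in>UNIV. sc (XU a b m n) (F b a (u $ m))))"
        by (rule sum.cong[OF refl], rule sum.swap)
      also have "\<dots> = (\<Sum>n\<in>UNIV. \<Sum>a\<in>UNIV. \<Sum>b\<in>UNIV. T (zt n * h) (\<Sum>m\<in>UNIV. sc (XU a b m n) (F b a (u $ m))))"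
        by (rule sum.swap)
      finally show ?thesis by (simp add: V.N.Theta_def T_sum_right T_sc H.scale_sum_right)
    qed
    also have "(\<Sum>m\<in>UNIV. T (zt m * h) (sc (of_nat n - 6) (u $ m))) + (\<Sum>a\<in>UNIV. T (zt a * h) (V.N.Theta u $ a)) - (\<Sum>m\<in>UNIV. T (zt m * h) (sc c (u $ m)))
        = (\<Sum>a\<in>UNIV. T (zt a * h) (V.N.Theta u $ a - sc (c + 6 - of_nat n) (u $ a)))"
    proof -
      have "T f (V.N.Theta u $ a - sc (c + 6 - of_nat n) (u $ a))
          = T f (sc (of_nat n - 6) (u $ a)) + T f (V.N.Theta u $ a) - T f (sc c (u $ a))" for f a
      proof -
        have "V.N.Theta u $ a - sc (c + 6 - of_nat n) (u $ a) + sc c (u $ a) = sc (of_nat n - 6) (u $ a) + V.N.Theta u $ a"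
          by (simp add: V.scale_left_distrib V.scale_left_diff_distrib algebra_simps)
        then show ?thesis by (metis T_add_right add_diff_cancel_right')
      qed
      then show ?thesis by (simp add: sum.distrib sum_subtractf)
    qed
    finally show ?thesis .
  qed
  have "T (zt m * h) v \<in> W" for v
  proof -
    obtain u where u: "V.N.Theta u - V.N.tsc (c + 6 - of_nat n) u = axis m v"
      using V.N.Theta_surj[OF Theta_N_injective[OF c, of _ n]] by blast
    have "V.N.Theta u $ a - sc (c + 6 - of_nat n) (u $ a) = (if a = m then v else 0)" for a
      using arg_cong[OF u, of "\<lambda>w. w $ a"] by (simp add: axis_def)
    then have "(\<Sum>a\<in>UNIV. T (zt a * h) (if a = m then v else 0)) \<in> W" using D[of u] by simp
    then show ?thesis by (simp add: if_distrib[of "T _"] T_0 cong: if_cong)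
  qed
  then show ?thesis by (simp add: J_def)
qed

text \<open>The part of \<open>Pop i g\<close> in the ideal of the quadrics has derivatives of g as
  cofactors, of degree n - 1, so \<open>zt_mult_J\<close> applies under the same hypothesis. Adding
  it back leaves only multiples of the products \<open>xv r * g\<close>.\<close>

lemma xv_mult_J:
  assumes W: "submodule W" and g: "homog n g" and IH: "\<And>f. homog n f \<Longrightarrow> f \<in> J W"
    and c1: "c \<notin> {complex_of_real (flat nu sc act lam) - 6 + of_nat n | n. True}"
    and c2: "c \<notin> {2 * complex_of_real (ell lam) + 2 * of_nat n | n. True}"
  shows "xv i * g \<in> J W"
proof -
  have S: "H.subspace W" using W by (simp add: submodule_def)
  let ?q = "\<lambda>i. \<Sum>a\<in>UNIV. zt a * (\<Sum>j\<in>UNIV. cpoly (Cm a $ i $ j) * dx j g)"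
  have q: "?q i \<in> J W" for i
  proof -
    have "zt a * (\<Sum>j\<in>UNIV. cpoly (Cm a $ i $ j) * dx j g) \<in> J W" for a
    proof (cases n)
      case 0
      then have "dx j g = 0" for j using homog_dx[OF g] by blast
      then show ?thesis using J_closed(1)[OF W] by simp
    next
      case (Suc k)
      then have "homog k (\<Sum>j\<in>UNIV. cpoly (Cm a $ i $ j) * dx j g)"
        using homog_dx[OF g] by (intro homog_sum homog_cpoly_mult) blast
      then show ?thesis using IH Suc by (intro zt_mult_J[OF W _ _ c1]) auto
    qed
    then show ?thesis by (intro J_closed(4)[OF W])
  qed
  have D: "(\<Sum>r\<in>UNIV. T (xv r * g) (V.S.Theta u $ r - sc (c / 2 - of_nat n) (u $ r))) \<in> W" for u
  proof -
    let ?e = "\<lambda>i. eta_act nu sc act c (idx16 i) (T g (u $ i)) + T (?q i) (u $ i)"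
    have "(\<Sum>i\<in>UNIV. ?e i) \<in> W"
      using IH[OF g] q by (intro H.subspace_sum[OF S] H.subspace_add[OF S] submodule_eta[OF W]) (auto simp: J_def)
    also have "(\<Sum>i\<in>UNIV. ?e i) = (\<Sum>i\<in>UNIV. T (xv i * g) (sc (of_nat n) (u $ i)))
        + (\<Sum>i\<in>UNIV. \<Sum>r\<in>UNIV. T (xv r * g) (act (M r i) (u $ i))) - (\<Sum>i\<in>UNIV. T (xv i * g) (sc (c / 2) (u $ i)))"
    proof -
      have "Pop (idx16 i) g = cpoly (of_nat n) * (xv i * g) - ?q i" for i
        unfolding Pop_eq homog_eul[OF g] by (simp add: cpoly_simps mult.left_commute)
      then have "?e i = T (xv i * g) (sc (of_nat n) (u $ i)) + (\<Sum>r\<in>UNIV. T (xv r * g) (act (M r i) (u $ i)))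
          - T (xv i * g) (sc (c / 2) (u $ i))" for i
        unfolding eta_act_T by (simp add: T_diff_left T_cpoly T_sc)
      then show ?thesis by (simp add: sum.distrib sum_subtractf)
    qed
    also have "(\<Sum>i\<in>UNIV. \<Sum>r\<in>UNIV. T (xv r * g) (act (M r i) (u $ i))) = (\<Sum>r\<in>UNIV. T (xv r * g) (V.S.Theta u $ r))"
    proof -
      have t: "(\<Sum>i\<in>UNIV. act (M r i) (u $ i)) = V.S.Theta u $ r" for r
      proof -
        have "(\<Sum>i\<in>UNIV. act (M r i) (u $ i)) = sc (1/2) (\<Sum>i\<in>UNIV. \<Sum>a\<in>UNIV. \<Sum>b\<in>UNIV. sc (XS a b i r) (F b a (u $ i)))"
          unfolding act_M V.scale_sum_right ..
        also have "(\<Sum>i\<in>UNIV. \<Sum>a\<in>UNIV. \<Sum>b\<in>UNIV. sc (XS a b i r) (F b a (u $ i)))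
            = (\<Sum>a\<in>UNIV. \<Sum>i\<in>UNIV. \<Sum>b\<in>UNIV. sc (XS a b i r) (F b a (u $ i)))" by (rule sum.swap)
        also have "\<dots> = (\<Sum>a\<in>UNIV. \<Sum>b\<in>UNIV. \<Sum>i\<in>UNIV. sc (XS a b i r) (F b a (u $ i)))"
          by (rule sum.cong[OF refl], rule sum.swap)
        finally show ?thesis by (simp add: V.S.Theta_def)
      qed
      show ?thesis unfolding t[symmetric] T_sum_right by (rule sum.swap)
    qed
    also have "(\<Sum>i\<in>UNIV. T (xv i * g) (sc (of_nat n) (u $ i))) + (\<Sum>r\<in>UNIV. T (xv r * g) (V.S.Theta u $ r)) - (\<Sum>i\<in>UNIV. T (xv i * g) (sc (c / 2) (u $ i)))
        = (\<Sum>r\<in>UNIV. T (xv r * g) (V.S.Theta u $ r - sc (c / 2 - of_nat n) (u $ r)))"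
    proof -
      have "T f (V.S.Theta u $ a - sc (c / 2 - of_nat n) (u $ a))
          = T f (sc (of_nat n) (u $ a)) + T f (V.S.Theta u $ a) - T f (sc (c / 2) (u $ a))" for f a
      proof -
        have "V.S.Theta u $ a - sc (c / 2 - of_nat n) (u $ a) + sc (c / 2) (u $ a) = sc (of_nat n) (u $ a) + V.S.Theta u $ a"
          by (simp add: V.scale_left_diff_distrib algebra_simps)
        then show ?thesis by (metis T_add_right add_diff_cancel_right')
      qed
      then show ?thesis by (simp add: sum.distrib sum_subtractf)
    qed
    finally show ?thesis .
  qed
  have "T (xv i * g) v \<in> W" for v
  proof -
    obtain u where u: "V.S.Theta u - V.S.tsc (c / 2 - of_nat n) u = axis i v"
      using V.S.Theta_surj[OF Theta_S_injective[OF c2, of _ n]] by blast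
    have "V.S.Theta u $ a - sc (c / 2 - of_nat n) (u $ a) = (if a = i then v else 0)" for a
      using arg_cong[OF u, of "\<lambda>w. w $ a"] by (simp add: axis_def)
    then have "(\<Sum>a\<in>UNIV. T (xv a * g) (if a = i then v else 0)) \<in> W" using D[of u] by simp
    then show ?thesis by (simp add: if_distrib[of "T _"] T_0 cong: if_cong)
  qed
  then show ?thesis by (simp add: J_def)
qed

lemma homog_J:
  assumes W: "submodule W" "\<And>v. T 1 v \<in> W"
    and c: "c \<notin> {complex_of_real (flat nu sc act lam) - 6 + of_nat n | n. True}"
      "c \<notin> {2 * complex_of_real (ell lam) + 2 * of_nat n | n. True}"
  shows "homog n f \<Longrightarrow> f \<in> J W"
proof (induction n arbitrary: f)
  case 0
  have "homog k f \<Longrightarrow> k = 0 \<Longrightarrow> f \<in> J W" for k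
  proof (induction rule: homog.induct)
    case (const a)
    have "1 \<in> J W" using W(2) by (simp add: J_def)
    from J_closed(3)[OF W(1) this, of a] show ?case by simp
  qed (auto intro: J_closed[OF W(1)])
  then show ?case using 0 by blast
next
  case (Suc n)
  obtain g where g: "\<And>i. homog n (g i)" "f = (\<Sum>i\<in>UNIV. xv i * g i)" using homog_Suc[OF Suc.prems] by blast
  show ?case unfolding g(2)
    by (intro J_closed(4)[OF W(1)] xv_mult_J[OF W(1) g(1) Suc.IH c])
qed

theorem irreducible_hat:
  assumes c: "c \<notin> {complex_of_real (flat nu sc act lam) - 6 + of_nat n | n. True}"
      "c \<notin> {2 * complex_of_real (ell lam) + 2 * of_nat n | n. True}"
  shows "irreducible_module GE6 (hscale sc) (E6_act nu sc act c)"
  unfolding irreducible_module_def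
proof (intro conjI allI impI)
  have "Poly_Mapping.lookup (T 1 v0) 0 \<noteq> 0" using V.sing_v by (simp add: V.sing_def lookup_one)
  then show "\<exists>w::'v hat. w \<noteq> 0" by (metis lookup_zero)
next
  fix W assume "H.subspace W \<and> (\<forall>x\<in>GE6. \<forall>w\<in>W. E6_act nu sc act c x w \<in> W)"
  then have W: "submodule W" and S: "H.subspace W" by (simp_all add: submodule_def)
  show "W = {0} \<or> W = UNIV"
  proof (cases "W = {0}")
    case False
    then obtain w where "w \<in> W" "w \<noteq> 0" using H.subspace_0[OF S] by blast
    then have V: "T 1 v \<in> W" for v using submodule_V[OF W] by blast
    have "w \<in> W" for w
    proof -
      have "T (Poly_Mapping.single m 1) v \<in> W" for m v
        using monomial_homog[of m] homog_J[OF W V c] by (auto simp: J_def)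
      then show ?thesis by (subst T_decomposition) (intro H.subspace_sum[OF S])
    qed
    then show ?thesis by blast
  qed simp
qed

end

theorem theorem6p4:
  fixes lam :: "real ^ 5" and c :: complex
    and nu :: "mat10 \<Rightarrow> e6"
    and sc :: "complex \<Rightarrow> 'v::ab_group_add \<Rightarrow> 'v"
    and act :: "mat10 \<Rightarrow> 'v \<Rightarrow> 'v"
  assumes "lam \<in> dominant"
    and "is_nu nu"
    and "is_irreducible_highest_weight_module sc act lam"
    and "c \<notin> {complex_of_real (flat nu sc act lam) - 6 + of_nat n | n. True}
             \<union> {2 * complex_of_real (ell lam) + 2 * of_nat n | n. True}"
  shows "irreducible_module GE6 (hscale sc) (E6_act nu sc act c)"
proof -
  interpret hat_module nu sc act lam c
    by unfold_locales (rule assms)+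
  show ?thesis using assms(4) by (intro irreducible_hat) blast+
qed

end
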